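(* There are universal constants $c_1\ge1$ and $c_2\ge2c_1$ such that the following holds. Let $\mathbf A\in\mathbb{F}^{d^n\times d^n}$ be positive semidefinite (psd), fix an error level $\varepsilon\in(0,1/2)$, and consider the rMPS Nyström++ estimator $\widehat{\operatorname{Tr}}_{\mathrm N++}$ with $k$ matrix–vector products for low-rank approximation and $\ell$ matrix–vector products for residual trace estimation. If the bond dimension satisfies $c_1n/\varepsilon\le\chi\le c_2n/\varepsilon$ and $k=\ell$ with $c_1/\varepsilon\le k\le c_2/\varepsilon$, then $$\left|\widehat{\operatorname{Tr}}_{\mathrm N++}-\operatorname{Tr}(\mathbf A)\right|\le\varepsilon\operatorname{Tr}(\mathbf A)\quad\text{with probability at least }0.98 .$$
   Context: $\mathbb{F}\in\{\mathbb{R},\mathbb{C}\}$. rMPS: Let $d,\chi\ge1$, $n\ge2$ be integers. An rMPS (random matrix product state) over $\mathbb{F}$ of order $n$, physical dimension $d$, bond dimension $\chi$ is the random vector in $\mathbb{F}^{d^n}$ with entries $\boldsymbol\omega(i_1,\dots,i_n)=\sum_{\alpha_1,\dots,\alpha_{n-1}=1}^{\chi}G_1(i_1,\alpha_1)G_2(\alpha_1,i_2,\alpha_2)\cdots G_{n-1}(\alpha_{n-2},i_{n-1},\alpha_{n-1})G_n(\alpha_{n-1},i_n)$, $(i_1,\dots,i_n)\in\{1,\dots,d\}^n$, where $G_1\in\mathbb{F}^{d\times\chi}$, $G_n\in\mathbb{F}^{\chi\times d}$, $G_p\in\mathbb{F}^{\chi\times d\times\chi}$ ($1<p<n$) have independent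 entries, those of $G_p$ with law $\mathcal N_{\mathbb F}(0,\sigma_p^2)$, $\sigma_p^2=1/\chi$ for $1<p<n$ and $\sigma_p^2=1/\sqrt\chi$ for $p\in\{1,n\}$. ($\mathcal N_{\mathbb C}(0,\sigma^2)$ is the law of $g_1+\mathrm{i}g_2$ with $g_1,g_2$ independent $\mathcal N_{\mathbb R}(0,\sigma^2/2)$.) Nyström++ estimator: let $\boldsymbol\omega_1,\dots,\boldsymbol\omega_k,\boldsymbol\psi_1,\dots,\boldsymbol\psi_\ell$ be iid rMPS vectors of bond dimension $\chi$, let $\mathbf\Omega=k^{-1/2}[\boldsymbol\omega_1,\dots,\boldsymbol\omega_k]$, and let $\mathbf A\langle\mathbf\Omega\rangle=\mathbf A\mathbf\Omega(\mathbf\Omega^*\mathbf A\mathbf\Omega)^+\mathbf\Omega^*\mathbf A$ ($^+$ the Moore–Penrose pseudoinverse). Then $$\widehat{\operatorname{Tr}}_{\mathrm N++}=\operatorname{Tr}(\mathbf A\langle\mathbf\Omega\rangle)+\frac1\ell\sum_{i=1}^{\ell}\boldsymbol\psi_i^*(\mathbf A-\mathbf A\langle\mathbf\Omega\rangle)\boldsymbol\psi_i .$$ *)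

theory Defs
  imports "HOL-Probability.Probability" "Jordan_Normal_Form.Schur_Decomposition"
begin

section \<open>Matrices over the reals and the complex numbers\<close>

text \<open>
  The real and the complex case are treated uniformly: \<^const>\<open>conjugate\<close> is the identity on the
  reals and complex conjugation on the complex numbers, so \<^const>\<open>mat_adjoint\<close> is the transpose
  resp. the conjugate transpose, and \<open>(B *\<^sub>v v) \<bullet>c v\<close> is $v^* B v$.
\<close>

definition mat_trace :: "'a :: comm_monoid_add mat \<Rightarrow> 'a" where
  "mat_trace A = (\<Sum>i<dim_row A. A $$ (i, i))"

definition hermitian_mat :: "'a :: conjugatable_field mat \<Rightarrow> bool" where
  "hermitian_mat A \<longleftrightarrow> mat_adjoint A = A"

text \<open>
  The order on the complex numbers is the one of \<^theory>\<open>HOL-Library.Complex_Order\<close>, in which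
  \<open>0 \<le> z\<close> means that \<open>z\<close> is real and nonnegative.
\<close>

definition psd_mat :: "'a :: conjugatable_ordered_field mat \<Rightarrow> bool" where
  "psd_mat A \<longleftrightarrow> square_mat A \<and> hermitian_mat A \<and>
     (\<forall>v \<in> carrier_vec (dim_row A). 0 \<le> (A *\<^sub>v v) \<bullet>c v)"

definition is_pseudoinverse :: "'a :: conjugatable_field mat \<Rightarrow> 'a mat \<Rightarrow> bool" where
  "is_pseudoinverse A X \<longleftrightarrow>
     X \<in> carrier_mat (dim_col A) (dim_row A) \<and>
     A * X * A = A \<and> X * A * X = X \<and>
     hermitian_mat (A * X) \<and> hermitian_mat (X * A)"

definition pseudoinverse :: "'a :: conjugatable_field mat \<Rightarrow> 'a mat" where
  "pseudoinverse A = (THE X. is_pseudoinverse A X)"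


section \<open>Gaussian laws\<close>

text \<open>The argument of both laws is the variance, not the standard deviation.\<close>

definition gaussian_real :: "real \<Rightarrow> real measure" where
  "gaussian_real v = density lborel (\<lambda>x. ennreal (normal_density 0 (sqrt v) x))"

definition gaussian_complex :: "real \<Rightarrow> complex measure" where
  "gaussian_complex v =
     distr (gaussian_real (v / 2) \<Otimes>\<^sub>M gaussian_real (v / 2)) borel (\<lambda>(x, y). Complex x y)"


section \<open>Random matrix product states\<close>

text \<open>
  One constructor per kind of core: \<open>First i \<alpha>\<close> stands for the entry $G_1(i,\alpha)$,
  \<open>Inner p \<alpha> i \<beta>\<close> for $G_p(\alpha,i,\beta)$ with $1<p<n$, and \<open>Last \<alpha> i\<close> for $G_n(\alpha,i)$.
  \<open>bd\<close> is the bond dimension $\chi$. Sites are numbered from 1; physical and bond indices are numbered from 0.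
\<close>

datatype core_entry = First nat nat | Inner nat nat nat nat | Last nat nat

definition core_entries :: "nat \<Rightarrow> nat \<Rightarrow> nat \<Rightarrow> core_entry set" where
  "core_entries n d bd =
     {First i \<alpha> | i \<alpha>. i < d \<and> \<alpha> < bd} \<union>
     {Inner p \<alpha> i \<beta> | p \<alpha> i \<beta>. 1 < p \<and> p < n \<and> \<alpha> < bd \<and> i < d \<and> \<beta> < bd} \<union>
     {Last \<alpha> i | \<alpha> i. \<alpha> < bd \<and> i < d}"

fun core_variance :: "nat \<Rightarrow> core_entry \<Rightarrow> real" where
  "core_variance bd (First i \<alpha>) = 1 / sqrt (real bd)"
| "core_variance bd (Inner p \<alpha> i \<beta>) = 1 / real bd"
| "core_variance bd (Last \<alpha> i) = 1 / sqrt (real bd)"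

text \<open>\<open>i\<close> maps the site \<open>p\<close> to the physical index $i_p$.\<close>

definition mps_entry ::
  "nat \<Rightarrow> nat \<Rightarrow> (core_entry \<Rightarrow> 'a) \<Rightarrow> (nat \<Rightarrow> nat) \<Rightarrow> 'a :: comm_semiring_1" where
  "mps_entry n bd G i =
     (\<Sum>\<alpha> \<in> {1..n-1} \<rightarrow>\<^sub>E {..<bd}.
        G (First (i 1) (\<alpha> 1)) *
        (\<Prod>p\<in>{2..n-1}. G (Inner p (\<alpha> (p - 1)) (i p) (\<alpha> p))) *
        G (Last (\<alpha> (n - 1)) (i n)))"

text \<open>
  The multi-indices $(i_1,\dots,i_n)$ are identified with \<open>{..<d ^ n}\<close> in lexicographic order:
  $i_1$ is the most significant digit in base \<open>d\<close>, $i_n$ the least significant one.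
\<close>

definition multi_index :: "nat \<Rightarrow> nat \<Rightarrow> nat \<Rightarrow> nat \<Rightarrow> nat" where
  "multi_index n d x p = (x div d ^ (n - p)) mod d"

text \<open>
  The law of an rMPS vector; \<open>N v\<close> is the centred Gaussian law of variance \<open>v\<close> over the scalar
  field.
\<close>

definition rmps_law ::
  "(real \<Rightarrow> 'a measure) \<Rightarrow> nat \<Rightarrow> nat \<Rightarrow> nat \<Rightarrow> (nat \<Rightarrow> 'a :: {comm_semiring_1, topological_space}) measure"
where
  "rmps_law N n d bd =
     distr (\<Pi>\<^sub>M e \<in> core_entries n d bd. N (core_variance bd e)) (\<Pi>\<^sub>M x \<in> {..<d ^ n}. borel)
       (\<lambda>G. \<lambda>x\<in>{..<d ^ n}. mps_entry n bd G (multi_index n d x))"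

text \<open>
  The joint law of $(\omega_1,\dots,\omega_k)$ and $(\psi_1,\dots,\psi_\ell)$, all \<open>k + l\<close> vectors
  being iid rMPS. The law of the estimator depends on nothing else, so no generality is lost by
  taking this product space as the underlying probability space.
\<close>

definition rmps_samples ::
  "(real \<Rightarrow> 'a measure) \<Rightarrow> nat \<Rightarrow> nat \<Rightarrow> nat \<Rightarrow> nat \<Rightarrow> nat \<Rightarrow>
     ((nat \<Rightarrow> nat \<Rightarrow> 'a :: {comm_semiring_1, topological_space}) \<times> (nat \<Rightarrow> nat \<Rightarrow> 'a)) measure"
where
  "rmps_samples N n d bd k l =
     (\<Pi>\<^sub>M j \<in> {..<k}. rmps_law N n d bd) \<Otimes>\<^sub>M (\<Pi>\<^sub>M j \<in> {..<l}. rmps_law N n d bd)"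


section \<open>The estimator\<close>

definition sketch_mat ::
  "nat \<Rightarrow> nat \<Rightarrow> (nat \<Rightarrow> nat \<Rightarrow> 'a) \<Rightarrow> 'a :: real_normed_field mat" where
  "sketch_mat D k \<omega> = Matrix.mat D k (\<lambda>(x, j). of_real (1 / sqrt (real k)) * \<omega> j x)"

definition nystrom_approx :: "'a :: conjugatable_field mat \<Rightarrow> 'a mat \<Rightarrow> 'a mat" where
  "nystrom_approx A \<Omega> =
     A * \<Omega> * pseudoinverse (mat_adjoint \<Omega> * A * \<Omega>) * (mat_adjoint \<Omega> * A)"

definition nystrom_pp ::
  "nat \<Rightarrow> nat \<Rightarrow> 'a mat \<Rightarrow> (nat \<Rightarrow> nat \<Rightarrow> 'a) \<times> (nat \<Rightarrow> nat \<Rightarrow> 'a) \<Rightarrow>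
     'a :: {conjugatable_field, real_normed_field}"
where
  "nystrom_pp k l A = (\<lambda>(\<omega>, \<psi>).
     let D = dim_row A; B = nystrom_approx A (sketch_mat D k \<omega>) in
     mat_trace B +
     of_real (1 / real l) *
       (\<Sum>j<l. ((A - B) *\<^sub>v Matrix.vec D (\<psi> j)) \<bullet>c Matrix.vec D (\<psi> j)))"

end

theory Submission
  imports Defs
begin

text \<open>
  Two ideas carry the proof. The first is to read the residual \<open>R = A - A\<langle>\<Omega>\<rangle>\<close> of the Nystrom
  approximation as the outcome of \<open>k\<close> rank-one deflations
  \<open>B \<mapsto> B - (B w) (B w)\<^sup>* / (w\<^sup>* B w)\<close>, one for every sketch vector \<open>w\<close>, starting from \<open>A\<close>
  (lemma \<open>nystrom_residual\<close>). Deflation keeps a kernel positive semidefinite, decreases its trace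
  and its Frobenius norm, and is a rational function of \<open>w\<close> and its
  conjugate, so that the estimator is visibly
  measurable although the pseudoinverse is not continuous.

  The second is that a matrix product state enters only through two moments. For all vectors
  \<open>u\<close>, \<open>v\<close> it satisfies
  \<open>E |\<langle>w, u\<rangle>|\<^sup>2 = |u|\<^sup>2\<close> and
  \<open>E |\<langle>w, u\<rangle>|\<^sup>2 |\<langle>w, v\<rangle>|\<^sup>2 \<le> a |u|\<^sup>2 |v|\<^sup>2 + 2 |\<langle>u, v\<rangle>|\<^sup>2\<close>
  with \<open>a = 3 (1 + 2/\<chi>)\<^bsup>n-1\<^esup> - 2\<close>; these are the assumptions of the locale \<open>isotropic_law\<close>. The
  hypothesis that \<open>\<chi>\<close> is at least a multiple of \<open>n/\<epsilon>\<close> makes \<open>a - 1\<close> of order \<open>\<epsilon>\<close>.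

  Low-rank approximation. Deflating \<open>B\<close> by a random \<open>w\<close> lowers the trace by
  \<open>|B w|\<^sup>2 / (w\<^sup>* B w)\<close>. The numerator has mean \<open>|B|\<^sub>F\<^sup>2\<close>, the denominator has mean \<open>tr B\<close>, and the two
  moments bound the mean of their product, so the expected drop is at least
  \<open>|B|\<^sub>F\<^sup>2 / ((a + 2) tr A)\<close> (lemma \<open>expected_trace_drop\<close>). The trace can lose at most \<open>tr A\<close> in
  total and the Frobenius norms decrease, so the last of the \<open>k\<close> residuals has
  \<open>E |R|\<^sub>F\<^sup>2 \<le> (a + 2) (tr A)\<^sup>2 / k\<close> (lemma \<open>expected_frobenius_residual\<close>).

  Residual trace estimation. Given the sketch, the error of the estimator is
  \<open>(1/k) \<Sum>\<^sub>j \<psi>\<^sub>j\<^sup>* R \<psi>\<^sub>j - tr R\<close>, an average of independent centred variables of variance at most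
  \<open>(a - 1) (tr R)\<^sup>2 + 2 |R|\<^sub>F\<^sup>2\<close>. Hence the mean square error is at most
  \<open>((a - 1)/k + 2 (a + 2)/k\<^sup>2) (tr A)\<^sup>2\<close>, which is \<open>O(\<epsilon>\<^sup>2 (tr A)\<^sup>2)\<close> because \<open>1/k\<close> and \<open>a - 1\<close> are both
  \<open>O(\<epsilon>)\<close>, and Chebyshev's inequality concludes (lemma \<open>nystrom_error_concentration\<close>).

  Moments of matrix product states. The value of a linear form at the state is computed by
  contracting its coefficient array with one core after the other. Contracting an array pair
  \<open>U\<close>, \<open>V\<close> with one Gaussian core changes the expectations of \<open>|U|\<^sup>2 |V|\<^sup>2\<close> and \<open>|\<langle>U, V\<rangle>|\<^sup>2\<close> in a way
  that involves only these two quantities (lemma \<open>linear_moments_contract\<close>, by Wick's formula), so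
  an induction over the sites yields the fourth moment with the explicit \<open>a\<close>
  (lemma \<open>linear_moments_mps\<close>).
\<close>

section \<open>Real and complex scalars\<close>

text \<open>
  The scalar fields of the theorem. The axioms are phrased with \<open>*\<^sub>R\<close> instead of \<open>of_real\<close> because class
  axioms may refer to the operations of the superclasses only. They tie the abstract conjugation and
  the order to the norm.
\<close>

class real_or_complex = conjugatable_ordered_field + real_normed_field + banach + second_countable_topology +
  assumes mult_conjugate_scaleR: "x * conjugate x = (norm x)\<^sup>2 *\<^sub>R 1"
    and nonneg_eq_norm_scaleR: "0 \<le> x \<Longrightarrow> x = norm x *\<^sub>R 1"

lemma mult_conjugate: "x * conjugate x = of_real ((norm (x :: 'a :: real_or_complex))\<^sup>2)"
  unfolding of_real_def by (rule mult_conjugate_scaleR)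

lemma nonneg_eq_norm: "0 \<le> x \<Longrightarrow> x = of_real (norm (x :: 'a :: real_or_complex))"
  unfolding of_real_def by (rule nonneg_eq_norm_scaleR)

instance real :: real_or_complex
  by standard (auto simp: power2_eq_square)

instance complex :: real_or_complex
proof
  show "x * conjugate x = (norm x)\<^sup>2 *\<^sub>R 1" for x :: complex
    by (simp add: complex_norm_square[symmetric] scaleR_conv_of_real)
  show "x = norm x *\<^sub>R 1" if "0 \<le> x" for x :: complex
    using that by (auto simp: less_eq_complex_def complex_eq_iff cmod_def)
qed

lemma norm_conjugate [simp]: "norm (conjugate x) = norm (x :: 'a :: real_or_complex)"
proof -
  have "(of_real ((norm (conjugate x))\<^sup>2) :: 'a) = of_real ((norm x)\<^sup>2)"
    unfolding mult_conjugate[symmetric] by (simp add: mult.commute)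
  then show ?thesis
    by (simp only: of_real_eq_iff power2_eq_iff_nonneg norm_ge_zero)
qed

lemma conjugate_of_real [simp]: "conjugate (of_real r :: 'a :: real_or_complex) = of_real r"
proof -
  have pos: "conjugate (of_real s :: 'a) = of_real s" if "0 \<le> s" for s
  proof -
    have "(of_real s :: 'a) = of_real (sqrt s) * conjugate (of_real (sqrt s))"
      using that by (simp add: mult_conjugate)
    then show ?thesis
      by (metis conjugate_dist_mul conjugate_id mult.commute)
  qed
  show ?thesis
    using pos[of r] pos[of "-r"] by (cases "0 \<le> r") (auto simp: conjugate_neg)
qed

lemma conjugate_one [simp]: "conjugate (1 :: 'a :: real_or_complex) = 1"
  using conjugate_of_real[of 1] by simp

lemma conjugate_diff: "conjugate (x - y :: 'a :: real_or_complex) = conjugate x - conjugate y"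
  using conjugate_dist_add[of x "-y"] by (simp add: conjugate_neg)

lemma conjugate_divide: "conjugate (x / y :: 'a :: real_or_complex) = conjugate x / conjugate y"
  by (cases "y = 0") (simp_all add: conjugate_dist_mul[symmetric] nonzero_eq_divide_eq)

lemma conjugate_sum:
  "conjugate (sum f X) = (\<Sum>x\<in>X. conjugate (f x :: 'a :: real_or_complex))"
  by (cases "finite X") (simp_all add: sum_conjugate)

lemma conjugate_prod:
  "conjugate (prod f X) = (\<Prod>x\<in>X. conjugate (f x :: 'a :: real_or_complex))"
  by (induction X rule: infinite_finite_induct) (simp_all add: conjugate_dist_mul)

lemma borel_measurable_conjugate [measurable]:
  "(conjugate :: 'a :: real_or_complex \<Rightarrow> 'a) \<in> borel_measurable borel"
proof (rule borel_measurable_continuous_onI)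
  show "continuous_on UNIV (conjugate :: 'a \<Rightarrow> 'a)"
    unfolding continuous_on_iff dist_norm conjugate_diff[symmetric] norm_conjugate by blast
qed

lemmas conjugate_simps = conjugate_dist_mul conjugate_dist_add conjugate_neg conjugate_diff
  conjugate_divide conjugate_sum

definition cinner_on :: "'i set \<Rightarrow> ('i \<Rightarrow> 'a) \<Rightarrow> ('i \<Rightarrow> 'a) \<Rightarrow> 'a :: real_or_complex" where
  "cinner_on I u v = (\<Sum>i\<in>I. u i * conjugate (v i))"

definition norm_sq_on :: "'i set \<Rightarrow> ('i \<Rightarrow> 'a :: real_or_complex) \<Rightarrow> real" where
  "norm_sq_on I u = (\<Sum>i\<in>I. (norm (u i))\<^sup>2)"

lemma norm_sq_on_nonneg [simp]: "0 \<le> norm_sq_on I u"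
  by (simp add: norm_sq_on_def sum_nonneg)

lemma cinner_on_self: "cinner_on I u u = of_real (norm_sq_on I u)"
  by (simp add: cinner_on_def norm_sq_on_def mult_conjugate)

lemma norm_sq_on_conjugate [simp]: "norm_sq_on I (\<lambda>i. conjugate (u i)) = norm_sq_on I u"
  by (simp add: norm_sq_on_def)

lemma conjugate_cinner_on: "conjugate (cinner_on I u v) = cinner_on I v u"
  by (simp add: cinner_on_def conjugate_sum conjugate_dist_mul mult.commute)

lemma norm_cinner_on_commute: "norm (cinner_on I u v) = norm (cinner_on I v u)"
  by (metis conjugate_cinner_on norm_conjugate)

lemma norm_cinner_on_conjugate:
  "norm (cinner_on I (\<lambda>x. conjugate (u x)) (\<lambda>x. conjugate (v x))) = norm (cinner_on I u v)"
proof -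
  have "cinner_on I (\<lambda>x. conjugate (u x)) (\<lambda>x. conjugate (v x)) = conjugate (cinner_on I u v)"
    by (simp add: cinner_on_def conjugate_sum conjugate_dist_mul)
  then show ?thesis by simp
qed

lemma cinner_on_Cauchy_Schwarz:
  "(norm (cinner_on I u v))\<^sup>2 \<le> norm_sq_on I u * norm_sq_on I v"
proof -
  have "norm (cinner_on I u v) \<le> (\<Sum>i\<in>I. norm (u i) * norm (v i))"
    unfolding cinner_on_def by (rule order_trans[OF norm_sum]) (simp add: norm_mult)
  then have "(norm (cinner_on I u v))\<^sup>2 \<le> (\<Sum>i\<in>I. norm (u i) * norm (v i))\<^sup>2"
    by (rule power_mono) simp
  also have "\<dots> \<le> norm_sq_on I u * norm_sq_on I v"
    unfolding norm_sq_on_def by (rule Cauchy_Schwarz_ineq_sum)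
  finally show ?thesis .
qed

lemma cinner_on_Cauchy_Schwarz_sqrt:
  "norm (cinner_on I u v) \<le> sqrt (norm_sq_on I u) * sqrt (norm_sq_on I v)"
  using cinner_on_Cauchy_Schwarz[of I u v] by (metis real_le_rsqrt real_sqrt_mult)

section \<open>Positive semidefinite kernels and their rank-one deflation\<close>

definition apply_kernel :: "nat \<Rightarrow> (nat \<Rightarrow> nat \<Rightarrow> 'a) \<Rightarrow> (nat \<Rightarrow> 'a) \<Rightarrow> nat \<Rightarrow> 'a :: real_or_complex" where
  "apply_kernel D B w x = (\<Sum>y<D. B x y * w y)"

definition sesq :: "nat \<Rightarrow> (nat \<Rightarrow> nat \<Rightarrow> 'a) \<Rightarrow> (nat \<Rightarrow> 'a) \<Rightarrow> (nat \<Rightarrow> 'a) \<Rightarrow> 'a :: real_or_complex" where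
  "sesq D B v w = (\<Sum>x<D. conjugate (v x) * apply_kernel D B w x)"

text \<open>
  Hermitian with nonnegative form; the second conjunct says that \<open>w\<^sup>* B w\<close> is real and
  nonnegative, without reference to an order on the scalars.
\<close>

definition psd_kernel :: "nat \<Rightarrow> (nat \<Rightarrow> nat \<Rightarrow> 'a :: real_or_complex) \<Rightarrow> bool" where
  "psd_kernel D B \<longleftrightarrow> (\<forall>x<D. \<forall>y<D. B y x = conjugate (B x y)) \<and>
     (\<forall>w. sesq D B w w = of_real (norm (sesq D B w w)))"

definition quad :: "nat \<Rightarrow> (nat \<Rightarrow> nat \<Rightarrow> 'a :: real_or_complex) \<Rightarrow> (nat \<Rightarrow> 'a) \<Rightarrow> real" where
  "quad D B w = norm (sesq D B w w)"

text \<open>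
  One step of a Cholesky elimination with pivot vector \<open>w\<close>, i.e. the Schur complement of \<open>w\<close>. If
  the pivot \<open>w\<^sup>* B w\<close> is zero then division by zero leaves \<open>B\<close> unchanged.
\<close>

definition deflate :: "nat \<Rightarrow> (nat \<Rightarrow> nat \<Rightarrow> 'a) \<Rightarrow> (nat \<Rightarrow> 'a) \<Rightarrow> nat \<Rightarrow> nat \<Rightarrow> 'a :: real_or_complex" where
  "deflate D B w x y = B x y - apply_kernel D B w x * conjugate (apply_kernel D B w y) / sesq D B w w"

fun residual :: "nat \<Rightarrow> nat \<Rightarrow> (nat \<Rightarrow> nat \<Rightarrow> 'a) \<Rightarrow> (nat \<Rightarrow> nat \<Rightarrow> 'a) \<Rightarrow> nat \<Rightarrow> nat \<Rightarrow> 'a :: real_or_complex" where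
  "residual D 0 B \<omega> = B"
| "residual D (Suc k) B \<omega> = residual D k (deflate D B (\<omega> k)) \<omega>"

definition kernel_trace :: "nat \<Rightarrow> (nat \<Rightarrow> nat \<Rightarrow> 'a :: real_or_complex) \<Rightarrow> real" where
  "kernel_trace D B = (\<Sum>x<D. norm (B x x))"

definition frobenius_sq :: "nat \<Rightarrow> (nat \<Rightarrow> nat \<Rightarrow> 'a :: real_or_complex) \<Rightarrow> real" where
  "frobenius_sq D B = (\<Sum>x<D. \<Sum>y<D. (norm (B x y))\<^sup>2)"

lemma quad_nonneg [simp]: "0 \<le> quad D B w" by (simp add: quad_def)
lemma kernel_trace_nonneg [simp]: "0 \<le> kernel_trace D B" by (simp add: kernel_trace_def sum_nonneg)
lemma frobenius_sq_nonneg [simp]: "0 \<le> frobenius_sq D B" by (simp add: frobenius_sq_def sum_nonneg)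

lemma psd_kernel_hermitian: "psd_kernel D B \<Longrightarrow> x < D \<Longrightarrow> y < D \<Longrightarrow> conjugate (B x y) = B y x"
proof -
  assume "psd_kernel D B" "x < D" "y < D"
  then have "\<forall>x<D. \<forall>y<D. B y x = conjugate (B x y)"
    unfolding psd_kernel_def by (elim conjE)
  with \<open>x < D\<close> \<open>y < D\<close> have "B y x = conjugate (B x y)" by blast
  then show ?thesis by (rule sym)
qed

lemma psd_kernel_quad: "psd_kernel D B \<Longrightarrow> sesq D B w w = of_real (quad D B w)"
  unfolding psd_kernel_def quad_def by (elim conjE, erule spec)

lemma apply_kernel_lincomb:
  "apply_kernel D B (\<lambda>y. v y - c * w y) x = apply_kernel D B v x - c * apply_kernel D B w x"
  unfolding apply_kernel_def sum_distrib_left sum_subtractf[symmetric]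
  by (intro sum.cong refl) (simp add: right_diff_distrib mult.left_commute)

lemma sesq_lincomb_right:
  "sesq D B u (\<lambda>y. v y - c * w y) = sesq D B u v - c * sesq D B u w"
  unfolding sesq_def apply_kernel_lincomb sum_distrib_left sum_subtractf[symmetric]
  by (intro sum.cong refl) (simp add: right_diff_distrib mult.left_commute)

lemma sesq_lincomb_left:
  "sesq D B (\<lambda>y. v y - c * w y) u = sesq D B v u - conjugate c * sesq D B w u"
  unfolding sesq_def conjugate_diff conjugate_dist_mul sum_distrib_left sum_subtractf[symmetric]
  by (intro sum.cong refl) (simp add: left_diff_distrib mult.assoc)

lemma sesq_conjugate_apply:
  assumes "psd_kernel D B"
  shows "sesq D B w v = (\<Sum>y<D. conjugate (apply_kernel D B w y) * v y)"
proof -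
  have "sesq D B w v = (\<Sum>x<D. \<Sum>y<D. conjugate (w x) * (B x y * v y))"
    by (simp add: sesq_def apply_kernel_def sum_distrib_left)
  also have "\<dots> = (\<Sum>y<D. \<Sum>x<D. conjugate (w x) * (B x y * v y))"
    by (rule sum.swap)
  also have "\<dots> = (\<Sum>y<D. conjugate (apply_kernel D B w y) * v y)"
    unfolding apply_kernel_def conjugate_sum conjugate_dist_mul sum_distrib_right
    by (intro sum.cong refl) (simp add: psd_kernel_hermitian[OF assms] mult_ac)
  finally show ?thesis .
qed

lemma conjugate_sesq:
  assumes "psd_kernel D B"
  shows "conjugate (sesq D B v w) = sesq D B w v"
  unfolding sesq_conjugate_apply[OF assms, of w v]
  by (simp add: sesq_def conjugate_sum conjugate_dist_mul mult.commute)

text \<open>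
  Since the form is nonnegative at \<open>w - t B w\<close> for every real \<open>t\<close>, its linear coefficient
  \<open>-2 |B w|\<^sup>2\<close> in \<open>t\<close> must vanish. This is what makes the division by zero in \<open>deflate\<close> harmless:
  when \<open>w\<^sup>* B w = 0\<close> there is nothing left to deflate.
\<close>

lemma psd_kernel_null:
  assumes psd: "psd_kernel D B" and null: "sesq D B w w = 0" and "x < D"
  shows "apply_kernel D B w x = 0"
proof -
  define w' where "w' = apply_kernel D B w"
  define N where "N = norm_sq_on {..<D} w'"
  define Q where "Q = quad D B w'"
  \<comment> \<open>Any small positive \<open>t\<close> would do; the summand 1 covers the case \<open>Q = 0\<close>.\<close>
  define t where "t = N / (Q + 1)"
  have s: "sesq D B w' w = of_real N"
    unfolding sesq_def w'_def[symmetric] N_def cinner_on_self[symmetric] cinner_on_def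
    by (simp add: mult.commute)
  have s': "sesq D B w w' = of_real N"
    using conjugate_sesq[OF psd, of w' w] s by simp
  define u where "u = (\<lambda>y. w y - of_real t * w' y)"
  have "sesq D B u u = of_real (t\<^sup>2 * Q - 2 * t * N)"
    by (simp add: u_def sesq_lincomb_left sesq_lincomb_right null s s' psd_kernel_quad[OF psd, of w'] Q_def
        algebra_simps power2_eq_square)
  then have "0 \<le> t\<^sup>2 * Q - 2 * t * N"
    unfolding psd_kernel_quad[OF psd] of_real_eq_iff by (metis quad_nonneg)
  moreover have "t * (Q + 1) = N" "0 \<le> Q"
    by (simp_all add: t_def Q_def add_nonneg_eq_0_iff)
  moreover have "t * Q * t \<le> t * (Q + 1) * t"
    using zero_le_square[of t] by (simp add: algebra_simps)
  ultimately have "t * N \<le> 0"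
    by (simp add: power2_eq_square algebra_simps)
  then have "N * N / (Q + 1) \<le> 0"
    by (simp add: t_def)
  then have "N = 0"
    using \<open>0 \<le> Q\<close> norm_sq_on_nonneg[of "{..<D}" w', folded N_def]
    by (simp add: divide_le_0_iff mult_le_0_iff)
  then show ?thesis
    using \<open>x < D\<close> by (auto simp: N_def norm_sq_on_def w'_def sum_nonneg_eq_0_iff)
qed

lemma apply_deflate:
  assumes "psd_kernel D B"
  shows "apply_kernel D (deflate D B w) v x =
    apply_kernel D B v x - apply_kernel D B w x * (sesq D B w v / sesq D B w w)"
  unfolding sesq_conjugate_apply[OF assms, of w v] apply_kernel_def[of D "deflate D B w"]
    apply_kernel_def[of D B v] deflate_def sum_divide_distrib sum_distrib_left sum_subtractf[symmetric]
  by (intro sum.cong refl) (simp add: left_diff_distrib)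

lemma sesq_deflate:
  assumes "psd_kernel D B"
  shows "sesq D (deflate D B w) u v = sesq D B u v - sesq D B u w * sesq D B w v / sesq D B w w"
proof -
  have "sesq D (deflate D B w) u v = sesq D B u v - sesq D B u w * (sesq D B w v / sesq D B w w)"
    unfolding sesq_def[of D _ u] apply_deflate[OF assms] sum_distrib_right sum_subtractf[symmetric]
    by (intro sum.cong refl) (simp only: right_diff_distrib mult.assoc)
  then show ?thesis by simp
qed

text \<open>
  The deflated form at \<open>v\<close> is the original form at \<open>v - c w\<close>, where \<open>c w\<close> is the component of \<open>v\<close>
  along \<open>w\<close> with respect to \<open>B\<close>.
\<close>

lemma psd_deflate:
  assumes psd: "psd_kernel D B"
  shows "psd_kernel D (deflate D B w)"
proof -
  have "sesq D (deflate D B w) v v = of_real (quad D B (\<lambda>y. v y - sesq D B w v / sesq D B w w * w y))" for v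
  proof -
    have c: "conjugate (sesq D B w w) = sesq D B w w"
      by (rule conjugate_sesq[OF psd])
    show ?thesis
      unfolding psd_kernel_quad[OF psd, symmetric] sesq_deflate[OF psd] sesq_lincomb_left
        sesq_lincomb_right conjugate_divide conjugate_sesq[OF psd]
      by (cases "sesq D B w w = 0") (simp_all add: field_simps)
  qed
  then have "sesq D (deflate D B w) v v = of_real (norm (sesq D (deflate D B w) v v))" for v
    by (metis abs_of_nonneg norm_of_real quad_nonneg)
  moreover have "deflate D B w y x = conjugate (deflate D B w x y)" if "x < D" "y < D" for x y
    using that by (simp add: deflate_def conjugate_simps conjugate_sesq[OF psd]
        psd_kernel_hermitian[OF psd] mult.commute)
  ultimately show ?thesis
    unfolding psd_kernel_def by blast
qed

lemma deflate_kills: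
  assumes psd: "psd_kernel D B" and "x < D"
  shows "apply_kernel D (deflate D B w) w x = 0"
  using psd_kernel_null[OF psd _ \<open>x < D\<close>, of w] by (auto simp: apply_deflate[OF psd])

lemma deflate_keeps_kernel:
  assumes psd: "psd_kernel D B" and null: "\<And>x. x < D \<Longrightarrow> apply_kernel D B v x = 0" and "x < D"
  shows "apply_kernel D (deflate D B w) v x = 0"
proof -
  have "sesq D B w v = 0"
    by (simp add: sesq_def null)
  then show ?thesis
    using assms by (simp add: apply_deflate)
qed

lemma psd_residual: "psd_kernel D B \<Longrightarrow> psd_kernel D (residual D k B \<omega>)"
  by (induction k arbitrary: B) (simp_all add: psd_deflate)

lemma residual_keeps_kernel:
  assumes "psd_kernel D B" "\<And>x. x < D \<Longrightarrow> apply_kernel D B v x = 0" "x < D"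
  shows "apply_kernel D (residual D k B \<omega>) v x = 0"
  using assms
proof (induction k arbitrary: B)
  case (Suc k)
  show ?case
    using Suc.IH[OF psd_deflate[OF Suc.prems(1)] deflate_keeps_kernel[OF Suc.prems(1,2)] Suc.prems(3)]
    by simp
qed simp

lemma residual_kills:
  assumes "psd_kernel D B" "j < k" "x < D"
  shows "apply_kernel D (residual D k B \<omega>) (\<omega> j) x = 0"
  using assms
proof (induction k arbitrary: B)
  case (Suc k)
  then show ?case
    by (cases "j = k")
       (simp_all add: psd_deflate residual_keeps_kernel deflate_kills)
qed simp

text \<open>
  Together with \<open>residual_kills\<close> this characterizes the residual as \<open>B - B \<Omega> Z\<close> with
  \<open>\<Omega>\<^sup>* (B - B \<Omega> Z) = 0\<close>. It is used both for the Nystrom residual and, with the identity kernel, to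
  solve normal equations.
\<close>

lemma residual_form:
  assumes "psd_kernel D B"
  shows "\<exists>Z. \<forall>x y. residual D k B \<omega> x y = B x y - (\<Sum>j<k. apply_kernel D B (\<omega> j) x * Z j y)"
  using assms
proof (induction k arbitrary: B)
  case (Suc k)
  let ?w = "\<omega> k"
  let ?q = "sesq D B ?w ?w"
  obtain Z where Z: "residual D k (deflate D B ?w) \<omega> x y =
      deflate D B ?w x y - (\<Sum>j<k. apply_kernel D (deflate D B ?w) (\<omega> j) x * Z j y)" for x y
    using Suc.IH[OF psd_deflate[OF Suc.prems]] by blast
  \<comment> \<open>The deflation by \<open>\<omega> k\<close> comes first, so it also alters the columns \<open>B (\<omega> j)\<close>; the coefficient of \<open>B (\<omega> k)\<close> collects these corrections.\<close>
  define Z' where "Z' j y = (if j < k then Z j y else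
    conjugate (apply_kernel D B ?w y) / ?q - (\<Sum>j<k. sesq D B ?w (\<omega> j) / ?q * Z j y))" for j y
  have "residual D (Suc k) B \<omega> x y = B x y - (\<Sum>j<Suc k. apply_kernel D B (\<omega> j) x * Z' j y)" for x y
  proof -
    have "(\<Sum>j<k. apply_kernel D (deflate D B ?w) (\<omega> j) x * Z j y) =
        (\<Sum>j<k. apply_kernel D B (\<omega> j) x * Z j y) -
        apply_kernel D B ?w x * (\<Sum>j<k. sesq D B ?w (\<omega> j) / ?q * Z j y)"
      unfolding apply_deflate[OF Suc.prems] sum_distrib_left sum_subtractf[symmetric]
      by (intro sum.cong refl) (simp add: left_diff_distrib mult.assoc)
    then show ?thesis
      by (simp add: Z Z'_def deflate_def right_diff_distrib)
  qed
  then show ?case by blast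
qed simp

lemma deflate_rank_one:
  assumes psd: "psd_kernel D B"
  shows "deflate D B w x y = B x y - (apply_kernel D B w x / of_real (sqrt (quad D B w)))
    * conjugate (apply_kernel D B w y / of_real (sqrt (quad D B w)))"
proof -
  have "(of_real (sqrt (quad D B w)) :: 'a) * of_real (sqrt (quad D B w)) = sesq D B w w"
    unfolding of_real_mult[symmetric] psd_kernel_quad[OF psd] by simp
  then show ?thesis
    by (simp add: deflate_def conjugate_divide)
qed

lemma residual_rank_one_sum:
  assumes "psd_kernel D B"
  shows "\<exists>c. \<forall>x y. B x y = residual D k B \<omega> x y + (\<Sum>i<k. c i x * conjugate (c i y))"
  using assms
proof (induction k arbitrary: B)
  case (Suc k)
  obtain c where c: "deflate D B (\<omega> k) x y =
      residual D (Suc k) B \<omega> x y + (\<Sum>i<k. c i x * conjugate (c i y))" for x y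
    using Suc.IH[OF psd_deflate[OF Suc.prems, of "\<omega> k"]] unfolding residual.simps by blast
  define c' where "c' i = (if i < k then c i else
    (\<lambda>x. apply_kernel D B (\<omega> k) x / of_real (sqrt (quad D B (\<omega> k)))))" for i
  have "B x y = residual D (Suc k) B \<omega> x y + (\<Sum>i<Suc k. c' i x * conjugate (c' i y))" for x y
  proof -
    have "B x y = deflate D B (\<omega> k) x y + c' k x * conjugate (c' k y)"
      using deflate_rank_one[OF Suc.prems, of "\<omega> k" x y] by (simp add: c'_def)
    also have "deflate D B (\<omega> k) x y =
        residual D (Suc k) B \<omega> x y + (\<Sum>i<k. c' i x * conjugate (c' i y))"
      unfolding c[of x y] c'_def by (intro arg_cong2[of _ _ _ _ plus] sum.cong) auto
    finally show ?thesis by (simp only: sum.lessThan_Suc add.assoc)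
  qed
  then show ?case by blast
qed simp

text \<open>
  Cholesky factorization: deflating successively by all standard basis vectors leaves the zero
  kernel, and each deflation splits off a rank-one term.
\<close>

lemma psd_kernel_gram:
  assumes psd: "psd_kernel D B"
  obtains c where "\<And>x y. x < D \<Longrightarrow> y < D \<Longrightarrow> B x y = (\<Sum>i<D. c i x * conjugate (c i y))"
proof -
  define e :: "nat \<Rightarrow> nat \<Rightarrow> 'a" where "e j y = (if y = j then 1 else 0)" for j y
  obtain c where c: "B x y = residual D D B e x y + (\<Sum>i<D. c i x * conjugate (c i y))" for x y
    using residual_rank_one_sum[OF psd] by blast
  \<comment> \<open>Killing the basis vector \<open>e y\<close> means that column \<open>y\<close> of the remainder is zero.\<close>
  have R: "residual D D B e x y = 0" if "x < D" "y < D" for x y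
    using residual_kills[OF psd that(2,1), of e] that(2)
    by (simp add: apply_kernel_def e_def if_distrib cong: if_cong)
  show ?thesis
    by (rule that[of c], rule trans[OF c]) (simp add: R)
qed

lemma of_real_kernel_trace:
  assumes psd: "psd_kernel D B"
  shows "of_real (kernel_trace D B) = (\<Sum>x<D. B x x)"
proof -
  obtain c where c: "\<And>x y. x < D \<Longrightarrow> y < D \<Longrightarrow> B x y = (\<Sum>i<D. c i x * conjugate (c i y))"
    by (rule psd_kernel_gram[OF psd]) blast
  have "B x x = of_real (norm (B x x))" if "x < D" for x
  proof -
    define r where "r = (\<Sum>i<D. (norm (c i x))\<^sup>2)"
    have "B x x = of_real r"
      unfolding r_def c[OF that that] by (simp add: mult_conjugate)
    moreover have "0 \<le> r"
      unfolding r_def by (intro sum_nonneg) simp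
    ultimately show ?thesis by simp
  qed
  then show ?thesis
    unfolding kernel_trace_def of_real_sum by (intro sum.cong) auto
qed

lemma trace_deflate:
  assumes psd: "psd_kernel D B"
  shows "kernel_trace D (deflate D B w) =
    kernel_trace D B - norm_sq_on {..<D} (apply_kernel D B w) / quad D B w"
proof -
  have "(of_real (kernel_trace D (deflate D B w)) :: 'a) =
    of_real (kernel_trace D B - norm_sq_on {..<D} (apply_kernel D B w) / quad D B w)"
    unfolding of_real_kernel_trace[OF psd_deflate[OF psd]] of_real_diff of_real_divide
      of_real_kernel_trace[OF psd] psd_kernel_quad[OF psd, symmetric] cinner_on_self[symmetric]
      cinner_on_def
    by (simp add: deflate_def sum_subtractf sum_divide_distrib)
  then show ?thesis by (simp only: of_real_eq_iff)
qed

text \<open>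
  Writing \<open>B = B' + c c\<^sup>*\<close> with the deflated kernel \<open>B'\<close>, the cross terms in \<open>|B|\<^sub>F\<^sup>2\<close> are
  \<open>c\<^sup>* B' c \<ge> 0\<close>.
\<close>

lemma frobenius_deflate_le:
  assumes psd: "psd_kernel D B"
  shows "frobenius_sq D (deflate D B w) \<le> frobenius_sq D B"
proof -
  define B' where "B' = deflate D B w"
  define c where "c x = apply_kernel D B w x / of_real (sqrt (quad D B w))" for x
  have psd': "psd_kernel D B'" unfolding B'_def by (rule psd_deflate[OF psd])
  have B: "B x y = B' x y + c x * conjugate (c y)" for x y
    using deflate_rank_one[OF psd, of w x y] by (simp add: B'_def c_def)
  have fro: "of_real (frobenius_sq D K) = (\<Sum>x<D. \<Sum>y<D. K x y * conjugate (K x y))" for K :: "nat \<Rightarrow> nat \<Rightarrow> 'a"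
    by (simp add: frobenius_sq_def mult_conjugate)
  have q: "(\<Sum>x<D. \<Sum>y<D. B' x y * conjugate (c x) * c y) = of_real (quad D B' c)"
    unfolding psd_kernel_quad[OF psd', symmetric] sesq_def apply_kernel_def sum_distrib_left
    by (simp add: mult_ac)
  have q': "(\<Sum>x<D. \<Sum>y<D. conjugate (B' x y) * c x * conjugate (c y)) = of_real (quad D B' c)"
    using arg_cong[OF q, of conjugate] by (simp add: conjugate_sum conjugate_dist_mul)
  have cc: "(\<Sum>x<D. \<Sum>y<D. c x * conjugate (c x) * (c y * conjugate (c y))) =
      of_real ((norm_sq_on {..<D} c)\<^sup>2)"
    unfolding sum_product[symmetric] by (simp add: mult_conjugate norm_sq_on_def power2_eq_square)
  have "(of_real (frobenius_sq D B) :: 'a) = (\<Sum>x<D. \<Sum>y<D. B' x y * conjugate (B' x y) +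
      B' x y * conjugate (c x) * c y + conjugate (B' x y) * c x * conjugate (c y) +
      c x * conjugate (c x) * (c y * conjugate (c y)))"
    unfolding fro by (intro sum.cong refl) (simp add: B conjugate_simps algebra_simps)
  also have "\<dots> = of_real (frobenius_sq D B' + quad D B' c + quad D B' c + (norm_sq_on {..<D} c)\<^sup>2)"
    unfolding sum.distrib q q' cc fro[symmetric] by simp
  finally have "frobenius_sq D B = frobenius_sq D B' + quad D B' c + quad D B' c + (norm_sq_on {..<D} c)\<^sup>2"
    by (simp only: of_real_eq_iff)
  then show ?thesis
    by (simp add: B'_def)
qed

lemma frobenius_residual_le:
  "psd_kernel D B \<Longrightarrow> frobenius_sq D (residual D k B \<omega>) \<le> frobenius_sq D B"
proof (induction k arbitrary: B)
  case (Suc k)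
  show ?case
    using Suc.IH[OF psd_deflate[OF Suc.prems, of "\<omega> k"]] frobenius_deflate_le[OF Suc.prems, of "\<omega> k"]
    by simp
qed simp

lemma trace_residual_le:
  "psd_kernel D B \<Longrightarrow> kernel_trace D (residual D k B \<omega>) \<le> kernel_trace D B"
proof (induction k arbitrary: B)
  case (Suc k)
  have "kernel_trace D (deflate D B (\<omega> k)) \<le> kernel_trace D B"
    by (simp add: trace_deflate[OF Suc.prems])
  then show ?case
    using Suc.IH[OF psd_deflate[OF Suc.prems, of "\<omega> k"]] by simp
qed simp

section \<open>Factorization and measurability of deflated kernels\<close>

text \<open>
  The Gram vectors \<open>c\<^sub>i\<close> turn the quadratic form into a sum of squared absolute values of linear
  forms, and the trace and the Frobenius norm into the corresponding sums of norms and inner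
  products. Moment bounds for linear forms thereby become moment bounds for quadratic forms.
\<close>

lemma psd_kernel_quad_sum:
  assumes psd: "psd_kernel D B"
  obtains c where
    "\<And>w. quad D B w = (\<Sum>i<D. (norm (\<Sum>x<D. conjugate (c i x) * w x))\<^sup>2)"
    "kernel_trace D B = (\<Sum>i<D. norm_sq_on {..<D} (c i))"
    "frobenius_sq D B = (\<Sum>i<D. \<Sum>j<D. (norm (cinner_on {..<D} (c i) (c j)))\<^sup>2)"
proof -
  obtain c where c: "\<And>x y. x < D \<Longrightarrow> y < D \<Longrightarrow> B x y = (\<Sum>i<D. c i x * conjugate (c i y))"
    by (rule psd_kernel_gram[OF psd]) blast
  have "quad D B w = (\<Sum>i<D. (norm (\<Sum>x<D. conjugate (c i x) * w x))\<^sup>2)" for w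
  proof -
    have "sesq D B w w = (\<Sum>x<D. \<Sum>y<D. \<Sum>i<D. conjugate (conjugate (c i x) * w x) * (conjugate (c i y) * w y))"
      unfolding sesq_def apply_kernel_def sum_distrib_left
    proof (intro sum.cong refl)
      fix x y assume "x \<in> {..<D}" "y \<in> {..<D}"
      then show "conjugate (w x) * (B x y * w y) =
          (\<Sum>i<D. conjugate (conjugate (c i x) * w x) * (conjugate (c i y) * w y))"
        by (simp add: c sum_distrib_left sum_distrib_right conjugate_dist_mul mult_ac)
    qed
    also have "\<dots> = (\<Sum>x<D. \<Sum>i<D. \<Sum>y<D. conjugate (conjugate (c i x) * w x) * (conjugate (c i y) * w y))"
      by (intro sum.cong refl sum.swap)
    also have "\<dots> = (\<Sum>i<D. \<Sum>x<D. \<Sum>y<D. conjugate (conjugate (c i x) * w x) * (conjugate (c i y) * w y))"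
      by (rule sum.swap)
    also have "\<dots> = (\<Sum>i<D. conjugate (\<Sum>x<D. conjugate (c i x) * w x) * (\<Sum>x<D. conjugate (c i x) * w x))"
      unfolding conjugate_sum sum_product ..
    also have "\<dots> = of_real (\<Sum>i<D. (norm (\<Sum>x<D. conjugate (c i x) * w x))\<^sup>2)"
      unfolding of_real_sum mult_conjugate[symmetric] by (simp only: mult.commute)
    finally show ?thesis
      unfolding psd_kernel_quad[OF psd] of_real_eq_iff .
  qed
  moreover have "kernel_trace D B = (\<Sum>i<D. norm_sq_on {..<D} (c i))"
  proof -
    have "of_real (kernel_trace D B) = (\<Sum>x<D. \<Sum>i<D. c i x * conjugate (c i x))"
      unfolding of_real_kernel_trace[OF psd] by (intro sum.cong refl) (simp add: c)
    also have "\<dots> = (\<Sum>i<D. \<Sum>x<D. c i x * conjugate (c i x))"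
      by (rule sum.swap)
    also have "\<dots> = of_real (\<Sum>i<D. norm_sq_on {..<D} (c i))"
      by (simp add: norm_sq_on_def mult_conjugate)
    finally show ?thesis
      unfolding of_real_eq_iff .
  qed
  moreover have "frobenius_sq D B = (\<Sum>i<D. \<Sum>j<D. (norm (cinner_on {..<D} (c i) (c j)))\<^sup>2)"
  proof -
    have "of_real (frobenius_sq D B) = (\<Sum>x<D. \<Sum>y<D. B x y * conjugate (B x y))"
      by (simp add: frobenius_sq_def mult_conjugate)
    also have "\<dots> = (\<Sum>x<D. \<Sum>y<D. \<Sum>i<D. \<Sum>j<D.
        (c i x * conjugate (c j x)) * conjugate (c i y * conjugate (c j y)))"
    proof (intro sum.cong refl)
      fix x y assume "x \<in> {..<D}" "y \<in> {..<D}"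
      then show "B x y * conjugate (B x y) =
          (\<Sum>i<D. \<Sum>j<D. (c i x * conjugate (c j x)) * conjugate (c i y * conjugate (c j y)))"
        by (simp add: c conjugate_sum sum_product conjugate_dist_mul mult_ac)
    qed
    also have "\<dots> = (\<Sum>i<D. \<Sum>j<D. \<Sum>x<D. \<Sum>y<D.
        (c i x * conjugate (c j x)) * conjugate (c i y * conjugate (c j y)))"
    proof -
      have "(\<Sum>x<D. \<Sum>y<D. \<Sum>i<D. \<Sum>j<D. F x y i j) = (\<Sum>i<D. \<Sum>j<D. \<Sum>x<D. \<Sum>y<D. F x y i j)"
        for F :: "nat \<Rightarrow> nat \<Rightarrow> nat \<Rightarrow> nat \<Rightarrow> 'a"
      proof -
        have "(\<Sum>x<D. \<Sum>y<D. \<Sum>i<D. \<Sum>j<D. F x y i j) = (\<Sum>x<D. \<Sum>i<D. \<Sum>y<D. \<Sum>j<D. F x y i j)"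
          by (intro sum.cong refl sum.swap)
        also have "\<dots> = (\<Sum>i<D. \<Sum>x<D. \<Sum>y<D. \<Sum>j<D. F x y i j)"
          by (rule sum.swap)
        also have "\<dots> = (\<Sum>i<D. \<Sum>x<D. \<Sum>j<D. \<Sum>y<D. F x y i j)"
          by (intro sum.cong refl sum.swap)
        also have "\<dots> = (\<Sum>i<D. \<Sum>j<D. \<Sum>x<D. \<Sum>y<D. F x y i j)"
          by (intro sum.cong refl sum.swap)
        finally show ?thesis .
      qed
      then show ?thesis .
    qed
    also have "\<dots> = of_real (\<Sum>i<D. \<Sum>j<D. (norm (cinner_on {..<D} (c i) (c j)))\<^sup>2)"
      unfolding of_real_sum mult_conjugate[symmetric] cinner_on_def conjugate_sum sum_product ..
    finally show ?thesis
      unfolding of_real_eq_iff .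
  qed
  ultimately show ?thesis
    by (rule that)
qed

lemma residual_cong:
  "(\<And>j. j < k \<Longrightarrow> \<omega> j = \<omega>' j) \<Longrightarrow> residual D k B \<omega> = residual D k B \<omega>'"
  by (induction k arbitrary: B) simp_all

lemma borel_measurable_deflate:
  assumes "\<And>x y. x < D \<Longrightarrow> y < D \<Longrightarrow> (\<lambda>s. B s x y) \<in> borel_measurable M"
    and "\<And>x. x < D \<Longrightarrow> (\<lambda>s. w s x) \<in> borel_measurable M"
    and "x < D" "y < D"
  shows "(\<lambda>s. deflate D (B s) (w s) x y) \<in> borel_measurable M"
proof -
  have app: "(\<lambda>s. apply_kernel D (B s) (w s) x) \<in> borel_measurable M" if "x < D" for x
    unfolding apply_kernel_def
    by (intro borel_measurable_sum borel_measurable_times assms that) auto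
  have "(\<lambda>s. sesq D (B s) (w s) (w s)) \<in> borel_measurable M"
    unfolding sesq_def
    by (intro borel_measurable_sum borel_measurable_times app
        measurable_compose[OF _ borel_measurable_conjugate] assms) auto
  then show ?thesis
    unfolding deflate_def
    by (intro borel_measurable_diff borel_measurable_divide borel_measurable_times app
        measurable_compose[OF _ borel_measurable_conjugate] assms)
qed

lemma borel_measurable_residual:
  assumes "\<And>x y. x < D \<Longrightarrow> y < D \<Longrightarrow> (\<lambda>s. B s x y) \<in> borel_measurable M"
    and "\<And>j x. j < k \<Longrightarrow> x < D \<Longrightarrow> (\<lambda>s. \<omega> s j x) \<in> borel_measurable M"
    and "x < D" "y < D"
  shows "(\<lambda>s. residual D k (B s) (\<omega> s) x y) \<in> borel_measurable M"
  using assms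
proof (induction k arbitrary: B)
  case (Suc k)
  show ?case
    unfolding residual.simps
    by (rule Suc.IH) (use Suc.prems in \<open>auto intro!: borel_measurable_deflate\<close>)
qed simp

lemma borel_measurable_kernel_trace:
  assumes "\<And>x y. x < D \<Longrightarrow> y < D \<Longrightarrow> (\<lambda>s. B s x y) \<in> borel_measurable M"
  shows "(\<lambda>s. kernel_trace D (B s)) \<in> borel_measurable M"
  unfolding kernel_trace_def by (intro borel_measurable_sum measurable_compose[OF _ borel_measurable_norm] assms) auto

lemma borel_measurable_frobenius_sq:
  assumes "\<And>x y. x < D \<Longrightarrow> y < D \<Longrightarrow> (\<lambda>s. B s x y) \<in> borel_measurable M"
  shows "(\<lambda>s. frobenius_sq D (B s)) \<in> borel_measurable M"
  unfolding frobenius_sq_def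
  by (intro borel_measurable_sum borel_measurable_power measurable_compose[OF _ borel_measurable_norm] assms) auto

lemma borel_measurable_quad:
  assumes "\<And>x y. x < D \<Longrightarrow> y < D \<Longrightarrow> (\<lambda>s. B s x y) \<in> borel_measurable M"
    and "\<And>x. x < D \<Longrightarrow> (\<lambda>s. w s x) \<in> borel_measurable M"
  shows "(\<lambda>s. quad D (B s) (w s)) \<in> borel_measurable M"
  unfolding quad_def sesq_def apply_kernel_def
  by (intro measurable_compose[OF _ borel_measurable_norm] borel_measurable_sum borel_measurable_times
      measurable_compose[OF _ borel_measurable_conjugate] assms) auto

section \<open>Nystrom++ for isotropic random vectors with controlled fourth moments\<close>

text \<open>
  The error of the Nystrom++ estimator for \<open>k\<close> sketch vectors \<open>fst S\<close> and \<open>k\<close> test vectors \<open>snd S\<close>,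
  with the residual in its deflation form; lemma \<open>nystrom_pp_error\<close> identifies it with
  the estimator itself.
\<close>

definition nystrom_error ::
  "nat \<Rightarrow> nat \<Rightarrow> (nat \<Rightarrow> nat \<Rightarrow> 'a) \<Rightarrow> (nat \<Rightarrow> nat \<Rightarrow> 'a :: real_or_complex) \<times> (nat \<Rightarrow> nat \<Rightarrow> 'a) \<Rightarrow> real" where
  "nystrom_error D k B S = (1 / real k) * (\<Sum>j<k. quad D (residual D k B (fst S)) (snd S j)) -
     kernel_trace D (residual D k B (fst S))"

text \<open>
  For a standard Gaussian vector the fourth moment bound holds with \<open>a = 1\<close>; the excess \<open>a - 1\<close>
  measures how much quadratic forms fluctuate beyond the Gaussian case. All integrands are
  nonnegative, so the moments are stated with the nonnegative integral.
\<close>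

locale isotropic_law = prob_space L
  for L :: "(nat \<Rightarrow> 'a :: real_or_complex) measure" +
  fixes D :: nat and a :: real
  assumes sets_L: "sets L = sets (\<Pi>\<^sub>M x\<in>{..<D}. borel)"
    and a_ge_1: "1 \<le> a"
    and second_moment: "\<And>u. (\<integral>\<^sup>+\<omega>. ennreal ((norm (\<Sum>x<D. u x * \<omega> x))\<^sup>2) \<partial>L) = ennreal (norm_sq_on {..<D} u)"
    and fourth_moment: "\<And>u v. (\<integral>\<^sup>+\<omega>. ennreal ((norm (\<Sum>x<D. u x * \<omega> x))\<^sup>2 * (norm (\<Sum>x<D. v x * \<omega> x))\<^sup>2) \<partial>L)
      \<le> ennreal (a * norm_sq_on {..<D} u * norm_sq_on {..<D} v + 2 * (norm (cinner_on {..<D} u v))\<^sup>2)"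
begin

lemma measurable_component_L [measurable]: "x < D \<Longrightarrow> (\<lambda>\<omega>. \<omega> x) \<in> borel_measurable L"
  unfolding measurable_cong_sets[OF sets_L refl] by (rule measurable_component_singleton) simp

lemma borel_measurable_linear [measurable]: "(\<lambda>\<omega>. \<Sum>x<D. u x * \<omega> x) \<in> borel_measurable L"
  by (intro borel_measurable_sum borel_measurable_times measurable_component_L) auto

lemma second_moment_sum:
  "(\<integral>\<^sup>+\<omega>. ennreal (\<Sum>i\<in>I. (norm (\<Sum>x<D. u i x * \<omega> x))\<^sup>2) \<partial>L) = ennreal (\<Sum>i\<in>I. norm_sq_on {..<D} (u i))"
proof -
  have "(\<integral>\<^sup>+\<omega>. ennreal (\<Sum>i\<in>I. (norm (\<Sum>x<D. u i x * \<omega> x))\<^sup>2) \<partial>L) =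
      (\<integral>\<^sup>+\<omega>. (\<Sum>i\<in>I. ennreal ((norm (\<Sum>x<D. u i x * \<omega> x))\<^sup>2)) \<partial>L)"
    by (intro nn_integral_cong sum_ennreal[symmetric]) simp
  also have "\<dots> = (\<Sum>i\<in>I. ennreal (norm_sq_on {..<D} (u i)))"
    by (subst nn_integral_sum) (auto simp: second_moment)
  finally show ?thesis by simp
qed

lemma fourth_moment_sum:
  "(\<integral>\<^sup>+\<omega>. ennreal ((\<Sum>i\<in>I. (norm (\<Sum>x<D. u i x * \<omega> x))\<^sup>2) * (\<Sum>j\<in>J. (norm (\<Sum>x<D. v j x * \<omega> x))\<^sup>2)) \<partial>L)
    \<le> ennreal (a * (\<Sum>i\<in>I. norm_sq_on {..<D} (u i)) * (\<Sum>j\<in>J. norm_sq_on {..<D} (v j)) +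
        2 * (\<Sum>i\<in>I. \<Sum>j\<in>J. (norm (cinner_on {..<D} (u i) (v j)))\<^sup>2))"
proof -
  have "(\<integral>\<^sup>+\<omega>. ennreal ((\<Sum>i\<in>I. (norm (\<Sum>x<D. u i x * \<omega> x))\<^sup>2) * (\<Sum>j\<in>J. (norm (\<Sum>x<D. v j x * \<omega> x))\<^sup>2)) \<partial>L)
      = (\<integral>\<^sup>+\<omega>. (\<Sum>i\<in>I. \<Sum>j\<in>J. ennreal ((norm (\<Sum>x<D. u i x * \<omega> x))\<^sup>2 * (norm (\<Sum>x<D. v j x * \<omega> x))\<^sup>2)) \<partial>L)"
    unfolding sum_product by (intro nn_integral_cong) (simp add: sum_nonneg)
  also have "\<dots> = (\<Sum>i\<in>I. \<Sum>j\<in>J. (\<integral>\<^sup>+\<omega>. ennreal ((norm (\<Sum>x<D. u i x * \<omega> x))\<^sup>2 * (norm (\<Sum>x<D. v j x * \<omega> x))\<^sup>2) \<partial>L))"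
    by (simp add: nn_integral_sum del: sum_ennreal)
  also have "\<dots> \<le> (\<Sum>i\<in>I. \<Sum>j\<in>J. ennreal (a * norm_sq_on {..<D} (u i) * norm_sq_on {..<D} (v j) +
      2 * (norm (cinner_on {..<D} (u i) (v j)))\<^sup>2))"
    by (intro sum_mono fourth_moment)
  also have "\<dots> = ennreal (\<Sum>i\<in>I. \<Sum>j\<in>J. a * norm_sq_on {..<D} (u i) * norm_sq_on {..<D} (v j) +
      2 * (norm (cinner_on {..<D} (u i) (v j)))\<^sup>2)"
    using a_ge_1 by (simp add: sum_nonneg)
  also have "(\<Sum>i\<in>I. \<Sum>j\<in>J. a * norm_sq_on {..<D} (u i) * norm_sq_on {..<D} (v j) +
      2 * (norm (cinner_on {..<D} (u i) (v j)))\<^sup>2) =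
      a * (\<Sum>i\<in>I. norm_sq_on {..<D} (u i)) * (\<Sum>j\<in>J. norm_sq_on {..<D} (v j)) +
        2 * (\<Sum>i\<in>I. \<Sum>j\<in>J. (norm (cinner_on {..<D} (u i) (v j)))\<^sup>2)"
    unfolding mult.assoc sum.distrib unfolding sum_product unfolding sum_distrib_left ..
  finally show ?thesis .
qed

lemma expectation_quad:
  assumes "psd_kernel D B"
  shows "(\<integral>\<^sup>+\<omega>. ennreal (quad D B \<omega>) \<partial>L) = ennreal (kernel_trace D B)"
proof -
  obtain c where c: "\<And>w. quad D B w = (\<Sum>i<D. (norm (\<Sum>x<D. conjugate (c i x) * w x))\<^sup>2)"
    "kernel_trace D B = (\<Sum>i<D. norm_sq_on {..<D} (c i))"
    by (rule psd_kernel_quad_sum[OF assms]) blast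
  show ?thesis
    unfolding c second_moment_sum by simp
qed

lemma expectation_quad_sq:
  assumes "psd_kernel D B"
  shows "(\<integral>\<^sup>+\<omega>. ennreal ((quad D B \<omega>)\<^sup>2) \<partial>L) \<le> ennreal (a * (kernel_trace D B)\<^sup>2 + 2 * frobenius_sq D B)"
proof -
  obtain c where c: "\<And>w. quad D B w = (\<Sum>i<D. (norm (\<Sum>x<D. conjugate (c i x) * w x))\<^sup>2)"
    "kernel_trace D B = (\<Sum>i<D. norm_sq_on {..<D} (c i))"
    "frobenius_sq D B = (\<Sum>i<D. \<Sum>j<D. (norm (cinner_on {..<D} (c i) (c j)))\<^sup>2)"
    by (rule psd_kernel_quad_sum[OF assms]) blast
  show ?thesis
    using fourth_moment_sum[of "\<lambda>i x. conjugate (c i x)" "{..<D}" "\<lambda>i x. conjugate (c i x)" "{..<D}"]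
    unfolding c power2_eq_square[of "sum _ _"] norm_cinner_on_conjugate norm_sq_on_conjugate
    by (simp only: mult.assoc)
qed

lemma expectation_apply_sq:
  "(\<integral>\<^sup>+\<omega>. ennreal (norm_sq_on {..<D} (apply_kernel D B \<omega>)) \<partial>L) = ennreal (frobenius_sq D B)"
  using second_moment_sum[of B "{..<D}"]
  by (simp add: norm_sq_on_def apply_kernel_def frobenius_sq_def)

lemma expectation_apply_sq_quad:
  assumes "psd_kernel D B"
  shows "(\<integral>\<^sup>+\<omega>. ennreal (norm_sq_on {..<D} (apply_kernel D B \<omega>) * quad D B \<omega>) \<partial>L)
    \<le> ennreal ((a + 2) * frobenius_sq D B * kernel_trace D B)"
proof -
  obtain c where c: "\<And>w. quad D B w = (\<Sum>i<D. (norm (\<Sum>x<D. conjugate (c i x) * w x))\<^sup>2)"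
    "kernel_trace D B = (\<Sum>i<D. norm_sq_on {..<D} (c i))"
    by (rule psd_kernel_quad_sum[OF assms]) blast
  have f: "frobenius_sq D B = (\<Sum>x<D. norm_sq_on {..<D} (B x))"
    by (simp add: frobenius_sq_def norm_sq_on_def)
  have "(\<Sum>x<D. \<Sum>j<D. (norm (cinner_on {..<D} (B x) (\<lambda>y. conjugate (c j y))))\<^sup>2) \<le>
      (\<Sum>x<D. \<Sum>j<D. norm_sq_on {..<D} (B x) * norm_sq_on {..<D} (c j))"
    by (intro sum_mono order_trans[OF cinner_on_Cauchy_Schwarz]) simp
  also have "\<dots> = frobenius_sq D B * kernel_trace D B"
    unfolding f c sum_product ..
  finally have *: "(\<Sum>x<D. \<Sum>j<D. (norm (cinner_on {..<D} (B x) (\<lambda>y. conjugate (c j y))))\<^sup>2) \<le>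
    frobenius_sq D B * kernel_trace D B" .
  have "(\<integral>\<^sup>+\<omega>. ennreal (norm_sq_on {..<D} (apply_kernel D B \<omega>) * quad D B \<omega>) \<partial>L)
    \<le> ennreal (a * frobenius_sq D B * kernel_trace D B +
      2 * (\<Sum>x<D. \<Sum>j<D. (norm (cinner_on {..<D} (B x) (\<lambda>y. conjugate (c j y))))\<^sup>2))"
    using fourth_moment_sum[of B "{..<D}" "\<lambda>i x. conjugate (c i x)" "{..<D}"]
    unfolding c f norm_sq_on_conjugate norm_sq_on_def[of _ "apply_kernel _ _ _"] apply_kernel_def .
  also have "\<dots> \<le> ennreal ((a + 2) * frobenius_sq D B * kernel_trace D B)"
    using * by (intro ennreal_leI) (simp add: algebra_simps)
  finally show ?thesis .
qed

text \<open>
  With \<open>X = |B w|\<^sup>2\<close> and \<open>Y = w\<^sup>* B w\<close> the trace drops by \<open>X / Y\<close>. A lower bound for the mean of this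
  quotient follows from the linearization \<open>X / Y \<ge> 2 s X - s\<^sup>2 X Y\<close>, an expansion of
  \<open>X (1 - s Y)\<^sup>2 / Y \<ge> 0\<close>: its right-hand side only needs \<open>E X = |B|\<^sub>F\<^sup>2\<close> and
  \<open>E X Y \<le> (a + 2) |B|\<^sub>F\<^sup>2 tr B\<close>, and \<open>s = 1 / ((a + 2) T)\<close> is the best choice when \<open>tr B = T\<close>.
\<close>

lemma expected_trace_drop:
  assumes psd: "psd_kernel D B" and T: "kernel_trace D B \<le> T" "0 < T" and s: "s = 1 / ((a + 2) * T)"
  shows "(\<integral>\<^sup>+\<omega>. ennreal (kernel_trace D (deflate D B \<omega>)) \<partial>L) + ennreal (s * frobenius_sq D B)
    \<le> ennreal (kernel_trace D B)"
proof -
  let ?X = "\<lambda>\<omega>. norm_sq_on {..<D} (apply_kernel D B \<omega>)"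
  let ?I = "\<integral>\<^sup>+\<omega>. ennreal (kernel_trace D (deflate D B \<omega>)) \<partial>L"
  have s_pos: "0 < s" and sa: "s * ((a + 2) * T) = 1"
    using T a_ge_1 by (simp_all add: s)
  have [measurable]: "(\<lambda>\<omega>. kernel_trace D (deflate D B \<omega>)) \<in> borel_measurable L"
    by (intro borel_measurable_kernel_trace borel_measurable_deflate) auto
  have [measurable]: "?X \<in> borel_measurable L"
    unfolding norm_sq_on_def apply_kernel_def by measurable
  have [measurable]: "quad D B \<in> borel_measurable L"
    by (intro borel_measurable_quad) auto
  \<comment> \<open>For \<open>Y = 0\<close> the numerator vanishes as well and the trace does not change.\<close>
  have pointwise: "kernel_trace D (deflate D B \<omega>) + 2 * s * ?X \<omega> \<le> kernel_trace D B + s\<^sup>2 * (?X \<omega> * quad D B \<omega>)" for \<omega>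
  proof (cases "quad D B \<omega> = 0")
    case True
    then have "?X \<omega> = 0"
      using psd_kernel_null[OF psd, of \<omega>] psd_kernel_quad[OF psd, of \<omega>] by (simp add: norm_sq_on_def)
    then show ?thesis by (simp add: trace_deflate[OF psd])
  next
    case False
    then have "0 < quad D B \<omega>" using quad_nonneg[of D B \<omega>] by linarith
    have "0 \<le> ?X \<omega> * (1 - s * quad D B \<omega>)\<^sup>2 / quad D B \<omega>"
      by simp
    also have "\<dots> = ?X \<omega> / quad D B \<omega> - 2 * s * ?X \<omega> + s\<^sup>2 * (?X \<omega> * quad D B \<omega>)"
      using False by (simp add: field_simps power2_eq_square)
    finally show ?thesis by (simp add: trace_deflate[OF psd])
  qed
  have "?I + ennreal (2 * s * frobenius_sq D B) =
      (\<integral>\<^sup>+\<omega>. ennreal (kernel_trace D (deflate D B \<omega>)) + ennreal (2 * s) * ennreal (?X \<omega>) \<partial>L)"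
    using s_pos by (subst nn_integral_add) (simp_all add: nn_integral_cmult expectation_apply_sq ennreal_mult)
  also have "\<dots> \<le> (\<integral>\<^sup>+\<omega>. ennreal (kernel_trace D B) + ennreal (s\<^sup>2) * ennreal (?X \<omega> * quad D B \<omega>) \<partial>L)"
  proof (intro nn_integral_mono)
    fix \<omega>
    show "ennreal (kernel_trace D (deflate D B \<omega>)) + ennreal (2 * s) * ennreal (?X \<omega>) \<le>
        ennreal (kernel_trace D B) + ennreal (s\<^sup>2) * ennreal (?X \<omega> * quad D B \<omega>)"
      using pointwise[of \<omega>] s_pos
      by (simp add: ennreal_mult[symmetric] ennreal_plus[symmetric] del: ennreal_plus)
  qed
  also have "\<dots> = ennreal (kernel_trace D B) + ennreal (s\<^sup>2) * (\<integral>\<^sup>+\<omega>. ennreal (?X \<omega> * quad D B \<omega>) \<partial>L)"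
    by (simp add: nn_integral_add nn_integral_cmult emeasure_space_1)
  also have "\<dots> \<le> ennreal (kernel_trace D B) + ennreal (s\<^sup>2) * ennreal ((a + 2) * frobenius_sq D B * kernel_trace D B)"
    by (intro add_left_mono mult_left_mono expectation_apply_sq_quad psd) simp
  also have "\<dots> \<le> ennreal (kernel_trace D B) + ennreal (s * frobenius_sq D B)"
  proof -
    have "s\<^sup>2 * ((a + 2) * frobenius_sq D B * kernel_trace D B) \<le> s\<^sup>2 * ((a + 2) * frobenius_sq D B * T)"
      using T a_ge_1 by (intro mult_left_mono) auto
    also have "\<dots> = s * frobenius_sq D B * (s * ((a + 2) * T))"
      by (simp add: power2_eq_square mult_ac)
    also have "\<dots> = s * frobenius_sq D B"
      unfolding sa by simp
    finally show ?thesis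
      using a_ge_1 by (intro add_left_mono) (simp add: ennreal_mult[symmetric] ennreal_leI)
  qed
  finally have "?I + ennreal (2 * s * frobenius_sq D B) \<le>
      ennreal (kernel_trace D B) + ennreal (s * frobenius_sq D B)" .
  moreover have "ennreal (2 * s * frobenius_sq D B) =
      ennreal (s * frobenius_sq D B) + ennreal (s * frobenius_sq D B)"
    using s_pos by (subst ennreal_plus[symmetric]) simp_all
  ultimately have "ennreal (s * frobenius_sq D B) + (?I + ennreal (s * frobenius_sq D B)) \<le>
      ennreal (s * frobenius_sq D B) + ennreal (kernel_trace D B)"
    by (simp only: add_ac)
  then show ?thesis
    by (simp only: ennreal_add_left_cancel_le) simp
qed

lemma measurable_component_component [measurable]:
  "j \<in> J \<Longrightarrow> x < D \<Longrightarrow> (\<lambda>\<omega>. \<omega> j x) \<in> borel_measurable (\<Pi>\<^sub>M j\<in>J. L)"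
  by (rule measurable_compose[where f = "\<lambda>\<omega>. \<omega> j" and N = L])
     (auto intro: measurable_component_singleton measurable_component_L)

lemma borel_measurable_residual_PiM:
  assumes "{..<k} \<subseteq> J" "x < D" "y < D"
  shows "(\<lambda>\<omega>. residual D k B \<omega> x y) \<in> borel_measurable (\<Pi>\<^sub>M j\<in>J. L)"
proof (rule borel_measurable_residual[of D "\<lambda>_. B" _ k "\<lambda>\<omega>. \<omega>"])
  show "(\<lambda>\<omega>. \<omega> j x) \<in> borel_measurable (\<Pi>\<^sub>M j\<in>J. L)" if "j < k" "x < D" for j x
    using assms(1) that by (intro measurable_component_component) auto
qed (use assms(2,3) in simp_all)

lemma product_sigma_finite_L: "product_sigma_finite (\<lambda>_ :: nat. L)"
  by (rule product_sigma_finite.intro) (rule sigma_finite_measure_axioms)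

lemma prob_space_PiM_L: "prob_space (\<Pi>\<^sub>M j\<in>(J :: nat set). L)"
  by (rule prob_space_PiM) (rule prob_space_axioms)

text \<open>
  The induction peels off the sketch vector that is used first. The following deflations only
  decrease the Frobenius norm, so each of the \<open>k\<close> steps pays at least \<open>s\<close> times the final squared
  norm out of the initial trace.
\<close>

lemma expected_residual_energy:
  assumes "psd_kernel D B" "kernel_trace D B \<le> T" and T: "0 < T" and s: "s = 1 / ((a + 2) * T)"
  shows "(\<integral>\<^sup>+\<omega>. ennreal (real k * s * frobenius_sq D (residual D k B \<omega>) + kernel_trace D (residual D k B \<omega>))
      \<partial>(\<Pi>\<^sub>M j\<in>{..<k}. L)) \<le> ennreal (kernel_trace D B)"
  using assms(1,2)
proof (induction k arbitrary: B)
  case 0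
  interpret Q: prob_space "\<Pi>\<^sub>M j\<in>({} :: nat set). L" by (rule prob_space_PiM_L)
  show ?case by (simp add: Q.emeasure_space_1)
next
  case (Suc k)
  let ?P = "\<Pi>\<^sub>M j\<in>{..<k}. L"
  interpret P: product_sigma_finite "\<lambda>_ :: nat. L" by (rule product_sigma_finite_L)
  interpret Q: prob_space ?P by (rule prob_space_PiM_L)
  have s_pos: "0 < s" using T a_ge_1 by (simp add: s)
  let ?f = "\<lambda>k B \<omega>. real k * s * frobenius_sq D (residual D k B \<omega>) + kernel_trace D (residual D k B \<omega>)"
  have meas: "(\<lambda>\<omega>. ennreal (?f k' B \<omega>)) \<in> borel_measurable (\<Pi>\<^sub>M j\<in>J. L)" if "{..<k'} \<subseteq> J" for k' B J
    by (intro measurable_compose[OF _ measurable_ennreal] borel_measurable_add borel_measurable_times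
        borel_measurable_const borel_measurable_frobenius_sq borel_measurable_kernel_trace
        borel_measurable_residual_PiM that)
  have "(\<integral>\<^sup>+\<omega>. ennreal (?f (Suc k) B \<omega>) \<partial>(\<Pi>\<^sub>M j\<in>{..<Suc k}. L)) =
      (\<integral>\<^sup>+y. (\<integral>\<^sup>+\<omega>. ennreal (?f (Suc k) B (fun_upd \<omega> k y)) \<partial>?P) \<partial>L)"
    unfolding lessThan_Suc
    by (rule P.product_nn_integral_insert_rev) (use meas[of "Suc k" "insert k {..<k}"] in \<open>auto simp: lessThan_Suc\<close>)
  also have "\<dots> \<le> (\<integral>\<^sup>+y. ennreal (kernel_trace D (deflate D B y)) + ennreal (s * frobenius_sq D B) \<partial>L)"
  proof (rule nn_integral_mono)
    fix y
    let ?B = "deflate D B y"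
    have psd': "psd_kernel D ?B" by (rule psd_deflate[OF Suc.prems(1)])
    have tr': "kernel_trace D ?B \<le> T"
      using trace_residual_le[OF Suc.prems(1), of 1 "\<lambda>_. y"] Suc.prems(2) by simp
    have "(\<integral>\<^sup>+\<omega>. ennreal (?f (Suc k) B (fun_upd \<omega> k y)) \<partial>?P) \<le>
        (\<integral>\<^sup>+\<omega>. ennreal (?f k ?B \<omega>) + ennreal (s * frobenius_sq D B) \<partial>?P)"
    proof (rule nn_integral_mono)
      fix \<omega>
      have r: "residual D (Suc k) B (fun_upd \<omega> k y) = residual D k ?B \<omega>"
        by (simp add: residual_cong[of k "fun_upd \<omega> k y" \<omega>])
      have "frobenius_sq D (residual D k ?B \<omega>) \<le> frobenius_sq D B"
        using frobenius_residual_le[OF psd', of k \<omega>] frobenius_deflate_le[OF Suc.prems(1), of y] by simp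
      then have "s * frobenius_sq D (residual D k ?B \<omega>) \<le> s * frobenius_sq D B"
        using s_pos by (intro mult_left_mono) auto
      then have "?f (Suc k) B (fun_upd \<omega> k y) \<le> ?f k ?B \<omega> + s * frobenius_sq D B"
        unfolding r by (simp add: algebra_simps)
      then have "ennreal (?f (Suc k) B (fun_upd \<omega> k y)) \<le> ennreal (?f k ?B \<omega> + s * frobenius_sq D B)"
        by (rule ennreal_leI)
      also have "\<dots> = ennreal (?f k ?B \<omega>) + ennreal (s * frobenius_sq D B)"
        using s_pos by (intro ennreal_plus) simp_all
      finally show "ennreal (?f (Suc k) B (fun_upd \<omega> k y)) \<le> ennreal (?f k ?B \<omega>) + ennreal (s * frobenius_sq D B)" .
    qed
    also have "\<dots> = (\<integral>\<^sup>+\<omega>. ennreal (?f k ?B \<omega>) \<partial>?P) + ennreal (s * frobenius_sq D B)"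
      by (subst nn_integral_add) (auto intro: meas simp: Q.emeasure_space_1)
    also have "\<dots> \<le> ennreal (kernel_trace D ?B) + ennreal (s * frobenius_sq D B)"
      by (intro add_right_mono Suc.IH psd' tr')
    finally show "(\<integral>\<^sup>+\<omega>. ennreal (?f (Suc k) B (fun_upd \<omega> k y)) \<partial>?P) \<le>
      ennreal (kernel_trace D ?B) + ennreal (s * frobenius_sq D B)" .
  qed
  also have "\<dots> = (\<integral>\<^sup>+y. ennreal (kernel_trace D (deflate D B y)) \<partial>L) + ennreal (s * frobenius_sq D B)"
    by (subst nn_integral_add)
       (auto simp: emeasure_space_1 intro!: measurable_compose[OF _ measurable_ennreal]
          borel_measurable_kernel_trace borel_measurable_deflate)
  also have "\<dots> \<le> ennreal (kernel_trace D B)"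
    by (rule expected_trace_drop[OF Suc.prems T s])
  finally show ?case .
qed

text \<open>
  The previous lemma with \<open>T = tr B\<close>. When the trace vanishes, \<open>T\<close> is replaced by 1 to keep it
  positive; both sides are then zero.
\<close>

lemma expected_frobenius_residual:
  assumes psd: "psd_kernel D B" and k: "0 < k"
  shows "(\<integral>\<^sup>+\<omega>. ennreal (frobenius_sq D (residual D k B \<omega>)) \<partial>(\<Pi>\<^sub>M j\<in>{..<k}. L))
    \<le> ennreal ((a + 2) * (kernel_trace D B)\<^sup>2 / real k)"
proof -
  let ?P = "\<Pi>\<^sub>M j\<in>{..<k}. L"
  define T where "T = (if kernel_trace D B = 0 then 1 else kernel_trace D B)"
  define s where "s = 1 / ((a + 2) * T)"
  have T: "0 < T" "kernel_trace D B \<le> T"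
    using kernel_trace_nonneg[of D B] by (auto simp: T_def less_le)
  have ks: "0 < real k * s" using T a_ge_1 k by (simp add: s_def)
  have meas: "(\<lambda>\<omega>. ennreal (frobenius_sq D (residual D k B \<omega>))) \<in> borel_measurable ?P"
    by (intro measurable_compose[OF _ measurable_ennreal] borel_measurable_frobenius_sq
        borel_measurable_residual_PiM) auto
  let ?I = "\<integral>\<^sup>+\<omega>. ennreal (frobenius_sq D (residual D k B \<omega>)) \<partial>?P"
  have "ennreal (real k * s) * ?I =
      (\<integral>\<^sup>+\<omega>. ennreal (real k * s * frobenius_sq D (residual D k B \<omega>)) \<partial>?P)"
    using ks by (simp add: nn_integral_cmult[OF meas, symmetric] ennreal_mult)
  also have "\<dots> \<le> (\<integral>\<^sup>+\<omega>. ennreal (real k * s * frobenius_sq D (residual D k B \<omega>) +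
      kernel_trace D (residual D k B \<omega>)) \<partial>?P)"
    by (intro nn_integral_mono ennreal_leI) simp
  also have "\<dots> \<le> ennreal (kernel_trace D B)"
    by (rule expected_residual_energy[OF psd T(2,1) s_def])
  finally have *: "ennreal (real k * s) * ?I \<le> ennreal (kernel_trace D B)" .
  have "?I = ennreal (1 / (real k * s)) * (ennreal (real k * s) * ?I)"
    unfolding mult.assoc[symmetric] using ks by (subst ennreal_mult[symmetric]) auto
  also have "\<dots> \<le> ennreal (1 / (real k * s)) * ennreal (kernel_trace D B)"
    by (intro mult_left_mono *) simp
  also have "\<dots> = ennreal (1 / (real k * s) * kernel_trace D B)"
    using ks by (subst ennreal_mult) auto
  also have "1 / (real k * s) * kernel_trace D B = (a + 2) * (kernel_trace D B)\<^sup>2 / real k"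
    using a_ge_1 k by (auto simp: s_def T_def power2_eq_square)
  finally show ?thesis .
qed

text \<open>
  The variance bound for \<open>w\<^sup>* B w\<close>. The shift \<open>t\<close> stands for the part of a longer sum that has
  already been fixed; it contributes just \<open>t\<^sup>2\<close> since the form is centred at its mean.
\<close>

lemma expected_shifted_quad_sq:
  assumes psd: "psd_kernel D B"
  shows "(\<integral>\<^sup>+\<omega>. ennreal ((t + (quad D B \<omega> - kernel_trace D B))\<^sup>2) \<partial>L)
    \<le> ennreal (t\<^sup>2 + ((a - 1) * (kernel_trace D B)\<^sup>2 + 2 * frobenius_sq D B))"
proof -
  let ?\<mu> = "kernel_trace D B"
  have [measurable]: "quad D B \<in> borel_measurable L"
    by (intro borel_measurable_quad) auto
  have i1: "integrable L (quad D B)"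
    by (rule integrableI_nn_integral_finite[OF _ _ expectation_quad[OF psd]]) auto
  have "ennreal (\<integral>\<omega>. quad D B \<omega> \<partial>L) = ennreal ?\<mu>"
    unfolding expectation_quad[OF psd, symmetric] by (rule nn_integral_eq_integral[symmetric, OF i1]) simp
  then have e1: "(\<integral>\<omega>. quad D B \<omega> \<partial>L) = ?\<mu>"
    by (simp add: ennreal_inj integral_nonneg_AE)
  have i2: "integrable L (\<lambda>\<omega>. (quad D B \<omega>)\<^sup>2)"
    by (rule integrableI_nonneg) (use expectation_quad_sq[OF psd] in \<open>auto simp: le_less_trans\<close>)
  have "ennreal (\<integral>\<omega>. (quad D B \<omega>)\<^sup>2 \<partial>L) \<le> ennreal (a * ?\<mu>\<^sup>2 + 2 * frobenius_sq D B)"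
    using expectation_quad_sq[OF psd] nn_integral_eq_integral[OF i2] by simp
  then have e2: "(\<integral>\<omega>. (quad D B \<omega>)\<^sup>2 \<partial>L) \<le> a * ?\<mu>\<^sup>2 + 2 * frobenius_sq D B"
    using a_ge_1 by (subst (asm) ennreal_le_iff) auto
  have eq: "(t + (quad D B \<omega> - ?\<mu>))\<^sup>2 = (t - ?\<mu>)\<^sup>2 + 2 * (t - ?\<mu>) * quad D B \<omega> + (quad D B \<omega>)\<^sup>2" for \<omega>
    by (simp add: power2_eq_square algebra_simps)
  have i3: "integrable L (\<lambda>\<omega>. (t + (quad D B \<omega> - ?\<mu>))\<^sup>2)"
    unfolding eq using i1 i2 by simp
  have "(\<integral>\<omega>. (t + (quad D B \<omega> - ?\<mu>))\<^sup>2 \<partial>L) = (t - ?\<mu>)\<^sup>2 + 2 * (t - ?\<mu>) * ?\<mu> + (\<integral>\<omega>. (quad D B \<omega>)\<^sup>2 \<partial>L)"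
    unfolding eq using i1 i2 e1 by (simp add: prob_space)
  also have "\<dots> \<le> t\<^sup>2 + ((a - 1) * ?\<mu>\<^sup>2 + 2 * frobenius_sq D B)"
    using e2 by (simp add: power2_eq_square algebra_simps)
  finally show ?thesis
    by (subst nn_integral_eq_integral[OF i3]) (auto intro: ennreal_leI)
qed

text \<open>
  Variances of independent summands add up. The shift \<open>t\<close> collects the summands that have been
  split off by Fubini, and the centring of each summand removes the cross terms.
\<close>

lemma expected_sum_quad_sq:
  assumes psd: "psd_kernel D B"
  shows "(\<integral>\<^sup>+\<psi>. ennreal ((t + (\<Sum>j<l. quad D B (\<psi> j) - kernel_trace D B))\<^sup>2) \<partial>(\<Pi>\<^sub>M j\<in>{..<l}. L))
    \<le> ennreal (t\<^sup>2 + real l * ((a - 1) * (kernel_trace D B)\<^sup>2 + 2 * frobenius_sq D B))"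
proof (induction l arbitrary: t)
  case 0
  interpret Q: prob_space "\<Pi>\<^sub>M j\<in>({} :: nat set). L" by (rule prob_space_PiM_L)
  show ?case by (simp add: Q.emeasure_space_1)
next
  case (Suc l)
  interpret P: product_sigma_finite "\<lambda>_ :: nat. L" by (rule product_sigma_finite_L)
  let ?\<mu> = "kernel_trace D B" let ?V = "(a - 1) * (kernel_trace D B)\<^sup>2 + 2 * frobenius_sq D B"
  have V: "0 \<le> ?V" using a_ge_1 by simp
  have [measurable]: "quad D B \<in> borel_measurable L"
    by (intro borel_measurable_quad) auto
  have "(\<integral>\<^sup>+\<psi>. ennreal ((t + (\<Sum>j<Suc l. quad D B (\<psi> j) - ?\<mu>))\<^sup>2) \<partial>(\<Pi>\<^sub>M j\<in>{..<Suc l}. L)) =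
    (\<integral>\<^sup>+y. (\<integral>\<^sup>+\<psi>. ennreal ((t + (\<Sum>j<Suc l. quad D B ((fun_upd \<psi> l y) j) - ?\<mu>))\<^sup>2) \<partial>(\<Pi>\<^sub>M j\<in>{..<l}. L)) \<partial>L)"
    unfolding lessThan_Suc[of l]
    by (rule P.product_nn_integral_insert_rev) auto
  also have "\<dots> = (\<integral>\<^sup>+y. (\<integral>\<^sup>+\<psi>. ennreal (((t + (quad D B y - ?\<mu>)) + (\<Sum>j<l. quad D B (\<psi> j) - ?\<mu>))\<^sup>2) \<partial>(\<Pi>\<^sub>M j\<in>{..<l}. L)) \<partial>L)"
    by (intro nn_integral_cong) (simp add: add_ac)
  also have "\<dots> \<le> (\<integral>\<^sup>+y. ennreal ((t + (quad D B y - ?\<mu>))\<^sup>2 + real l * ?V) \<partial>L)"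
    by (intro nn_integral_mono Suc.IH)
  also have "\<dots> = (\<integral>\<^sup>+y. ennreal ((t + (quad D B y - ?\<mu>))\<^sup>2) \<partial>L) + ennreal (real l * ?V)"
    using V by (simp add: nn_integral_add emeasure_space_1)
  also have "\<dots> \<le> ennreal (t\<^sup>2 + ?V) + ennreal (real l * ?V)"
    by (intro add_right_mono expected_shifted_quad_sq psd)
  also have "\<dots> = ennreal (t\<^sup>2 + real (Suc l) * ?V)"
    unfolding ennreal_plus[OF add_nonneg_nonneg[OF zero_le_power2 V]
        mult_nonneg_nonneg[OF of_nat_0_le_iff V], symmetric]
    by (intro arg_cong[of _ _ ennreal]) (simp add: algebra_simps)
  finally show ?case .
qed

lemma borel_measurable_nystrom_error:
  "nystrom_error D k B \<in> borel_measurable ((\<Pi>\<^sub>M j\<in>{..<k}. L) \<Otimes>\<^sub>M (\<Pi>\<^sub>M j\<in>{..<k}. L))"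
proof -
  let ?P = "\<Pi>\<^sub>M j\<in>{..<k}. L"
  have R: "(\<lambda>S. residual D k B (fst S) x y) \<in> borel_measurable (?P \<Otimes>\<^sub>M ?P)" if "x < D" "y < D" for x y
    by (rule measurable_compose[OF measurable_fst borel_measurable_residual_PiM[OF subset_refl that]])
  have \<psi>: "(\<lambda>S. snd S j x) \<in> borel_measurable (?P \<Otimes>\<^sub>M ?P)" if "j < k" "x < D" for j x
    using that by (intro measurable_compose[OF measurable_snd measurable_component_component]) simp_all
  show ?thesis
    unfolding nystrom_error_def
    by (intro borel_measurable_diff borel_measurable_times borel_measurable_const borel_measurable_sum
        borel_measurable_quad borel_measurable_kernel_trace R \<psi>) auto
qed

lemma expected_nystrom_error_sq:
  assumes psd: "psd_kernel D B" and k: "0 < k"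
  shows "(\<integral>\<^sup>+S. ennreal ((nystrom_error D k B S)\<^sup>2) \<partial>((\<Pi>\<^sub>M j\<in>{..<k}. L) \<Otimes>\<^sub>M (\<Pi>\<^sub>M j\<in>{..<k}. L)))
    \<le> ennreal (((a - 1) / real k + 2 * (a + 2) / (real k)\<^sup>2) * (kernel_trace D B)\<^sup>2)"
proof -
  let ?P = "\<Pi>\<^sub>M j\<in>{..<k}. L" and ?T = "kernel_trace D B"
  interpret Q: prob_space ?P by (rule prob_space_PiM_L)
  have "(\<integral>\<^sup>+S. ennreal ((nystrom_error D k B S)\<^sup>2) \<partial>(?P \<Otimes>\<^sub>M ?P)) =
      (\<integral>\<^sup>+\<omega>. (\<integral>\<^sup>+\<psi>. ennreal ((nystrom_error D k B (\<omega>, \<psi>))\<^sup>2) \<partial>?P) \<partial>?P)"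
    using borel_measurable_nystrom_error[of k B]
    by (subst Q.nn_integral_fst[symmetric]) auto
  also have "\<dots> \<le> (\<integral>\<^sup>+\<omega>. ennreal ((a - 1) / real k * ?T\<^sup>2) +
      ennreal (2 / real k) * ennreal (frobenius_sq D (residual D k B \<omega>)) \<partial>?P)"
  proof (rule nn_integral_mono)
    fix \<omega>
    let ?R = "residual D k B \<omega>"
    have "(nystrom_error D k B (\<omega>, \<psi>))\<^sup>2 =
        (1 / real k)\<^sup>2 * (0 + (\<Sum>j<k. quad D ?R (\<psi> j) - kernel_trace D ?R))\<^sup>2" for \<psi>
      unfolding power_mult_distrib[symmetric] using k
      by (intro arg_cong[of _ _ "\<lambda>x. x\<^sup>2"]) (simp add: nystrom_error_def sum_subtractf field_simps)
    then have "(\<integral>\<^sup>+\<psi>. ennreal ((nystrom_error D k B (\<omega>, \<psi>))\<^sup>2) \<partial>?P) =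
        (\<integral>\<^sup>+\<psi>. ennreal ((1 / real k)\<^sup>2) * ennreal ((0 + (\<Sum>j<k. quad D ?R (\<psi> j) - kernel_trace D ?R))\<^sup>2) \<partial>?P)"
      by (simp only: ennreal_mult zero_le_power2)
    also have "\<dots> = ennreal ((1 / real k)\<^sup>2) *
        (\<integral>\<^sup>+\<psi>. ennreal ((0 + (\<Sum>j<k. quad D ?R (\<psi> j) - kernel_trace D ?R))\<^sup>2) \<partial>?P)"
      by (rule nn_integral_cmult, intro measurable_compose[OF _ measurable_ennreal] borel_measurable_power
          borel_measurable_add borel_measurable_const borel_measurable_sum borel_measurable_diff borel_measurable_quad
          measurable_component_component) auto
    also have "\<dots> \<le> ennreal ((1 / real k)\<^sup>2) *
        ennreal (0\<^sup>2 + real k * ((a - 1) * (kernel_trace D ?R)\<^sup>2 + 2 * frobenius_sq D ?R))"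
      by (intro mult_left_mono expected_sum_quad_sq psd_residual psd) simp
    also have "\<dots> = ennreal ((a - 1) / real k * (kernel_trace D ?R)\<^sup>2 + 2 / real k * frobenius_sq D ?R)"
      using k by (subst ennreal_mult'[symmetric], simp, intro arg_cong[of _ _ ennreal])
        (simp add: field_simps power2_eq_square)
    also have "\<dots> \<le> ennreal ((a - 1) / real k * ?T\<^sup>2 + 2 / real k * frobenius_sq D ?R)"
      using a_ge_1 trace_residual_le[OF psd, of k \<omega>]
      by (intro ennreal_leI add_right_mono mult_left_mono power_mono) auto
    also have "\<dots> = ennreal ((a - 1) / real k * ?T\<^sup>2) + ennreal (2 / real k) * ennreal (frobenius_sq D ?R)"
      using a_ge_1 by (subst ennreal_mult'[of "2 / real k", symmetric], simp, intro ennreal_plus) simp_all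
    finally show "(\<integral>\<^sup>+\<psi>. ennreal ((nystrom_error D k B (\<omega>, \<psi>))\<^sup>2) \<partial>?P) \<le>
      ennreal ((a - 1) / real k * ?T\<^sup>2) + ennreal (2 / real k) * ennreal (frobenius_sq D ?R)" .
  qed
  also have "\<dots> = ennreal ((a - 1) / real k * ?T\<^sup>2) +
      ennreal (2 / real k) * (\<integral>\<^sup>+\<omega>. ennreal (frobenius_sq D (residual D k B \<omega>)) \<partial>?P)"
  proof -
    have [measurable]: "(\<lambda>\<omega>. frobenius_sq D (residual D k B \<omega>)) \<in> borel_measurable ?P"
      by (intro borel_measurable_frobenius_sq borel_measurable_residual_PiM) auto
    show ?thesis
      by (simp add: nn_integral_add nn_integral_cmult Q.emeasure_space_1)
  qed
  also have "\<dots> \<le> ennreal ((a - 1) / real k * ?T\<^sup>2) + ennreal (2 / real k) * ennreal ((a + 2) * ?T\<^sup>2 / real k)"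
    by (intro add_left_mono mult_left_mono expected_frobenius_residual psd k) simp
  also have "\<dots> = ennreal ((a - 1) / real k * ?T\<^sup>2 + 2 / real k * ((a + 2) * ?T\<^sup>2 / real k))"
    using a_ge_1 by (subst ennreal_mult'[of "2 / real k", symmetric], simp, intro ennreal_plus[symmetric]) simp_all
  also have "(a - 1) / real k * ?T\<^sup>2 + 2 / real k * ((a + 2) * ?T\<^sup>2 / real k) =
      ((a - 1) / real k + 2 * (a + 2) / (real k)\<^sup>2) * ?T\<^sup>2"
    using k by (simp add: field_simps power2_eq_square)
  finally show ?thesis .
qed

text \<open>
  Chebyshev's inequality. A kernel of trace zero needs a separate argument since Markov's
  inequality cannot be scaled; there the error vanishes almost surely.
\<close>

theorem nystrom_error_concentration:
  assumes psd: "psd_kernel D B" and k: "0 < k" and \<epsilon>: "0 < \<epsilon>"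
    and small: "(a - 1) / real k + 2 * (a + 2) / (real k)\<^sup>2 \<le> \<delta> * \<epsilon>\<^sup>2"
  shows "measure ((\<Pi>\<^sub>M j\<in>{..<k}. L) \<Otimes>\<^sub>M (\<Pi>\<^sub>M j\<in>{..<k}. L))
    {S \<in> space ((\<Pi>\<^sub>M j\<in>{..<k}. L) \<Otimes>\<^sub>M (\<Pi>\<^sub>M j\<in>{..<k}. L)). \<bar>nystrom_error D k B S\<bar> \<le> \<epsilon> * kernel_trace D B} \<ge> 1 - \<delta>"
proof -
  let ?P = "\<Pi>\<^sub>M j\<in>{..<k}. L" and ?T = "kernel_trace D B"
  let ?N = "?P \<Otimes>\<^sub>M ?P"
  interpret Q: prob_space ?P by (rule prob_space_PiM_L)
  interpret PQ: pair_prob_space ?P ?P ..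
  have [measurable]: "nystrom_error D k B \<in> borel_measurable ?N"
    by (rule borel_measurable_nystrom_error)
  have "0 \<le> (a - 1) / real k + 2 * (a + 2) / (real k)\<^sup>2"
    using a_ge_1 by simp
  then have "0 \<le> \<delta> * \<epsilon>\<^sup>2" using small by (rule order_trans)
  then have \<delta>: "0 \<le> \<delta>" using \<epsilon> by (simp add: zero_le_mult_iff)
  have E: "(\<integral>\<^sup>+S. ennreal ((nystrom_error D k B S)\<^sup>2) \<partial>?N) \<le> ennreal (\<delta> * (\<epsilon> * ?T)\<^sup>2)"
    using mult_right_mono[OF small, of "?T\<^sup>2"]
    by (intro order_trans[OF expected_nystrom_error_sq[OF psd k]] ennreal_leI)
       (simp add: power_mult_distrib mult_ac)
  let ?bad = "{S \<in> space ?N. \<epsilon> * ?T < \<bar>nystrom_error D k B S\<bar>}"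
  have "emeasure ?N ?bad \<le> ennreal \<delta>"
  proof (cases "?T = 0")
    case True
    then have "(\<integral>\<^sup>+S. ennreal ((nystrom_error D k B S)\<^sup>2) \<partial>?N) = 0"
      using E by simp
    then have "AE S in ?N. ennreal ((nystrom_error D k B S)\<^sup>2) = 0"
      by (subst (asm) nn_integral_0_iff_AE) auto
    then have "AE S in ?N. \<not> \<epsilon> * ?T < \<bar>nystrom_error D k B S\<bar>"
      by eventually_elim (simp add: True ennreal_eq_0_iff)
    then have "emeasure ?N ?bad = 0"
      by (subst (asm) AE_iff_measurable[OF _ refl]) auto
    then show ?thesis by simp
  next
    case False
    then have c: "0 < \<epsilon> * ?T" using \<epsilon> kernel_trace_nonneg[of D B] by (simp add: less_le)
    let ?c = "ennreal (1 / (\<epsilon> * ?T)\<^sup>2)"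
    have "emeasure ?N ?bad \<le> emeasure ?N {S \<in> space ?N. 1 \<le> ?c * ennreal ((nystrom_error D k B S)\<^sup>2)}"
    proof (rule emeasure_mono)
      show "?bad \<subseteq> {S \<in> space ?N. 1 \<le> ?c * ennreal ((nystrom_error D k B S)\<^sup>2)}"
      proof safe
        fix S assume "\<epsilon> * ?T < \<bar>nystrom_error D k B S\<bar>"
        then have "(\<epsilon> * ?T)\<^sup>2 \<le> (nystrom_error D k B S)\<^sup>2"
          using c by (metis abs_of_pos less_imp_le power2_abs power_mono abs_ge_zero)
        moreover have "p \<le> q \<Longrightarrow> 0 < p \<Longrightarrow> 1 \<le> 1 / p * q" for p q :: real
          by simp
        ultimately have "1 \<le> 1 / (\<epsilon> * ?T)\<^sup>2 * (nystrom_error D k B S)\<^sup>2"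
          using c by (metis zero_less_power)
        then show "1 \<le> ?c * ennreal ((nystrom_error D k B S)\<^sup>2)"
          by (simp add: ennreal_mult[symmetric])
      qed
    qed measurable
    also have "\<dots> \<le> ?c * (\<integral>\<^sup>+S. ennreal ((nystrom_error D k B S)\<^sup>2) * indicator (space ?N) S \<partial>?N)"
      by (rule nn_integral_Markov_inequality) auto
    also have "\<dots> = ?c * (\<integral>\<^sup>+S. ennreal ((nystrom_error D k B S)\<^sup>2) \<partial>?N)"
      by (intro arg_cong2[of _ _ _ _ "(*)"] refl nn_integral_cong) simp
    also have "\<dots> \<le> ?c * ennreal (\<delta> * (\<epsilon> * ?T)\<^sup>2)"
      by (intro mult_left_mono E) simp
    also have "\<dots> = ennreal \<delta>"
      using c \<delta> by (subst ennreal_mult[symmetric]) auto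
    finally show ?thesis .
  qed
  then have "measure ?N ?bad \<le> \<delta>"
    unfolding PQ.emeasure_eq_measure using \<delta> by (simp add: ennreal_le_iff)
  moreover have "{S \<in> space ?N. \<bar>nystrom_error D k B S\<bar> \<le> \<epsilon> * ?T} = space ?N - ?bad"
    by auto
  moreover have "?bad \<in> sets ?N"
    by measurable
  ultimately show ?thesis
    by (simp add: PQ.prob_compl)
qed

end

section \<open>Gaussian moments of a single core\<close>

lemma prod_power_indicator:
  fixes f :: "'e \<Rightarrow> 'a :: comm_semiring_1"
  assumes "finite E" "i \<in> E"
  shows "(\<Prod>e\<in>E. f e ^ of_bool (e = i)) = f i"
proof -
  have "(\<Prod>e\<in>E. f e ^ of_bool (e = i)) = (\<Prod>e\<in>E. if i = e then f e else 1)"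
    by (intro prod.cong) auto
  then show ?thesis using assms by simp
qed

text \<open>
  What is used of the centred Gaussian law of variance \<open>v\<close>: its moments up to order four, with
  \<open>\<tau> = E g\<^sup>2 / E |g|\<^sup>2\<close>. The real case is \<open>\<tau> = 1\<close> and the circular complex case is \<open>\<tau> = 0\<close>; in both
  the fourth moment is \<open>(2 + \<tau>) v\<^sup>2\<close>, which makes Wick's formula hold without a diagonal
  correction.
\<close>

locale wick_family =
  fixes N :: "real \<Rightarrow> 'a :: real_or_complex measure" and \<tau> :: real
  assumes prob_space_N: "0 < v \<Longrightarrow> prob_space (N v)"
    and sets_N: "sets (N v) = sets borel"
    and integrable_norm_4: "0 < v \<Longrightarrow> integrable (N v) (\<lambda>x. (norm x) ^ 4)"
    and mean_N: "0 < v \<Longrightarrow> (\<integral>x. x \<partial>N v) = 0"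
    and mean_conjugate_N: "0 < v \<Longrightarrow> (\<integral>x. conjugate x \<partial>N v) = 0"
    and variance_N: "0 < v \<Longrightarrow> (\<integral>x. x * conjugate x \<partial>N v) = of_real v"
    and square_N: "0 < v \<Longrightarrow> (\<integral>x. x\<^sup>2 \<partial>N v) = of_real (\<tau> * v)"
    and square_conjugate_N: "0 < v \<Longrightarrow> (\<integral>x. (conjugate x)\<^sup>2 \<partial>N v) = of_real (\<tau> * v)"
    and fourth_N: "0 < v \<Longrightarrow> (\<integral>x. x\<^sup>2 * (conjugate x)\<^sup>2 \<partial>N v) = of_real ((2 + \<tau>) * v\<^sup>2)"
    and \<tau>_cases: "\<tau> = 0 \<or> \<tau> = 1 \<and> (\<forall>x :: 'a. conjugate x = x)"
begin

definition mixed_moment :: "real \<Rightarrow> nat \<Rightarrow> nat \<Rightarrow> 'a" where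
  "mixed_moment v p q = (\<integral>x. x ^ p * conjugate x ^ q \<partial>N v)"

lemma measurable_mixed [measurable]: "(\<lambda>x. x ^ p * conjugate x ^ q) \<in> borel_measurable (N v)"
  unfolding measurable_cong_sets[OF sets_N refl] by measurable

lemma integrable_mixed:
  assumes "0 < v" "p + q \<le> 4"
  shows "integrable (N v) (\<lambda>x. x ^ p * conjugate x ^ q)"
proof -
  interpret prob_space "N v" by (rule prob_space_N[OF assms(1)])
  have "integrable (N v) (\<lambda>x. 1 + (norm x) ^ 4)"
    using integrable_norm_4[OF assms(1)] by simp
  then show ?thesis
  proof (rule Bochner_Integration.integrable_bound)
    show "AE x in N v. norm (x ^ p * conjugate x ^ q) \<le> norm (1 + (norm x) ^ 4)"
    proof (rule AE_I2)
      fix x :: 'a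
      have "norm (x ^ p * conjugate x ^ q) = norm x ^ (p + q)"
        by (simp add: norm_mult norm_power power_add)
      also have "\<dots> \<le> 1 + norm x ^ 4"
      proof (cases "norm x \<le> 1")
        case True
        then have "norm x ^ (p + q) \<le> 1" by (simp add: power_le_one)
        then show ?thesis by (simp add: add_increasing2)
      next
        case False
        then have "norm x ^ (p + q) \<le> norm x ^ 4" using assms(2) by (intro power_increasing) auto
        then show ?thesis by simp
      qed
      finally show "norm (x ^ p * conjugate x ^ q) \<le> norm (1 + (norm x) ^ 4)" by simp
    qed
  qed simp
qed

lemma mixed_moment_simps:
  assumes v: "0 < v"
  shows "mixed_moment v 0 0 = 1" "mixed_moment v (Suc 0) 0 = 0" "mixed_moment v 0 (Suc 0) = 0"
    "mixed_moment v (Suc 0) (Suc 0) = of_real v"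
    "mixed_moment v 2 0 = of_real (\<tau> * v)" "mixed_moment v 0 2 = of_real (\<tau> * v)"
    "mixed_moment v 2 2 = of_real ((2 + \<tau>) * v\<^sup>2)"
proof -
  interpret prob_space "N v" by (rule prob_space_N[OF v])
  show "mixed_moment v 0 0 = 1" by (simp add: mixed_moment_def prob_space)
qed (simp_all add: mixed_moment_def mean_N mean_conjugate_N variance_N square_N square_conjugate_N fourth_N v)

lemma product_sigma_finite_N: "0 < v \<Longrightarrow> product_sigma_finite (\<lambda>_. N v)"
  by (intro product_sigma_finite.intro prob_space_imp_sigma_finite prob_space_N)

text \<open>
  Independence factorizes the moment; the coordinates outside \<open>S\<close> contribute a factor 1.
\<close>

lemma monomial_moment:
  assumes E: "finite E" "S \<subseteq> E" and deg: "\<And>e. n e + m e \<le> 4"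
    and S: "\<And>e. e \<notin> S \<Longrightarrow> n e = 0 \<and> m e = 0" and v: "0 < v"
  shows "has_bochner_integral (\<Pi>\<^sub>M e\<in>E. N v) (\<lambda>G. \<Prod>e\<in>E. G e ^ n e * conjugate (G e) ^ m e)
    (\<Prod>e\<in>S. mixed_moment v (n e) (m e))"
proof -
  interpret product_sigma_finite "\<lambda>_. N v" by (rule product_sigma_finite_N[OF v])
  have int: "integrable (N v) (\<lambda>x. x ^ n e * conjugate x ^ m e)" for e
    by (rule integrable_mixed[OF v deg])
  have "(\<integral>G. (\<Prod>e\<in>E. G e ^ n e * conjugate (G e) ^ m e) \<partial>(\<Pi>\<^sub>M e\<in>E. N v)) =
      (\<Prod>e\<in>E. mixed_moment v (n e) (m e))"
    unfolding mixed_moment_def by (rule product_integral_prod[OF E(1) int])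
  also have "\<dots> = (\<Prod>e\<in>S. mixed_moment v (n e) (m e))"
    using E S by (intro prod.mono_neutral_right) (auto simp: mixed_moment_simps[OF v])
  finally show ?thesis
    using product_integrable_prod[OF E(1) int] by (simp add: has_bochner_integral_iff)
qed

lemma pair_moment:
  assumes E: "finite E" "a \<in> E" "b \<in> E" and v: "0 < v"
  shows "has_bochner_integral (\<Pi>\<^sub>M e\<in>E. N v) (\<lambda>G. G a * conjugate (G b)) (of_real (v * of_bool (a = b)))"
proof -
  define n where "n e = (of_bool (e = a) :: nat)" for e
  define m where "m e = (of_bool (e = b) :: nat)" for e
  have prod: "(\<Prod>e\<in>E. G e ^ n e * conjugate (G e) ^ m e) = G a * conjugate (G b)"
    for G :: "_ \<Rightarrow> 'a"
    unfolding n_def m_def prod.distrib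
    by (simp add: prod_power_indicator E conjugate_prod[symmetric])
  have "has_bochner_integral (\<Pi>\<^sub>M e\<in>E. N v) (\<lambda>G. \<Prod>e\<in>E. G e ^ n e * conjugate (G e) ^ m e)
      (\<Prod>e\<in>{a, b}. mixed_moment v (n e) (m e))"
    using E v by (intro monomial_moment) (auto simp: n_def m_def)
  moreover have "(\<Prod>e\<in>{a, b}. mixed_moment v (n e) (m e)) = of_real (v * of_bool (a = b))"
    by (cases "a = b") (simp_all add: n_def m_def mixed_moment_simps[OF v])
  ultimately show ?thesis
    unfolding prod by simp
qed

text \<open>
  Wick's formula for four coordinates: the three terms are the three pairings of the factors. If
  some index occurs exactly once then both sides vanish, and the coincidence of all four indices
  is the identity \<open>E |g|\<^sup>4 = (2 + \<tau>) v\<^sup>2\<close>.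
\<close>

lemma quartic_moment:
  assumes E: "finite E" "a \<in> E" "b \<in> E" "c \<in> E" "d \<in> E" and v: "0 < v"
  shows "has_bochner_integral (\<Pi>\<^sub>M e\<in>E. N v) (\<lambda>G. G a * conjugate (G b) * G c * conjugate (G d))
    (of_real (v\<^sup>2 * (of_bool (a = b \<and> c = d) + of_bool (a = d \<and> b = c) + \<tau> * of_bool (a = c \<and> b = d))))"
proof -
  define n where "n e = (of_bool (e = a) + of_bool (e = c) :: nat)" for e
  define m where "m e = (of_bool (e = b) + of_bool (e = d) :: nat)" for e
  have prod: "(\<Prod>e\<in>E. G e ^ n e * conjugate (G e) ^ m e) = G a * conjugate (G b) * G c * conjugate (G d)"
    for G :: "_ \<Rightarrow> 'a"
    unfolding n_def m_def power_add prod.distrib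
    by (simp add: prod_power_indicator E conjugate_prod[symmetric])
  have "has_bochner_integral (\<Pi>\<^sub>M e\<in>E. N v) (\<lambda>G. \<Prod>e\<in>E. G e ^ n e * conjugate (G e) ^ m e)
      (\<Prod>e\<in>{a, b, c, d}. mixed_moment v (n e) (m e))"
    using E v by (intro monomial_moment) (auto simp: n_def m_def)
  moreover have "(\<Prod>e\<in>{a, b, c, d}. mixed_moment v (n e) (m e)) =
      of_real (v\<^sup>2 * (of_bool (a = b \<and> c = d) + of_bool (a = d \<and> b = c) + \<tau> * of_bool (a = c \<and> b = d)))"
  proof -
    have \<tau>2: "\<tau> * (\<tau> * y) = \<tau> * y" for y using \<tau>_cases by auto
    show ?thesis
      by (cases "a = b"; cases "a = c"; cases "a = d"; cases "b = c"; cases "b = d"; cases "c = d")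
        (simp_all add: n_def m_def prod.insert_if mixed_moment_simps[OF v] power2_eq_square \<tau>2 mult_ac
          of_real_mult[symmetric] numeral_2_eq_2[symmetric] algebra_simps del: of_real_mult)
  qed
  ultimately show ?thesis
    unfolding prod by simp
qed

end

text \<open>
  A core is thought of as a Gaussian matrix with rows \<open>\<alpha>\<close> (the bond shared with the part of the
  network that remains) and columns \<open>j\<close> (the indices that are summed over). The injection
  \<open>ent\<close> names its entries.
\<close>

definition row_form :: "'j set \<Rightarrow> ('k \<Rightarrow> 'j \<Rightarrow> 'e) \<Rightarrow> 'k \<Rightarrow> ('j \<Rightarrow> 'a) \<Rightarrow> ('e \<Rightarrow> 'a) \<Rightarrow> 'a :: comm_ring_1" where
  "row_form J ent \<alpha> f G = (\<Sum>j\<in>J. f j * G (ent \<alpha> j))"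

lemma sum_if_const: "(\<Sum>l\<in>J. if P then g l else 0) = (if P then sum g J else (0 :: 'a :: comm_monoid_add))"
  by simp

lemma sum_product_4:
  fixes f h f' h' :: "'j \<Rightarrow> 'a :: comm_ring_1"
  shows "sum f J * sum h J * sum f' J * sum h' J = (\<Sum>i\<in>J. \<Sum>j\<in>J. \<Sum>k\<in>J. \<Sum>l\<in>J. f i * h j * (f' k * h' l))"
proof -
  have "sum f J * sum h J * sum f' J * sum h' J = (sum f J * sum h J) * (sum f' J * sum h' J)"
    by (simp only: mult.assoc)
  also have "\<dots> = (\<Sum>i\<in>J. \<Sum>j\<in>J. \<Sum>k\<in>J. \<Sum>l\<in>J. f i * h j * (f' k * h' l))"
    unfolding sum_product[of f J h J] sum_product[of f' J h' J]
    unfolding sum_distrib_right unfolding sum_distrib_left ..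
  finally show ?thesis .
qed

text \<open>
  Transfers scalar-valued integrals, in which cross terms can be expanded, to the nonnegative
  integrals of the moment conditions.
\<close>

lemma nn_integral_of_norm:
  fixes \<Phi> :: "'b \<Rightarrow> 'a :: real_or_complex"
  assumes int: "has_bochner_integral M \<Phi> z" and eq: "\<And>G. of_real (\<phi> G) = \<Phi> G" and nonneg: "\<And>G. 0 \<le> \<phi> G"
  shows "(\<integral>\<^sup>+G. ennreal (\<phi> G) \<partial>M) = ennreal (norm z)"
proof -
  have i: "integrable M (\<lambda>G. of_real (\<phi> G) :: 'a)" and z: "(\<integral>G. (of_real (\<phi> G) :: 'a) \<partial>M) = z"
    using int unfolding eq by (simp_all add: has_bochner_integral_iff)
  have \<phi>: "integrable M \<phi>"
  proof -
    have n: "norm (of_real (\<phi> G) :: 'a) = \<phi> G" for G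
      using nonneg[of G] by simp
    have "integrable M (\<lambda>G. norm (of_real (\<phi> G) :: 'a))"
      by (rule integrable_norm[OF i])
    also have "(\<lambda>G. norm (of_real (\<phi> G) :: 'a)) = \<phi>"
      by (rule ext) (rule n)
    finally show ?thesis .
  qed
  have "z = of_real (\<integral>G. \<phi> G \<partial>M)"
    unfolding z[symmetric] by (rule integral_of_real[OF \<phi>])
  moreover have "0 \<le> (\<integral>G. \<phi> G \<partial>M)"
    by (intro Bochner_Integration.integral_nonneg nonneg)
  ultimately have "norm z = (\<integral>G. \<phi> G \<partial>M)"
    by simp
  then show ?thesis
    using nonneg by (subst nn_integral_eq_integral[OF \<phi>]) auto
qed

lemma norm_sq_on_Times: "norm_sq_on (R \<times> K) f = (\<Sum>r\<in>R. \<Sum>\<alpha>\<in>K. (norm (f (r, \<alpha>)))\<^sup>2)"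
  unfolding norm_sq_on_def sum.cartesian_product by (intro sum.cong) auto

lemma cinner_on_Times: "cinner_on (R \<times> K) f g = (\<Sum>r\<in>R. \<Sum>\<alpha>\<in>K. f (r, \<alpha>) * conjugate (g (r, \<alpha>)))"
  unfolding cinner_on_def sum.cartesian_product by (intro sum.cong) auto

text \<open>
  The two moment conditions for a family of linear forms \<open>lf u\<close> with coefficient arrays \<open>u\<close> on \<open>I\<close>,
  in a form that is stable under contraction with a further core.
\<close>

definition linear_moments ::
  "'c measure \<Rightarrow> (('i \<Rightarrow> 'a) \<Rightarrow> 'c \<Rightarrow> 'a :: real_or_complex) \<Rightarrow> 'i set \<Rightarrow> real \<Rightarrow> real \<Rightarrow> real \<Rightarrow> bool"
where
  "linear_moments P lf I s p q \<longleftrightarrow> (\<forall>u. lf u \<in> borel_measurable P) \<and>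
     (\<forall>u. (\<integral>\<^sup>+y. ennreal ((norm (lf u y))\<^sup>2) \<partial>P) = ennreal (s * norm_sq_on I u)) \<and>
     (\<forall>u w. (\<integral>\<^sup>+y. ennreal ((norm (lf u y))\<^sup>2 * (norm (lf w y))\<^sup>2) \<partial>P)
       \<le> ennreal (p * norm_sq_on I u * norm_sq_on I w + q * (norm (cinner_on I u w))\<^sup>2))"

locale wick_core = wick_family N \<tau> for N :: "real \<Rightarrow> 'a :: real_or_complex measure" and \<tau> +
  fixes ent :: "'k \<Rightarrow> 'j \<Rightarrow> 'e" and K :: "'k set" and J :: "'j set" and v :: real
  assumes inj_ent: "inj_on (\<lambda>(\<alpha>, j). ent \<alpha> j) (K \<times> J)"
    and finite_K: "finite K" and finite_J: "finite J" and v_pos: "0 < v"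
begin

abbreviation "core_law \<equiv> \<Pi>\<^sub>M e\<in>(\<lambda>(\<alpha>, j). ent \<alpha> j) ` (K \<times> J). N v"

abbreviation "form_at \<equiv> row_form J ent"

lemma ent_eq_iff:
  "\<alpha> \<in> K \<Longrightarrow> \<beta> \<in> K \<Longrightarrow> i \<in> J \<Longrightarrow> j \<in> J \<Longrightarrow> ent \<alpha> i = ent \<beta> j \<longleftrightarrow> \<alpha> = \<beta> \<and> i = j"
  using inj_onD[OF inj_ent, of "(\<alpha>, i)" "(\<beta>, j)"] by auto

text \<open>
  Wick's formula for linear forms in the rows of a core: the first pairing is always present, the
  other two couple different rows and survive only for \<open>\<alpha> = \<beta>\<close>.
\<close>

lemma wick_rows:
  assumes "\<alpha> \<in> K" "\<beta> \<in> K"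
  shows "has_bochner_integral core_law
    (\<lambda>G. form_at \<alpha> f G * conjugate (form_at \<alpha> h G) * form_at \<beta> f' G * conjugate (form_at \<beta> h' G))
    (of_real (v\<^sup>2) * (cinner_on J f h * cinner_on J f' h' + (if \<alpha> = \<beta> then cinner_on J f h' * cinner_on J f' h +
       of_real \<tau> * ((\<Sum>j\<in>J. f j * f' j) * conjugate (\<Sum>j\<in>J. h j * h' j)) else 0)))"
proof -
  define x where "x i j k l = f i * conjugate (h j) * (f' k * conjugate (h' l))" for i j k l
  have expand: "form_at \<alpha> f G * conjugate (form_at \<alpha> h G) * form_at \<beta> f' G * conjugate (form_at \<beta> h' G) =
      (\<Sum>i\<in>J. \<Sum>j\<in>J. \<Sum>k\<in>J. \<Sum>l\<in>J. x i j k l *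
        (G (ent \<alpha> i) * conjugate (G (ent \<alpha> j)) * G (ent \<beta> k) * conjugate (G (ent \<beta> l))))" for G
    unfolding row_form_def conjugate_sum sum_product_4
    by (intro sum.cong refl) (simp add: x_def conjugate_dist_mul mult_ac)
  have total: "(\<Sum>i\<in>J. \<Sum>j\<in>J. \<Sum>k\<in>J. \<Sum>l\<in>J. x i j k l *
        of_real (v\<^sup>2 * (of_bool (ent \<alpha> i = ent \<alpha> j \<and> ent \<beta> k = ent \<beta> l) +
          of_bool (ent \<alpha> i = ent \<beta> l \<and> ent \<alpha> j = ent \<beta> k) +
          \<tau> * of_bool (ent \<alpha> i = ent \<beta> k \<and> ent \<alpha> j = ent \<beta> l)))) =
      of_real (v\<^sup>2) * (cinner_on J f h * cinner_on J f' h' + (if \<alpha> = \<beta> then cinner_on J f h' * cinner_on J f' h +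
       of_real \<tau> * ((\<Sum>j\<in>J. f j * f' j) * conjugate (\<Sum>j\<in>J. h j * h' j)) else 0))"
    (is "?lhs = ?rhs")
  proof -
    have "?lhs = (\<Sum>i\<in>J. \<Sum>j\<in>J. \<Sum>k\<in>J. \<Sum>l\<in>J.
        (if i = j then (if k = l then of_real (v\<^sup>2) * x i j k l else 0) else 0) +
        (if \<alpha> = \<beta> then (if j = k then (if i = l then of_real (v\<^sup>2) * x i j k l else 0) else 0) else 0) +
        (if \<alpha> = \<beta> then (if i = k then (if j = l then of_real (v\<^sup>2) * of_real \<tau> * x i j k l else 0) else 0) else 0))"
      by (intro sum.cong refl) (auto simp: ent_eq_iff assms algebra_simps)
    also have "\<dots> = (\<Sum>i\<in>J. \<Sum>k\<in>J. of_real (v\<^sup>2) * x i i k k) +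
        (if \<alpha> = \<beta> then (\<Sum>i\<in>J. \<Sum>j\<in>J. of_real (v\<^sup>2) * x i j j i) else 0) +
        (if \<alpha> = \<beta> then (\<Sum>i\<in>J. \<Sum>j\<in>J. of_real (v\<^sup>2) * of_real \<tau> * x i j i j) else 0)"
      using finite_J by (simp add: sum.distrib sum_if_const sum.delta sum.delta' cong: if_cong)
    also have "\<dots> = ?rhs"
    proof -
      have 1: "(\<Sum>i\<in>J. \<Sum>k\<in>J. of_real (v\<^sup>2) * x i i k k) = of_real (v\<^sup>2) * (cinner_on J f h * cinner_on J f' h')"
        unfolding cinner_on_def sum_product unfolding sum_distrib_left x_def ..
      have 2: "(\<Sum>i\<in>J. \<Sum>j\<in>J. of_real (v\<^sup>2) * x i j j i) = of_real (v\<^sup>2) * (cinner_on J f h' * cinner_on J f' h)"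
        unfolding cinner_on_def sum_product unfolding sum_distrib_left x_def
        by (intro sum.cong refl) (simp add: mult_ac)
      have 3: "(\<Sum>i\<in>J. \<Sum>j\<in>J. of_real (v\<^sup>2) * of_real \<tau> * x i j i j) =
          of_real (v\<^sup>2) * (of_real \<tau> * ((\<Sum>j\<in>J. f j * f' j) * conjugate (\<Sum>j\<in>J. h j * h' j)))"
        unfolding conjugate_sum sum_product unfolding sum_distrib_left x_def
        by (intro sum.cong refl) (simp add: mult_ac conjugate_dist_mul)
      show ?thesis
        unfolding 1 2 3 by (simp add: distrib_left)
    qed
    finally show ?thesis .
  qed
  show ?thesis
    unfolding expand total[symmetric]
    by (intro has_bochner_integral_sum has_bochner_integral_mult_right quartic_moment v_pos)
       (use assms finite_K finite_J in auto)
qed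

lemma norm_wick_term_le:
  fixes f h f' h' :: "'j \<Rightarrow> 'a"
  shows "norm (of_real \<tau> * ((\<Sum>j\<in>J. f j * f' j) * conjugate (\<Sum>j\<in>J. h j * h' j)))
    \<le> sqrt (norm_sq_on J f) * sqrt (norm_sq_on J f') * (sqrt (norm_sq_on J h) * sqrt (norm_sq_on J h'))"
proof -
  have b: "norm (\<Sum>j\<in>J. f j * f' j) \<le> sqrt (norm_sq_on J f) * sqrt (norm_sq_on J f')" for f f' :: "'j \<Rightarrow> 'a"
    using cinner_on_Cauchy_Schwarz_sqrt[of J f "\<lambda>j. conjugate (f' j)"] by (simp add: cinner_on_def)
  have "norm (of_real \<tau> * ((\<Sum>j\<in>J. f j * f' j) * conjugate (\<Sum>j\<in>J. h j * h' j)))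
    \<le> 1 * (norm (\<Sum>j\<in>J. f j * f' j) * norm (\<Sum>j\<in>J. h j * h' j))"
    using \<tau>_cases by (auto simp: norm_mult)
  also have "\<dots> \<le> 1 * ((sqrt (norm_sq_on J f) * sqrt (norm_sq_on J f')) * (sqrt (norm_sq_on J h) * sqrt (norm_sq_on J h')))"
    by (intro mult_left_mono mult_mono b) auto
  finally show ?thesis by simp
qed

definition contract :: "('r \<times> 'j \<Rightarrow> 'a) \<Rightarrow> ('e \<Rightarrow> 'a) \<Rightarrow> 'r \<times> 'k \<Rightarrow> 'a" where
  "contract U G = (\<lambda>(r, \<alpha>). form_at \<alpha> (\<lambda>j. U (r, j)) G)"

text \<open>
  For a single linear form all three pairings survive. In the real case the third one equals the
  second, in the complex case it is absent.
\<close>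

lemma single_form_moment_4:
  assumes "\<alpha> \<in> K"
  shows "(\<integral>\<^sup>+G. ennreal ((norm (form_at \<alpha> f G))\<^sup>2 * (norm (form_at \<alpha> h G))\<^sup>2) \<partial>core_law)
    \<le> ennreal (v\<^sup>2 * (norm_sq_on J f * norm_sq_on J h + 2 * (norm (cinner_on J f h))\<^sup>2))"
proof -
  let ?t = "(\<Sum>j\<in>J. f j * h j) * conjugate (\<Sum>j\<in>J. f j * h j)"
  have wick: "has_bochner_integral core_law
      (\<lambda>G. form_at \<alpha> f G * conjugate (form_at \<alpha> f G) * form_at \<alpha> h G * conjugate (form_at \<alpha> h G))
      (of_real (v\<^sup>2) * (cinner_on J f f * cinner_on J h h + (cinner_on J f h * cinner_on J h f + of_real \<tau> * ?t)))"
    using wick_rows[OF assms assms, of f f h h] by (simp only: refl if_True)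
  have "(\<integral>\<^sup>+G. ennreal ((norm (form_at \<alpha> f G))\<^sup>2 * (norm (form_at \<alpha> h G))\<^sup>2) \<partial>core_law) =
    ennreal (norm (of_real (v\<^sup>2) * (cinner_on J f f * cinner_on J h h + (cinner_on J f h * cinner_on J h f + of_real \<tau> * ?t))))"
    by (rule nn_integral_of_norm[OF wick])
       (simp only: of_real_mult mult_conjugate[symmetric] mult.assoc, simp)
  also have "\<dots> \<le> ennreal (v\<^sup>2 * (norm_sq_on J f * norm_sq_on J h + 2 * (norm (cinner_on J f h))\<^sup>2))"
  proof (rule ennreal_leI)
    have c: "cinner_on J f h * cinner_on J h f = of_real ((norm (cinner_on J f h))\<^sup>2)"
      by (metis conjugate_cinner_on mult_conjugate)
    have t: "norm (of_real \<tau> * ?t) \<le> (norm (cinner_on J f h))\<^sup>2"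
      using \<tau>_cases by (auto simp: cinner_on_def norm_mult power2_eq_square)
    have "norm (of_real (v\<^sup>2) * (cinner_on J f f * cinner_on J h h + (cinner_on J f h * cinner_on J h f + of_real \<tau> * ?t)))
      \<le> v\<^sup>2 * (norm (cinner_on J f f * cinner_on J h h) + (norm (cinner_on J f h * cinner_on J h f) + norm (of_real \<tau> * ?t)))"
      unfolding norm_mult[of "of_real (v\<^sup>2)"] norm_of_real abs_power2
      by (intro mult_left_mono order_trans[OF norm_triangle_ineq add_left_mono[OF norm_triangle_ineq]]) simp
    also have "\<dots> \<le> v\<^sup>2 * (norm_sq_on J f * norm_sq_on J h + 2 * (norm (cinner_on J f h))\<^sup>2)"
      using t unfolding c cinner_on_self by (intro mult_left_mono) (simp_all add: norm_mult norm_power)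
    finally show "norm (of_real (v\<^sup>2) * (cinner_on J f f * cinner_on J h h + (cinner_on J f h * cinner_on J h f + of_real \<tau> * ?t)))
      \<le> v\<^sup>2 * (norm_sq_on J f * norm_sq_on J h + 2 * (norm (cinner_on J f h))\<^sup>2)" .
  qed
  finally show ?thesis .
qed

text \<open>
  The first pairing contributes \<open>k\<^sup>2 |U|\<^sup>2 |V|\<^sup>2\<close> for \<open>k\<close> rows, and each of the other two at most
  \<open>k |U|\<^sup>2 |V|\<^sup>2\<close>, by the Cauchy-Schwarz inequality.
\<close>

lemma contract_norm_moment_4:
  fixes U V :: "'r \<times> 'j \<Rightarrow> 'a"
  shows "(\<integral>\<^sup>+G. ennreal (norm_sq_on (R \<times> K) (contract U G) * norm_sq_on (R \<times> K) (contract V G)) \<partial>core_law)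
    \<le> ennreal (v\<^sup>2 * ((real (card K))\<^sup>2 + 2 * real (card K)) * norm_sq_on (R \<times> J) U * norm_sq_on (R \<times> J) V)"
proof -
  let ?I = "\<integral>\<^sup>+G. ennreal (norm_sq_on (R \<times> K) (contract U G) * norm_sq_on (R \<times> K) (contract V G)) \<partial>core_law"
  let ?F = "\<lambda>G. \<Sum>r\<in>R. \<Sum>\<alpha>\<in>K. \<Sum>r'\<in>R. \<Sum>\<beta>\<in>K.
      form_at \<alpha> (\<lambda>j. U (r, j)) G * conjugate (form_at \<alpha> (\<lambda>j. U (r, j)) G) * form_at \<beta> (\<lambda>j. V (r', j)) G * conjugate (form_at \<beta> (\<lambda>j. V (r', j)) G)"
  let ?b = "v\<^sup>2 * ((real (card K))\<^sup>2 + 2 * real (card K)) * norm_sq_on (R \<times> J) U * norm_sq_on (R \<times> J) V"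
  define p where "p r = norm_sq_on J (\<lambda>j. U (r, j))" for r
  define q where "q r = norm_sq_on J (\<lambda>j. V (r, j))" for r
  have nn: "0 \<le> p r" "0 \<le> q r" for r by (simp_all add: p_def q_def)
  define z where "z r \<alpha> r' \<beta> = of_real (v\<^sup>2) * (cinner_on J (\<lambda>j. U (r, j)) (\<lambda>j. U (r, j)) * cinner_on J (\<lambda>j. V (r', j)) (\<lambda>j. V (r', j)) +
      (if \<alpha> = \<beta> then cinner_on J (\<lambda>j. U (r, j)) (\<lambda>j. V (r', j)) * cinner_on J (\<lambda>j. V (r', j)) (\<lambda>j. U (r, j)) +
       of_real \<tau> * ((\<Sum>j\<in>J. U (r, j) * V (r', j)) * conjugate (\<Sum>j\<in>J. U (r, j) * V (r', j))) else 0))" for r r' and \<alpha> \<beta> :: 'k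
  let ?z = "\<Sum>r\<in>R. \<Sum>\<alpha>\<in>K. \<Sum>r'\<in>R. \<Sum>\<beta>\<in>K. z r \<alpha> r' \<beta>"
  have "has_bochner_integral core_law ?F
      ?z"
    unfolding z_def by (intro has_bochner_integral_sum wick_rows)
  then have "?I =
      ennreal (norm ?z)"
  proof (rule nn_integral_of_norm)
    fix G
    show "of_real (norm_sq_on (R \<times> K) (contract U G) * norm_sq_on (R \<times> K) (contract V G)) = ?F G"
      unfolding of_real_mult norm_sq_on_Times of_real_sum mult_conjugate[symmetric] contract_def prod.case mult.assoc
      unfolding sum_distrib_right unfolding sum_distrib_left by (simp only: mult.assoc)
  qed simp
  also have "\<dots> \<le> ennreal (?b)"
  proof (rule ennreal_leI)
    have "norm (z r \<alpha> r' \<beta>) \<le> v\<^sup>2 * (p r * q r') * (1 + 2 * of_bool (\<alpha> = \<beta>))" for r \<alpha> r' \<beta>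
    proof -
      let ?c = "cinner_on J (\<lambda>j. U (r, j)) (\<lambda>j. V (r', j)) * cinner_on J (\<lambda>j. V (r', j)) (\<lambda>j. U (r, j))"
      let ?t = "of_real \<tau> * ((\<Sum>j\<in>J. U (r, j) * V (r', j)) * conjugate (\<Sum>j\<in>J. U (r, j) * V (r', j)))"
      have s: "sqrt (p r) * sqrt (q r') * (sqrt (p r) * sqrt (q r')) = p r * q r'"
        using nn by (simp add: mult_ac)
      have c: "norm ?c \<le> p r * q r'"
      proof -
        have "norm ?c = (norm (cinner_on J (\<lambda>j. U (r, j)) (\<lambda>j. V (r', j))))\<^sup>2"
          by (simp add: norm_mult power2_eq_square norm_cinner_on_commute[of J "\<lambda>j. V (r', j)"])
        then show ?thesis
          using cinner_on_Cauchy_Schwarz[of J "\<lambda>j. U (r, j)" "\<lambda>j. V (r', j)"] by (simp add: p_def q_def)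
      qed
      have t: "norm ?t \<le> p r * q r'"
        using norm_wick_term_le[of "\<lambda>j. U (r, j)" "\<lambda>j. V (r', j)" "\<lambda>j. U (r, j)" "\<lambda>j. V (r', j)"] s
        by (simp add: p_def q_def)
      have "norm (if \<alpha> = \<beta> then ?c + ?t else 0) \<le> of_bool (\<alpha> = \<beta>) * (p r * q r' + p r * q r')"
        using c t by (auto intro: order_trans[OF norm_triangle_ineq])
      moreover have "norm (cinner_on J (\<lambda>j. U (r, j)) (\<lambda>j. U (r, j)) * cinner_on J (\<lambda>j. V (r', j)) (\<lambda>j. V (r', j))) = p r * q r'"
        by (simp add: cinner_on_self norm_mult p_def q_def)
      ultimately have "norm (z r \<alpha> r' \<beta>) \<le> v\<^sup>2 * (p r * q r' + of_bool (\<alpha> = \<beta>) * (p r * q r' + p r * q r'))"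
        unfolding z_def norm_mult[of "of_real (v\<^sup>2)"] norm_of_real abs_power2
        by (intro mult_left_mono order_trans[OF norm_triangle_ineq]) auto
      then show ?thesis by (simp add: algebra_simps)
    qed
    then have "norm ?z \<le>
        (\<Sum>r\<in>R. \<Sum>\<alpha>\<in>K. \<Sum>r'\<in>R. \<Sum>\<beta>\<in>K. v\<^sup>2 * (p r * q r') * (1 + 2 * of_bool (\<alpha> = \<beta>)))"
      by (intro sum_norm_le)
    also have "\<dots> = (\<Sum>r\<in>R. \<Sum>\<alpha>\<in>K. \<Sum>r'\<in>R. v\<^sup>2 * (p r * q r') * (real (card K) + 2))"
    proof (intro sum.cong refl)
      fix r \<alpha> r' assume "\<alpha> \<in> K"
      have "(\<Sum>\<beta>\<in>K. 1 + 2 * of_bool (\<alpha> = \<beta>)) = real (card K) + 2"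
        using \<open>\<alpha> \<in> K\<close> finite_K by (simp add: sum.distrib sum_distrib_left[symmetric] of_bool_def)
      then show "(\<Sum>\<beta>\<in>K. v\<^sup>2 * (p r * q r') * (1 + 2 * of_bool (\<alpha> = \<beta>))) = v\<^sup>2 * (p r * q r') * (real (card K) + 2)"
        unfolding sum_distrib_left[symmetric] by simp
    qed
    also have "\<dots> = v\<^sup>2 * ((real (card K))\<^sup>2 + 2 * real (card K)) * sum p R * sum q R"
      by (simp add: sum_distrib_left[symmetric] sum_distrib_right[symmetric] power2_eq_square algebra_simps)
    also have "sum p R = norm_sq_on (R \<times> J) U"
      by (simp add: p_def norm_sq_on_def sum.cartesian_product)
    also have "sum q R = norm_sq_on (R \<times> J) V"
      by (simp add: q_def norm_sq_on_def sum.cartesian_product)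
    finally show "norm ?z \<le>
      ?b" .
  qed
  finally show ?thesis .
qed

lemma form_at_covariance:
  assumes "\<alpha> \<in> K"
  shows "has_bochner_integral core_law (\<lambda>G. form_at \<alpha> f G * conjugate (form_at \<alpha> h G)) (of_real v * cinner_on J f h)"
proof -
  have expand: "form_at \<alpha> f G * conjugate (form_at \<alpha> h G) =
      (\<Sum>i\<in>J. \<Sum>j\<in>J. (f i * conjugate (h j)) * (G (ent \<alpha> i) * conjugate (G (ent \<alpha> j))))" for G
    unfolding row_form_def conjugate_sum sum_product
    by (intro sum.cong refl) (simp add: conjugate_dist_mul mult_ac)
  have total: "(\<Sum>i\<in>J. \<Sum>j\<in>J. (f i * conjugate (h j)) * of_real (v * of_bool (ent \<alpha> i = ent \<alpha> j))) =
      of_real v * cinner_on J f h"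
  proof -
    have "(\<Sum>i\<in>J. \<Sum>j\<in>J. (f i * conjugate (h j)) * of_real (v * of_bool (ent \<alpha> i = ent \<alpha> j))) =
      (\<Sum>i\<in>J. \<Sum>j\<in>J. if i = j then of_real v * (f i * conjugate (h j)) else 0)"
      by (intro sum.cong refl) (auto simp: ent_eq_iff assms)
    also have "\<dots> = of_real v * cinner_on J f h"
      using finite_J by (simp add: cinner_on_def sum_distrib_left)
    finally show ?thesis .
  qed
  show ?thesis
    unfolding expand total[symmetric]
    by (intro has_bochner_integral_sum has_bochner_integral_mult_right pair_moment v_pos)
       (use assms finite_K finite_J in auto)
qed

lemma contract_norm_moment_2:
  fixes U :: "'r \<times> 'j \<Rightarrow> 'a"
  shows "(\<integral>\<^sup>+G. ennreal (norm_sq_on (R \<times> K) (contract U G)) \<partial>core_law) =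
    ennreal (v * real (card K) * norm_sq_on (R \<times> J) U)"
proof -
  have "has_bochner_integral core_law
      (\<lambda>G. \<Sum>r\<in>R. \<Sum>\<alpha>\<in>K. form_at \<alpha> (\<lambda>j. U (r, j)) G * conjugate (form_at \<alpha> (\<lambda>j. U (r, j)) G))
      (\<Sum>r\<in>R. \<Sum>\<alpha>\<in>K. of_real v * cinner_on J (\<lambda>j. U (r, j)) (\<lambda>j. U (r, j)))"
    by (intro has_bochner_integral_sum form_at_covariance)
  then have "(\<integral>\<^sup>+G. ennreal (norm_sq_on (R \<times> K) (contract U G)) \<partial>core_law) =
      ennreal (norm (\<Sum>r\<in>R. \<Sum>\<alpha>\<in>K. (of_real v :: 'a) * cinner_on J (\<lambda>j. U (r, j)) (\<lambda>j. U (r, j))))"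
    by (rule nn_integral_of_norm)
       (simp only: norm_sq_on_Times of_real_sum mult_conjugate[symmetric] contract_def prod.case, simp)
  also have "(\<Sum>r\<in>R. \<Sum>\<alpha>\<in>K. (of_real v :: 'a) * cinner_on J (\<lambda>j. U (r, j)) (\<lambda>j. U (r, j))) =
      of_real (v * real (card K) * norm_sq_on (R \<times> J) U)"
    unfolding cinner_on_self norm_sq_on_Times
    by (simp add: norm_sq_on_def[of J] sum_distrib_left mult_ac)
  finally show ?thesis
    using v_pos by (simp add: norm_mult)
qed

text \<open>
  Here the first pairing contributes \<open>k\<^sup>2 |\<langle>U, V\<rangle>|\<^sup>2\<close>. The others need not be small compared to this,
  but they are bounded by \<open>k |U|\<^sup>2 |V|\<^sup>2\<close> each; this is where inner products turn into norms, with
  a weight that is smaller by the factor \<open>k\<close>.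
\<close>

lemma contract_inner_moment:
  fixes U V :: "'r \<times> 'j \<Rightarrow> 'a"
  shows "(\<integral>\<^sup>+G. ennreal ((norm (cinner_on (R \<times> K) (contract U G) (contract V G)))\<^sup>2) \<partial>core_law)
    \<le> ennreal (v\<^sup>2 * ((real (card K))\<^sup>2 * (norm (cinner_on (R \<times> J) U V))\<^sup>2 +
        2 * real (card K) * norm_sq_on (R \<times> J) U * norm_sq_on (R \<times> J) V))"
proof -
  let ?I = "\<integral>\<^sup>+G. ennreal ((norm (cinner_on (R \<times> K) (contract U G) (contract V G)))\<^sup>2) \<partial>core_law"
  let ?F = "\<lambda>G. \<Sum>r\<in>R. \<Sum>\<alpha>\<in>K. \<Sum>r'\<in>R. \<Sum>\<beta>\<in>K.
      form_at \<alpha> (\<lambda>j. U (r, j)) G * conjugate (form_at \<alpha> (\<lambda>j. V (r, j)) G) * form_at \<beta> (\<lambda>j. V (r', j)) G * conjugate (form_at \<beta> (\<lambda>j. U (r', j)) G)"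
  let ?b = "v\<^sup>2 * ((real (card K))\<^sup>2 * (norm (cinner_on (R \<times> J) U V))\<^sup>2 +
        2 * real (card K) * norm_sq_on (R \<times> J) U * norm_sq_on (R \<times> J) V)"
  define p where "p r = sqrt (norm_sq_on J (\<lambda>j. U (r, j)))" for r
  define q where "q r = sqrt (norm_sq_on J (\<lambda>j. V (r, j)))" for r
  have nn: "0 \<le> p r" "0 \<le> q r" for r by (simp_all add: p_def q_def)
  define c where "c r = cinner_on J (\<lambda>j. U (r, j)) (\<lambda>j. V (r, j))" for r
  define b where "b r r' = cinner_on J (\<lambda>j. U (r, j)) (\<lambda>j. U (r', j)) * cinner_on J (\<lambda>j. V (r', j)) (\<lambda>j. V (r, j)) +
       of_real \<tau> * ((\<Sum>j\<in>J. U (r, j) * V (r', j)) * conjugate (\<Sum>j\<in>J. V (r, j) * U (r', j)))" for r r'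
  define z where "z r \<alpha> r' \<beta> = of_real (v\<^sup>2) * (c r * conjugate (c r') + (if \<alpha> = \<beta> then b r r' else 0))"
    for r r' and \<alpha> \<beta> :: 'k
  let ?z = "\<Sum>r\<in>R. \<Sum>\<alpha>\<in>K. \<Sum>r'\<in>R. \<Sum>\<beta>\<in>K. z r \<alpha> r' \<beta>"
  let ?w = "of_real (v\<^sup>2) * (of_real ((real (card K))\<^sup>2) * (sum c R * conjugate (sum c R)) +
        of_real (real (card K)) * (\<Sum>r\<in>R. \<Sum>r'\<in>R. b r r'))"
  have "has_bochner_integral core_law ?F
      ?z"
    unfolding z_def b_def c_def conjugate_cinner_on by (intro has_bochner_integral_sum wick_rows)
  then have "?I =
      ennreal (norm ?z)"
  proof (rule nn_integral_of_norm)
    fix G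
    show "of_real ((norm (cinner_on (R \<times> K) (contract U G) (contract V G)))\<^sup>2) = ?F G"
      unfolding mult_conjugate[symmetric] conjugate_cinner_on
      unfolding cinner_on_Times contract_def prod.case
      unfolding sum_distrib_right unfolding sum_distrib_left by (simp only: mult.assoc)
  qed simp
  also have "\<dots> \<le> ennreal (?b)"
  proof (rule ennreal_leI)
    have b: "norm (b r r') \<le> 2 * (p r * q r) * (p r' * q r')" for r r'
    proof -
      have 1: "norm (cinner_on J (\<lambda>j. U (r, j)) (\<lambda>j. U (r', j)) * cinner_on J (\<lambda>j. V (r', j)) (\<lambda>j. V (r, j))) \<le>
          (p r * p r') * (q r' * q r)"
        unfolding norm_mult p_def q_def by (intro mult_mono cinner_on_Cauchy_Schwarz_sqrt) auto
      have 2: "norm (of_real \<tau> * ((\<Sum>j\<in>J. U (r, j) * V (r', j)) * conjugate (\<Sum>j\<in>J. V (r, j) * U (r', j)))) \<le>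
          (p r * q r') * (q r * p r')"
        unfolding p_def q_def by (rule norm_wick_term_le)
      show ?thesis
        unfolding b_def using norm_triangle_le[OF add_mono[OF 1 2]] by (simp add: mult_ac)
    qed
    have "?z =
        (\<Sum>r\<in>R. \<Sum>\<alpha>\<in>K. \<Sum>r'\<in>R. of_real (v\<^sup>2) * (of_real (real (card K)) * (c r * conjugate (c r')) + b r r'))"
    proof (intro sum.cong refl)
      fix r \<alpha> r' assume "\<alpha> \<in> K"
      then show "(\<Sum>\<beta>\<in>K. z r \<alpha> r' \<beta>) = of_real (v\<^sup>2) * (of_real (real (card K)) * (c r * conjugate (c r')) + b r r')"
        using finite_K by (simp add: z_def sum_distrib_left[symmetric] sum.distrib)
    qed
    also have "\<dots> = ?w"
      unfolding conjugate_sum sum_product sum_constant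
      by (simp add: sum_distrib_left sum.distrib distrib_left power2_eq_square mult_ac)
    finally have eq: "?z =
      ?w" .
    have sc: "sum c R = cinner_on (R \<times> J) U V"
      unfolding c_def cinner_on_Times unfolding cinner_on_def ..
    have sb: "norm (\<Sum>r\<in>R. \<Sum>r'\<in>R. b r r') \<le> 2 * (norm_sq_on (R \<times> J) U * norm_sq_on (R \<times> J) V)"
    proof -
      have "norm (\<Sum>r\<in>R. \<Sum>r'\<in>R. b r r') \<le> (\<Sum>r\<in>R. \<Sum>r'\<in>R. 2 * (p r * q r) * (p r' * q r'))"
        by (intro sum_norm_le b)
      also have "\<dots> = 2 * (\<Sum>r\<in>R. p r * q r)\<^sup>2"
        unfolding power2_eq_square sum_product by (simp add: sum_distrib_left mult_ac)
      also have "\<dots> \<le> 2 * ((\<Sum>r\<in>R. (p r)\<^sup>2) * (\<Sum>r\<in>R. (q r)\<^sup>2))"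
        by (intro mult_left_mono Cauchy_Schwarz_ineq_sum) simp
      also have "(\<Sum>r\<in>R. (p r)\<^sup>2) = norm_sq_on (R \<times> J) U"
        unfolding norm_sq_on_Times p_def by (simp add: norm_sq_on_def[of J] sum_nonneg)
      also have "(\<Sum>r\<in>R. (q r)\<^sup>2) = norm_sq_on (R \<times> J) V"
        unfolding norm_sq_on_Times q_def by (simp add: norm_sq_on_def[of J] sum_nonneg)
      finally show ?thesis .
    qed
    have "norm (of_real ((real (card K))\<^sup>2) * (sum c R * conjugate (sum c R)) +
        of_real (real (card K)) * (\<Sum>r\<in>R. \<Sum>r'\<in>R. b r r')) \<le>
        (real (card K))\<^sup>2 * (norm (sum c R))\<^sup>2 + real (card K) * (2 * (norm_sq_on (R \<times> J) U * norm_sq_on (R \<times> J) V))"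
    proof (rule order_trans[OF norm_triangle_ineq], rule add_mono)
      show "norm (of_real ((real (card K))\<^sup>2) * (sum c R * conjugate (sum c R))) \<le> (real (card K))\<^sup>2 * (norm (sum c R))\<^sup>2"
        unfolding norm_mult norm_of_real by (simp add: power2_eq_square)
      show "norm (of_real (real (card K)) * (\<Sum>r\<in>R. \<Sum>r'\<in>R. b r r')) \<le> real (card K) * (2 * (norm_sq_on (R \<times> J) U * norm_sq_on (R \<times> J) V))"
        unfolding norm_mult norm_of_real using sb by (simp add: mult_left_mono)
    qed
    then show "norm ?z \<le>
      ?b"
      unfolding eq sc norm_mult[of "of_real (v\<^sup>2)"] norm_of_real abs_power2
      by (intro mult_left_mono) (simp_all add: mult_ac)
  qed
  finally show ?thesis .
qed

lemma borel_measurable_form_at [measurable]: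
  assumes "\<alpha> \<in> K"
  shows "form_at \<alpha> f \<in> borel_measurable core_law"
proof -
  have "(\<lambda>G. G (ent \<alpha> j)) \<in> borel_measurable core_law" if "j \<in> J" for j
    unfolding measurable_cong_sets[OF refl sets_N[of v], symmetric]
    by (rule measurable_component_singleton) (use assms that in auto)
  then show ?thesis
    unfolding row_form_def by (intro borel_measurable_sum borel_measurable_times) auto
qed

lemma linear_moments_single_form:
  assumes "\<alpha> \<in> K"
  shows "linear_moments core_law (\<lambda>u. form_at \<alpha> u) J v (v\<^sup>2) (2 * v\<^sup>2)"
  unfolding linear_moments_def
proof (intro conjI allI)
  fix u :: "'j \<Rightarrow> 'a"
  have "(\<integral>\<^sup>+G. ennreal ((norm (form_at \<alpha> u G))\<^sup>2) \<partial>core_law) = ennreal (norm (of_real v * cinner_on J u u))"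
    by (rule nn_integral_of_norm[OF form_at_covariance[OF assms]]) (simp_all only: mult_conjugate, simp)
  also have "norm (of_real v * cinner_on J u u) = v * norm_sq_on J u"
    using v_pos by (simp add: cinner_on_self norm_mult)
  finally show "(\<integral>\<^sup>+G. ennreal ((norm (form_at \<alpha> u G))\<^sup>2) \<partial>core_law) = ennreal (v * norm_sq_on J u)" .
next
  fix u w :: "'j \<Rightarrow> 'a"
  show "(\<integral>\<^sup>+G. ennreal ((norm (form_at \<alpha> u G))\<^sup>2 * (norm (form_at \<alpha> w G))\<^sup>2) \<partial>core_law)
      \<le> ennreal (v\<^sup>2 * norm_sq_on J u * norm_sq_on J w + 2 * v\<^sup>2 * (norm (cinner_on J u w))\<^sup>2)"
    using single_form_moment_4[OF assms, of u w] by (simp add: algebra_simps)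
qed (rule borel_measurable_form_at[OF assms])

text \<open>
  One step of the induction over the sites. By Fubini the entries of the old cores \<open>A\<close> are
  integrated first, with the contracted array as coefficients, and then those of the new core
  \<open>B\<close>.
\<close>

lemma linear_moments_contract:
  fixes M :: "'e \<Rightarrow> 'a measure" and R :: "'r set"
  defines "B \<equiv> (\<lambda>(\<alpha>, j). ent \<alpha> j) ` (K \<times> J)" and "k \<equiv> real (card K)"
  assumes moments: "linear_moments (\<Pi>\<^sub>M e\<in>A. M e) lf (R \<times> K) s p q"
    and nonneg: "0 \<le> s" "0 \<le> p" "0 \<le> q"
    and A: "finite A" "B \<inter> A = {}"
    and M: "product_sigma_finite M" "\<And>e. e \<in> B \<Longrightarrow> M e = N v"
    and meas: "\<And>U. lf' U \<in> borel_measurable (\<Pi>\<^sub>M e\<in>B \<union> A. M e)"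
    and step: "\<And>U x y. lf' U (merge B A (x, y)) = lf (contract U x) y"
  shows "linear_moments (\<Pi>\<^sub>M e\<in>B \<union> A. M e) lf' (R \<times> J)
    (v * k * s) (v\<^sup>2 * ((k\<^sup>2 + 2 * k) * p + 2 * k * q)) (v\<^sup>2 * k\<^sup>2 * q)"
  unfolding linear_moments_def
proof (intro conjI allI meas)
  let ?PB = "\<Pi>\<^sub>M e\<in>B \<union> A. M e"
  let ?PA = "\<Pi>\<^sub>M e\<in>A. M e"
  let ?nJ = "norm_sq_on (R \<times> J)"
  let ?m = "\<lambda>U x. norm_sq_on (R \<times> K) (contract U x)"
  interpret product_sigma_finite M by (rule M(1))
  have finite_B: "finite B" using finite_K finite_J by (simp add: B_def)
  have law: "(\<Pi>\<^sub>M e\<in>B. M e) = core_law"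
    unfolding B_def[symmetric] by (intro PiM_cong refl M(2))
  have fold: "(\<integral>\<^sup>+G. f G \<partial>?PB) = (\<integral>\<^sup>+x. (\<integral>\<^sup>+y. f (merge B A (x, y)) \<partial>?PA) \<partial>core_law)"
    if "f \<in> borel_measurable ?PB" for f
    unfolding law[symmetric] by (rule product_nn_integral_fold[OF A(2) finite_B A(1) that])
  have meas_contract: "(\<lambda>G. contract U G i) \<in> borel_measurable core_law" if "i \<in> R \<times> K" for U :: "'r \<times> 'j \<Rightarrow> 'a" and i
    using that unfolding contract_def by (cases i) (auto intro: borel_measurable_form_at)
  have meas_norm: "(\<lambda>G. norm_sq_on (R \<times> K) (contract U G)) \<in> borel_measurable core_law" for U :: "'r \<times> 'j \<Rightarrow> 'a"
    unfolding norm_sq_on_def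
    by (intro borel_measurable_sum borel_measurable_power measurable_compose[OF _ borel_measurable_norm] meas_contract)
  have meas_inner: "(\<lambda>G. norm (cinner_on (R \<times> K) (contract U G) (contract W G))) \<in> borel_measurable core_law" for U W :: "'r \<times> 'j \<Rightarrow> 'a"
    unfolding cinner_on_def
    by (intro borel_measurable_sum borel_measurable_times measurable_compose[OF _ borel_measurable_norm]
        measurable_compose[OF _ borel_measurable_conjugate] meas_contract)
  show "(\<integral>\<^sup>+G. ennreal ((norm (lf' U G))\<^sup>2) \<partial>?PB) = ennreal (v * k * s * ?nJ U)" for U
  proof -
    have "(\<integral>\<^sup>+G. ennreal ((norm (lf' U G))\<^sup>2) \<partial>?PB) =
        (\<integral>\<^sup>+x. (\<integral>\<^sup>+y. ennreal ((norm (lf (contract U x) y))\<^sup>2) \<partial>?PA) \<partial>core_law)"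
      using meas by (subst fold) (simp_all add: step)
    also have "\<dots> = (\<integral>\<^sup>+x. ennreal s * ennreal (?m U x) \<partial>core_law)"
      using moments nonneg by (simp add: linear_moments_def ennreal_mult)
    also have "\<dots> = ennreal s * ennreal (v * k * ?nJ U)"
      using contract_norm_moment_2[of R U] meas_norm
      by (subst nn_integral_cmult) (simp_all add: k_def)
    also have "\<dots> = ennreal (v * k * s * ?nJ U)"
      using nonneg v_pos by (simp add: ennreal_mult[symmetric] k_def mult_ac)
    finally show ?thesis .
  qed
  show "(\<integral>\<^sup>+G. ennreal ((norm (lf' U G))\<^sup>2 * (norm (lf' W G))\<^sup>2) \<partial>?PB)
      \<le> ennreal (v\<^sup>2 * ((k\<^sup>2 + 2 * k) * p + 2 * k * q) * ?nJ U * ?nJ W +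
         v\<^sup>2 * k\<^sup>2 * q * (norm (cinner_on (R \<times> J) U W))\<^sup>2)" for U W
  proof -
    let ?n = "?nJ U * ?nJ W" and ?c = "(norm (cinner_on (R \<times> J) U W))\<^sup>2"
    have "(\<integral>\<^sup>+G. ennreal ((norm (lf' U G))\<^sup>2 * (norm (lf' W G))\<^sup>2) \<partial>?PB) =
        (\<integral>\<^sup>+x. (\<integral>\<^sup>+y. ennreal ((norm (lf (contract U x) y))\<^sup>2 * (norm (lf (contract W x) y))\<^sup>2) \<partial>?PA) \<partial>core_law)"
      using meas by (subst fold) (simp_all add: step)
    also have "\<dots> \<le> (\<integral>\<^sup>+x. ennreal (p * ?m U x * ?m W x +
        q * (norm (cinner_on (R \<times> K) (contract U x) (contract W x)))\<^sup>2) \<partial>core_law)"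
      using moments by (intro nn_integral_mono) (simp add: linear_moments_def)
    also have "\<dots> = (\<integral>\<^sup>+x. ennreal p * ennreal (?m U x * ?m W x) +
        ennreal q * ennreal ((norm (cinner_on (R \<times> K) (contract U x) (contract W x)))\<^sup>2) \<partial>core_law)"
      using nonneg by (simp add: ennreal_mult mult.assoc)
    also have "\<dots> = ennreal p * (\<integral>\<^sup>+x. ennreal (?m U x * ?m W x) \<partial>core_law) +
        ennreal q * (\<integral>\<^sup>+x. ennreal ((norm (cinner_on (R \<times> K) (contract U x) (contract W x)))\<^sup>2) \<partial>core_law)"
      using meas_norm meas_inner by (subst nn_integral_add) (simp_all add: nn_integral_cmult)
    also have "\<dots> \<le> ennreal p * ennreal (v\<^sup>2 * (k\<^sup>2 + 2 * k) * ?nJ U * ?nJ W) +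
        ennreal q * ennreal (v\<^sup>2 * (k\<^sup>2 * ?c + 2 * k * ?nJ U * ?nJ W))"
      unfolding k_def by (intro add_mono mult_left_mono contract_norm_moment_4 contract_inner_moment) simp_all
    also have "\<dots> = ennreal (p * (v\<^sup>2 * (k\<^sup>2 + 2 * k) * ?nJ U * ?nJ W) +
        q * (v\<^sup>2 * (k\<^sup>2 * ?c + 2 * k * ?nJ U * ?nJ W)))"
      using nonneg unfolding k_def
      by (subst (1 2) ennreal_mult[symmetric]) (auto intro!: ennreal_plus[symmetric] mult_nonneg_nonneg add_nonneg_nonneg)
    also have "p * (v\<^sup>2 * (k\<^sup>2 + 2 * k) * ?nJ U * ?nJ W) +
        q * (v\<^sup>2 * (k\<^sup>2 * ?c + 2 * k * ?nJ U * ?nJ W)) =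
      v\<^sup>2 * ((k\<^sup>2 + 2 * k) * p + 2 * k * q) * ?nJ U * ?nJ W + v\<^sup>2 * k\<^sup>2 * q * ?c"
      by (simp add: algebra_simps)
    finally show ?thesis .
  qed
qed

end

section \<open>Integrating out the cores of a matrix product state\<close>

text \<open>
  The network truncated after site \<open>m + 1\<close>, whose right bond \<open>\<beta>\<close> is left open; \<open>x\<close> encodes the
  physical indices of these sites, the last one being the least significant digit.
\<close>

fun left_mps :: "nat \<Rightarrow> nat \<Rightarrow> nat \<Rightarrow> (core_entry \<Rightarrow> 'a) \<Rightarrow> nat \<Rightarrow> nat \<Rightarrow> 'a :: comm_semiring_1" where
  "left_mps d bd 0 G x \<beta> = G (First x \<beta>)"
| "left_mps d bd (Suc m) G x \<beta> =
    (\<Sum>\<alpha><bd. left_mps d bd m G (x div d) \<alpha> * G (Inner (Suc (Suc m)) \<alpha> (x mod d) \<beta>))"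

definition first_site :: "unit \<Rightarrow> nat \<times> nat \<Rightarrow> core_entry" where
  "first_site _ = (\<lambda>(i, \<beta>). First i \<beta>)"

definition inner_site :: "nat \<Rightarrow> nat \<Rightarrow> nat \<times> nat \<Rightarrow> core_entry" where
  "inner_site p \<alpha> = (\<lambda>(i, \<beta>). Inner p \<alpha> i \<beta>)"

fun left_entries :: "nat \<Rightarrow> nat \<Rightarrow> nat \<Rightarrow> core_entry set" where
  "left_entries d bd 0 = (\<lambda>(\<alpha>, j). first_site \<alpha> j) ` ({()} \<times> ({..<d} \<times> {..<bd}))"
| "left_entries d bd (Suc m) =
    (\<lambda>(\<alpha>, j). inner_site (Suc (Suc m)) \<alpha> j) ` ({..<bd} \<times> ({..<d} \<times> {..<bd})) \<union> left_entries d bd m"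

lemma finite_left_entries [simp]: "finite (left_entries d bd m)"
  by (induction m) auto

lemma left_entries_eq:
  "left_entries d bd m = {First i \<alpha> | i \<alpha>. i < d \<and> \<alpha> < bd} \<union>
     {Inner p \<alpha> i \<beta> | p \<alpha> i \<beta>. 1 < p \<and> p < Suc (Suc m) \<and> \<alpha> < bd \<and> i < d \<and> \<beta> < bd}"
proof (induction m)
  case 0
  show ?case
    by (auto simp: first_site_def image_iff Bex_def)
next
  case (Suc m)
  have "(\<lambda>(\<alpha>, j). inner_site p \<alpha> j) ` ({..<bd} \<times> ({..<d} \<times> {..<bd})) =
      {Inner p \<alpha> i \<beta> | \<alpha> i \<beta>. \<alpha> < bd \<and> i < d \<and> \<beta> < bd}" for p
    by (auto simp: inner_site_def image_iff Bex_def)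
  then show ?case
    unfolding left_entries.simps Suc.IH by (auto simp: less_Suc_eq)
qed

lemma core_entries_eq:
  "core_entries (Suc (Suc m)) d bd = (\<lambda>(\<alpha>, i). Last \<alpha> i) ` ({..<bd} \<times> {..<d}) \<union> left_entries d bd m"
  unfolding core_entries_def left_entries_eq by auto

lemma left_mps_cong:
  assumes "\<And>e. e \<in> left_entries d bd m \<Longrightarrow> G e = G' e" "x < d ^ Suc m" "\<beta> < bd"
  shows "left_mps d bd m G x \<beta> = left_mps d bd m G' x \<beta>"
  using assms
proof (induction m arbitrary: x \<beta>)
  case 0
  then show ?case by (simp add: left_entries_eq)
next
  case (Suc m)
  have "x div d < d ^ Suc m" "x mod d < d"
    using Suc.prems(2) by (cases "d = 0"; simp add: less_mult_imp_div_less mult.commute)+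
  then show ?case
    using Suc by (auto simp: left_entries_eq intro!: sum.cong arg_cong2[of _ _ _ _ "(*)"] Suc.IH)
qed

lemma borel_measurable_PiM_component:
  assumes "\<And>e. sets (M e) = sets borel" "e \<in> E"
  shows "(\<lambda>G. G e) \<in> borel_measurable (\<Pi>\<^sub>M e\<in>E. M e)"
  using measurable_component_singleton[OF assms(2), of M] unfolding measurable_cong_sets[OF refl assms(1)] .

lemma borel_measurable_left_mps:
  fixes M :: "core_entry \<Rightarrow> 'a :: real_or_complex measure"
  assumes "\<And>e. sets (M e) = sets borel" "left_entries d bd m \<subseteq> E" "x < d ^ Suc m" "\<beta> < bd"
  shows "(\<lambda>G. left_mps d bd m G x \<beta>) \<in> borel_measurable (\<Pi>\<^sub>M e\<in>E. M e)"
  using assms(2-)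
proof (induction m arbitrary: x \<beta>)
  case 0
  then show ?case
    unfolding left_mps.simps
    by (intro borel_measurable_PiM_component assms(1)) (auto simp: left_entries_eq)
next
  case (Suc m)
  have "x div d < d ^ Suc m" "x mod d < d"
    using Suc.prems(2) by (cases "d = 0"; simp add: less_mult_imp_div_less mult.commute)+
  moreover have "(\<lambda>G. G (Inner (Suc (Suc m)) \<alpha> (x mod d) \<beta>)) \<in> borel_measurable (\<Pi>\<^sub>M e\<in>E. M e)"
    if "\<alpha> < bd" for \<alpha>
    using Suc.prems that \<open>x mod d < d\<close>
    by (intro borel_measurable_PiM_component assms(1)) (auto simp: left_entries_eq)
  ultimately show ?case
    unfolding left_mps.simps using Suc.prems
    by (intro borel_measurable_sum borel_measurable_times Suc.IH) auto
qed

lemma bij_betw_digits: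
  "bij_betw (\<lambda>(r, i). r * d + i) ({..<c} \<times> {..<d}) {..<c * d :: nat}"
proof (rule bij_betwI[where g = "\<lambda>x. (x div d, x mod d)"])
  have "r * d + i < c * d" if "r < c" "i < d" for r i
  proof -
    have "r * d + i < Suc r * d" using that by simp
    also have "\<dots> \<le> c * d" using that by (intro mult_le_mono1) simp
    finally show ?thesis .
  qed
  then show "(\<lambda>(r, i). r * d + i) \<in> {..<c} \<times> {..<d} \<rightarrow> {..<c * d}" by auto
  show "(\<lambda>x. (x div d, x mod d)) \<in> {..<c * d} \<rightarrow> {..<c} \<times> {..<d}"
    by (cases "d = 0") (auto simp: less_mult_imp_div_less)
qed auto

lemma linear_moments_reindex:
  assumes h: "bij_betw h I I'" and m: "linear_moments P lf I s p q"
    and eq: "\<And>u y. lf' u y = lf (\<lambda>i. u (h i)) y"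
  shows "linear_moments P lf' I' s p q"
proof -
  have n: "norm_sq_on I' u = norm_sq_on I (\<lambda>i. u (h i))" for u
    unfolding norm_sq_on_def by (rule sum.reindex_bij_betw[OF h, symmetric])
  have c: "cinner_on I' u w = cinner_on I (\<lambda>i. u (h i)) (\<lambda>i. w (h i))" for u w
    unfolding cinner_on_def by (rule sum.reindex_bij_betw[OF h, symmetric])
  have "lf' u = lf (\<lambda>i. u (h i))" for u by (rule ext) (rule eq)
  then show ?thesis
    using m unfolding linear_moments_def n c by simp
qed

definition left_form :: "nat \<Rightarrow> nat \<Rightarrow> nat \<Rightarrow> (nat \<times> nat \<Rightarrow> 'a) \<Rightarrow> (core_entry \<Rightarrow> 'a) \<Rightarrow> 'a :: comm_semiring_1" where
  "left_form d bd m u G = (\<Sum>(x, \<beta>)\<in>{..<d ^ Suc m} \<times> {..<bd}. u (x, \<beta>) * left_mps d bd m G x \<beta>)"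

lemma core_variance_pos: "0 < bd \<Longrightarrow> 0 < core_variance bd e"
  by (cases e) auto

lemma sum_PiE_insert:
  assumes "k \<notin> A"
  shows "(\<Sum>\<alpha>\<in>PiE (insert k A) (\<lambda>_. B). f \<alpha>) = (\<Sum>g\<in>PiE A (\<lambda>_. B). \<Sum>y\<in>B. f (fun_upd g k y))"
proof -
  have "(\<Sum>\<alpha>\<in>PiE (insert k A) (\<lambda>_. B). f \<alpha>) = (\<Sum>(y, g)\<in>B \<times> PiE A (\<lambda>_. B). f (fun_upd g k y))"
    unfolding PiE_insert_eq
    by (subst sum.reindex[OF inj_combinator[OF assms]]) (simp add: split_def comp_def)
  also have "\<dots> = (\<Sum>y\<in>B. \<Sum>g\<in>PiE A (\<lambda>_. B). f (fun_upd g k y))"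
    by (rule sum.cartesian_product[symmetric])
  also have "\<dots> = (\<Sum>g\<in>PiE A (\<lambda>_. B). \<Sum>y\<in>B. f (fun_upd g k y))"
    by (rule sum.swap)
  finally show ?thesis .
qed

text \<open>
  The sum over all bond assignments equals the product of transfer matrices. The function \<open>F\<close> of
  the last bond is arbitrary, so that it can absorb the next core in the induction step.
\<close>

lemma left_mps_path_sum:
  assumes "x < d ^ Suc m" "\<And>p. 1 \<le> p \<Longrightarrow> p \<le> Suc m \<Longrightarrow> i p = (x div d ^ (Suc m - p)) mod d"
  shows "(\<Sum>\<alpha>\<in>PiE {1..Suc m} (\<lambda>_. {..<bd}). G (First (i 1) (\<alpha> 1)) *
      (\<Prod>p\<in>{2..Suc m}. G (Inner p (\<alpha> (p - 1)) (i p) (\<alpha> p))) * F (\<alpha> (Suc m))) =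
    (\<Sum>\<beta><bd. left_mps d bd m G x \<beta> * F \<beta>)"
  using assms
proof (induction m arbitrary: x F)
  case 0
  have notin_empty: "Suc 0 \<notin> {}" by simp
  have "{1..Suc 0} = insert (Suc 0) {}" by auto
  moreover have "i (Suc 0) = x"
    using 0 by simp
  ultimately show ?case
    by (simp only: sum_PiE_insert[of "Suc 0" "{}", OF notin_empty]) simp
next
  case (Suc m)
  let ?q = "Suc (Suc m)"
  have x': "x div d < d ^ Suc m"
    using Suc.prems(1) by (simp add: less_mult_imp_div_less mult.commute)
  have i': "i p = ((x div d) div d ^ (Suc m - p)) mod d" if "1 \<le> p" "p \<le> Suc m" for p
    using Suc.prems(2)[of p] that by (simp add: Suc_diff_le div_mult2_eq)
  have iq: "i ?q = x mod d"
    using Suc.prems(2)[of ?q] by simp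
  have set: "{1..?q} = insert ?q {1..Suc m}" by auto
  have notin: "?q \<notin> {1..Suc m}" by simp
  have "(\<Sum>\<alpha>\<in>PiE {1..?q} (\<lambda>_. {..<bd}). G (First (i 1) (\<alpha> 1)) *
      (\<Prod>p\<in>{2..?q}. G (Inner p (\<alpha> (p - 1)) (i p) (\<alpha> p))) * F (\<alpha> ?q)) =
    (\<Sum>g\<in>PiE {1..Suc m} (\<lambda>_. {..<bd}). \<Sum>\<beta><bd. G (First (i 1) (g 1)) *
      (\<Prod>p\<in>{2..Suc m}. G (Inner p (g (p - 1)) (i p) (g p))) *
      (G (Inner ?q (g (Suc m)) (x mod d) \<beta>) * F \<beta>))"
    unfolding set sum_PiE_insert[OF notin]
  proof (intro sum.cong refl)
    fix g \<beta>
    have "(\<Prod>p\<in>{2..?q}. G (Inner p (fun_upd g ?q \<beta> (p - 1)) (i p) (fun_upd g ?q \<beta> p))) =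
        G (Inner ?q (fun_upd g ?q \<beta> (?q - 1)) (i ?q) (fun_upd g ?q \<beta> ?q)) *
        (\<Prod>p\<in>{2..Suc m}. G (Inner p (fun_upd g ?q \<beta> (p - 1)) (i p) (fun_upd g ?q \<beta> p)))"
      by (rule prod.nat_ivl_Suc') simp
    also have "(\<Prod>p\<in>{2..Suc m}. G (Inner p (fun_upd g ?q \<beta> (p - 1)) (i p) (fun_upd g ?q \<beta> p))) =
        (\<Prod>p\<in>{2..Suc m}. G (Inner p (g (p - 1)) (i p) (g p)))"
      by (intro prod.cong refl) auto
    finally have "(\<Prod>p\<in>{2..?q}. G (Inner p (fun_upd g ?q \<beta> (p - 1)) (i p) (fun_upd g ?q \<beta> p))) =
      G (Inner ?q (g (Suc m)) (x mod d) \<beta>) * (\<Prod>p\<in>{2..Suc m}. G (Inner p (g (p - 1)) (i p) (g p)))"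
      by (simp add: iq)
    then show "G (First (i 1) (fun_upd g ?q \<beta> 1)) *
      (\<Prod>p\<in>{2..?q}. G (Inner p (fun_upd g ?q \<beta> (p - 1)) (i p) (fun_upd g ?q \<beta> p))) * F (fun_upd g ?q \<beta> ?q) =
      G (First (i 1) (g 1)) * (\<Prod>p\<in>{2..Suc m}. G (Inner p (g (p - 1)) (i p) (g p))) *
      (G (Inner ?q (g (Suc m)) (x mod d) \<beta>) * F \<beta>)"
      by (simp add: mult_ac)
  qed
  also have "\<dots> = (\<Sum>\<alpha><bd. left_mps d bd m G (x div d) \<alpha> * (\<Sum>\<beta><bd. G (Inner ?q \<alpha> (x mod d) \<beta>) * F \<beta>))"
    unfolding sum_distrib_left[symmetric] by (rule Suc.IH[OF x' i'])
  also have "\<dots> = (\<Sum>\<beta><bd. \<Sum>\<alpha><bd. left_mps d bd m G (x div d) \<alpha> * (G (Inner ?q \<alpha> (x mod d) \<beta>) * F \<beta>))"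
    unfolding sum_distrib_left by (rule sum.swap)
  also have "\<dots> = (\<Sum>\<beta><bd. left_mps d bd (Suc m) G x \<beta> * F \<beta>)"
    unfolding left_mps.simps sum_distrib_right by (simp only: mult.assoc)
  finally show ?case .
qed

lemma mps_entry_left_mps:
  assumes "x < d ^ Suc (Suc m)"
  shows "mps_entry (Suc (Suc m)) bd G (multi_index (Suc (Suc m)) d x) =
    (\<Sum>\<alpha><bd. left_mps d bd m G (x div d) \<alpha> * G (Last \<alpha> (x mod d)))"
proof -
  have x': "x div d < d ^ Suc m"
    using assms by (simp add: less_mult_imp_div_less mult.commute)
  have i: "multi_index (Suc (Suc m)) d x p = ((x div d) div d ^ (Suc m - p)) mod d" if "1 \<le> p" "p \<le> Suc m" for p
    using that by (simp add: multi_index_def Suc_diff_le div_mult2_eq)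
  have last: "multi_index (Suc (Suc m)) d x (Suc (Suc m)) = x mod d"
    by (simp add: multi_index_def)
  show ?thesis
    unfolding mps_entry_def last diff_Suc_1
    by (rule left_mps_path_sum[OF x' i])
qed

context wick_family
begin

lemma product_sigma_finite_core:
  "0 < bd \<Longrightarrow> product_sigma_finite (\<lambda>e. N (core_variance bd e))"
  by (intro product_sigma_finite.intro prob_space_imp_sigma_finite prob_space_N core_variance_pos)

abbreviation left_law :: "nat \<Rightarrow> nat \<Rightarrow> nat \<Rightarrow> (core_entry \<Rightarrow> 'a) measure" where
  "left_law d bd m \<equiv> \<Pi>\<^sub>M e\<in>left_entries d bd m. N (core_variance bd e)"

lemma linear_moments_left_mps_0:
  assumes "0 < bd"
  shows "linear_moments (left_law d bd 0) (left_form d bd 0) ({..<d ^ Suc 0} \<times> {..<bd})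
    (1 / sqrt (real bd)) (1 / real bd) (2 / real bd)"
proof -
  interpret wick_core N \<tau> first_site "{()}" "{..<d} \<times> {..<bd}" "1 / sqrt (real bd)"
    by unfold_locales (use assms in \<open>auto simp: first_site_def inj_on_def\<close>)
  have law: "left_law d bd 0 = core_law"
    unfolding left_entries.simps by (intro PiM_cong refl) (auto simp: first_site_def)
  have form: "left_form d bd 0 = form_at ()"
    by (intro ext) (auto simp: left_form_def row_form_def first_site_def intro!: sum.cong)
  show ?thesis
    using linear_moments_single_form[of "()"] assms
    unfolding law form by (simp add: power_divide)
qed

text \<open>
  With variance \<open>1/\<chi>\<close> and \<open>\<chi>\<close> rows an inner core preserves the second moment and the coefficient of
  the inner product, and it maps \<open>a\<close> to \<open>(1 + 2/\<chi>) a + 4/\<chi>\<close>, i.e. \<open>a + 2\<close> to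
  \<open>(1 + 2/\<chi>) (a + 2)\<close>. The first core has the variance \<open>1/sqrt \<chi>\<close>, which leaves a factor \<open>1/sqrt \<chi>\<close> pending in the second
  moment and \<open>1/\<chi>\<close> in the fourth.
\<close>

lemma linear_moments_left_mps:
  assumes bd: "0 < bd"
  shows "linear_moments (left_law d bd m) (left_form d bd m) ({..<d ^ Suc m} \<times> {..<bd})
    (1 / sqrt (real bd)) ((3 * (1 + 2 / real bd) ^ m - 2) / real bd) (2 / real bd)"
proof (induction m)
  case 0
  show ?case
    using linear_moments_left_mps_0[OF bd, of d] by simp
next
  case (Suc m)
  let ?q = "Suc (Suc m)" and ?R = "{..<d ^ Suc m}" and ?J = "{..<d} \<times> {..<bd}"
  let ?B = "(\<lambda>(\<alpha>, j). inner_site ?q \<alpha> j) ` ({..<bd} \<times> ?J)"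
  interpret wick_core N \<tau> "inner_site ?q" "{..<bd}" ?J "1 / real bd"
    by unfold_locales (use bd in \<open>auto simp: inner_site_def inj_on_def\<close>)
  define lf :: "(nat \<times> nat \<times> nat \<Rightarrow> 'a) \<Rightarrow> (core_entry \<Rightarrow> 'a) \<Rightarrow> 'a" where
    "lf U G = (\<Sum>r\<in>?R. \<Sum>i<d. \<Sum>\<beta><bd. U (r, i, \<beta>) * left_mps d bd (Suc m) G (r * d + i) \<beta>)" for U G
  have entries: "left_entries d bd (Suc m) = ?B \<union> left_entries d bd m" by simp
  have disj: "?B \<inter> left_entries d bd m = {}"
    by (auto simp: left_entries_eq inner_site_def)
  have digit: "r * d + i < d ^ Suc (Suc m)" if "r < d ^ Suc m" "i < d" for r i
    using bij_betw_apply[OF bij_betw_digits[of d "d ^ Suc m"], of "(r, i)"] that by (simp add: mult.commute)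
  have step: "lf U (merge ?B (left_entries d bd m) (x, y)) = left_form d bd m (contract U x) y" for U x y
  proof -
    let ?G = "merge ?B (left_entries d bd m) (x, y)"
    have old: "left_mps d bd m ?G r \<alpha> = left_mps d bd m y r \<alpha>" if "r < d ^ Suc m" "\<alpha> < bd" for r \<alpha>
      using disj that by (intro left_mps_cong) (auto simp: merge_def)
    have new: "?G (Inner ?q \<alpha> i \<beta>) = x (Inner ?q \<alpha> i \<beta>)" if "\<alpha> < bd" "i < d" "\<beta> < bd" for \<alpha> i \<beta>
    proof -
      have "inner_site ?q \<alpha> (i, \<beta>) \<in> ?B"
        by (rule image_eqI[of _ _ "(\<alpha>, i, \<beta>)"]) (use that in auto)
      then have "Inner ?q \<alpha> i \<beta> \<in> ?B" by (simp add: inner_site_def)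
      then show ?thesis by (simp add: merge_def)
    qed
    have form: "form_at \<alpha> (\<lambda>j. U (r, j)) x = (\<Sum>i<d. \<Sum>\<beta><bd. U (r, i, \<beta>) * x (Inner ?q \<alpha> i \<beta>))" for r \<alpha>
      unfolding row_form_def inner_site_def sum.cartesian_product' prod.case ..
    have "lf U ?G = (\<Sum>r\<in>?R. \<Sum>i<d. \<Sum>\<beta><bd. \<Sum>\<alpha><bd. U (r, i, \<beta>) * x (Inner ?q \<alpha> i \<beta>) * left_mps d bd m y r \<alpha>)"
      unfolding lf_def left_mps.simps sum_distrib_left
      by (intro sum.cong refl) (simp add: old new mult_ac)
    also have "\<dots> = (\<Sum>r\<in>?R. \<Sum>i<d. \<Sum>\<alpha><bd. \<Sum>\<beta><bd. U (r, i, \<beta>) * x (Inner ?q \<alpha> i \<beta>) * left_mps d bd m y r \<alpha>)"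
      by (intro sum.cong refl sum.swap)
    also have "\<dots> = (\<Sum>r\<in>?R. \<Sum>\<alpha><bd. \<Sum>i<d. \<Sum>\<beta><bd. U (r, i, \<beta>) * x (Inner ?q \<alpha> i \<beta>) * left_mps d bd m y r \<alpha>)"
      by (intro sum.cong refl sum.swap)
    also have "\<dots> = (\<Sum>r\<in>?R. \<Sum>\<alpha><bd. (\<Sum>i<d. \<Sum>\<beta><bd. U (r, i, \<beta>) * x (Inner ?q \<alpha> i \<beta>)) * left_mps d bd m y r \<alpha>)"
      by (simp add: sum_distrib_right)
    also have "\<dots> = left_form d bd m (contract U x) y"
      unfolding left_form_def sum.cartesian_product[symmetric] contract_def prod.case form ..
    finally show ?thesis .
  qed
  have meas: "lf U \<in> borel_measurable (\<Pi>\<^sub>M e\<in>?B \<union> left_entries d bd m. N (core_variance bd e))" for U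
    unfolding lf_def entries[symmetric]
    by (intro borel_measurable_sum borel_measurable_times borel_measurable_left_mps digit) (auto simp: sets_N)
  have "1 \<le> (1 + 2 / real bd) ^ m" by (rule one_le_power) simp
  then have nonneg: "0 \<le> (3 * (1 + 2 / real bd) ^ m - 2) / real bd"
    by (intro divide_nonneg_nonneg, linarith) simp
  let ?p = "(1 / real bd)\<^sup>2 * (((real (card {..<bd}))\<^sup>2 + 2 * real (card {..<bd})) * ((3 * (1 + 2 / real bd) ^ m - 2) / real bd) +
        2 * real (card {..<bd}) * (2 / real bd))"
  let ?q2 = "(1 / real bd)\<^sup>2 * (real (card {..<bd}))\<^sup>2 * (2 / real bd)"
  have "linear_moments (left_law d bd (Suc m)) lf (?R \<times> ?J)
      (1 / real bd * real (card {..<bd}) * (1 / sqrt (real bd)))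
      ?p
      ?q2"
    unfolding entries
    by (rule linear_moments_contract[OF Suc.IH _ _ _ _ disj _ _ meas step])
       (use bd nonneg product_sigma_finite_core[OF bd] in \<open>auto simp: inner_site_def\<close>)
  also have "1 / real bd * real (card {..<bd}) * (1 / sqrt (real bd)) = 1 / sqrt (real bd)"
    using bd by simp
  also have "?p = (3 * (1 + 2 / real bd) ^ Suc m - 2) / real bd"
    using bd by (simp add: field_simps power2_eq_square)
  also have "?q2 = 2 / real bd"
    using bd by (simp add: power2_eq_square)
  finally have lm: "linear_moments (left_law d bd (Suc m)) lf (?R \<times> ?J)
      (1 / sqrt (real bd)) ((3 * (1 + 2 / real bd) ^ Suc m - 2) / real bd) (2 / real bd)" .
  define h where "h = (\<lambda>(r :: nat, i :: nat, \<beta> :: nat). (r * d + i, \<beta>))"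
  have h: "bij_betw h (?R \<times> ?J) ({..<d ^ Suc (Suc m)} \<times> {..<bd})"
  proof -
    have 1: "bij_betw (\<lambda>(r, i, \<beta>). ((r, i), \<beta>)) (?R \<times> ?J) ((?R \<times> {..<d}) \<times> {..<bd})"
      by (rule bij_betwI[where g = "\<lambda>((r, i), \<beta>). (r, i, \<beta>)"]) auto
    have 2: "bij_betw (map_prod (\<lambda>(r, i). r * d + i) id) ((?R \<times> {..<d}) \<times> {..<bd}) ({..<d ^ Suc m * d} \<times> {..<bd})"
      by (intro bij_betw_map_prod bij_betw_digits bij_betw_id)
    have "map_prod (\<lambda>(r, i). r * d + i) id \<circ> (\<lambda>(r, i, \<beta>). ((r, i), \<beta>)) = h"
      by (auto simp: h_def)
    moreover have "d ^ Suc m * d = d ^ Suc (Suc m)" by simp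
    ultimately show ?thesis
      using bij_betw_trans[OF 1 2] by (simp only:)
  qed
  show ?case
  proof (rule linear_moments_reindex[OF h lm])
    fix u :: "nat \<times> nat \<Rightarrow> 'a" and G
    have "left_form d bd (Suc m) u G = (\<Sum>i\<in>?R \<times> ?J. u (h i) * left_mps d bd (Suc m) G (fst (h i)) (snd (h i)))"
      unfolding left_form_def split_def prod.collapse by (rule sum.reindex_bij_betw[OF h, symmetric])
    also have "\<dots> = lf (\<lambda>i. u (h i)) G"
      unfolding lf_def h_def sum.cartesian_product' prod.case fst_conv snd_conv ..
    finally show "left_form d bd (Suc m) u G = lf (\<lambda>i. u (h i)) G" .
  qed
qed

text \<open>
  The last core has \<open>\<chi>\<close> rows and variance \<open>1/sqrt \<chi>\<close>, so contracting with it cancels the pending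
  factors.
\<close>

lemma linear_moments_mps:
  assumes bd: "0 < bd" and n: "2 \<le> n"
  shows "linear_moments (\<Pi>\<^sub>M e\<in>core_entries n d bd. N (core_variance bd e))
    (\<lambda>u G. \<Sum>x<d ^ n. u x * mps_entry n bd G (multi_index n d x)) {..<d ^ n}
    1 (3 * (1 + 2 / real bd) ^ (n - 1) - 2) 2"
proof -
  obtain m where m: "n = Suc (Suc m)"
    using n by (metis Suc_1 Suc_le_D add_2_eq_Suc le_Suc_ex)
  let ?R = "{..<d ^ Suc m}"
  let ?B = "(\<lambda>(\<alpha>, j). Last \<alpha> j) ` ({..<bd} \<times> {..<d})"
  interpret wick_core N \<tau> Last "{..<bd}" "{..<d}" "1 / sqrt (real bd)"
    by unfold_locales (use bd in \<open>auto simp: inj_on_def\<close>)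
  define lf :: "(nat \<times> nat \<Rightarrow> 'a) \<Rightarrow> (core_entry \<Rightarrow> 'a) \<Rightarrow> 'a" where
    "lf U G = (\<Sum>r\<in>?R. \<Sum>i<d. U (r, i) * (\<Sum>\<alpha><bd. left_mps d bd m G r \<alpha> * G (Last \<alpha> i)))" for U G
  have entries: "core_entries n d bd = ?B \<union> left_entries d bd m"
    unfolding m by (rule core_entries_eq)
  have disj: "?B \<inter> left_entries d bd m = {}"
    by (auto simp: left_entries_eq)
  have step: "lf U (merge ?B (left_entries d bd m) (x, y)) = left_form d bd m (contract U x) y" for U x y
  proof -
    let ?G = "merge ?B (left_entries d bd m) (x, y)"
    have old: "left_mps d bd m ?G r \<alpha> = left_mps d bd m y r \<alpha>" if "r < d ^ Suc m" "\<alpha> < bd" for r \<alpha>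
      using disj that by (intro left_mps_cong) (auto simp: merge_def)
    have new: "?G (Last \<alpha> i) = x (Last \<alpha> i)" if "\<alpha> < bd" "i < d" for \<alpha> i
      using that by (auto simp: merge_def)
    have "lf U ?G = (\<Sum>r\<in>?R. \<Sum>i<d. \<Sum>\<alpha><bd. U (r, i) * x (Last \<alpha> i) * left_mps d bd m y r \<alpha>)"
      unfolding lf_def sum_distrib_left
      by (intro sum.cong refl) (simp add: old new mult_ac)
    also have "\<dots> = (\<Sum>r\<in>?R. \<Sum>\<alpha><bd. \<Sum>i<d. U (r, i) * x (Last \<alpha> i) * left_mps d bd m y r \<alpha>)"
      by (intro sum.cong refl sum.swap)
    also have "\<dots> = left_form d bd m (contract U x) y"
      unfolding left_form_def sum.cartesian_product[symmetric] contract_def prod.case row_form_def sum_distrib_right ..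
    finally show ?thesis .
  qed
  have meas: "lf U \<in> borel_measurable (\<Pi>\<^sub>M e\<in>?B \<union> left_entries d bd m. N (core_variance bd e))" for U
    unfolding lf_def
    by (intro borel_measurable_sum borel_measurable_times borel_measurable_left_mps borel_measurable_PiM_component)
       (auto simp: sets_N)
  have "1 \<le> (1 + 2 / real bd) ^ m" by (rule one_le_power) simp
  then have nonneg: "0 \<le> (3 * (1 + 2 / real bd) ^ m - 2) / real bd"
    by (intro divide_nonneg_nonneg, linarith) simp
  let ?p = "(1 / sqrt (real bd))\<^sup>2 * (((real (card {..<bd}))\<^sup>2 + 2 * real (card {..<bd})) * ((3 * (1 + 2 / real bd) ^ m - 2) / real bd) +
        2 * real (card {..<bd}) * (2 / real bd))"
  let ?q2 = "(1 / sqrt (real bd))\<^sup>2 * (real (card {..<bd}))\<^sup>2 * (2 / real bd)"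
  have "linear_moments (\<Pi>\<^sub>M e\<in>core_entries n d bd. N (core_variance bd e)) lf (?R \<times> {..<d})
      (1 / sqrt (real bd) * real (card {..<bd}) * (1 / sqrt (real bd)))
      ?p
      ?q2"
    unfolding entries
    by (rule linear_moments_contract[OF linear_moments_left_mps[OF bd] _ _ _ _ disj _ _ meas step])
       (use bd nonneg product_sigma_finite_core[OF bd] in auto)
  also have "1 / sqrt (real bd) * real (card {..<bd}) * (1 / sqrt (real bd)) = 1"
    using bd by simp
  also have "?p = 3 * (1 + 2 / real bd) ^ (n - 1) - 2"
    using bd by (simp add: m field_simps power2_eq_square)
  also have "?q2 = 2"
    using bd by (simp add: power2_eq_square)
  finally have lm: "linear_moments (\<Pi>\<^sub>M e\<in>core_entries n d bd. N (core_variance bd e)) lf (?R \<times> {..<d})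
    1 (3 * (1 + 2 / real bd) ^ (n - 1) - 2) 2" .
  have h: "bij_betw (\<lambda>(r, i). r * d + i) (?R \<times> {..<d}) {..<d ^ n}"
    using bij_betw_digits[of d "d ^ Suc m"] by (simp add: m mult.commute)
  show ?thesis
  proof (rule linear_moments_reindex[OF h lm])
    fix u :: "nat \<Rightarrow> 'a" and G
    have "(\<Sum>x<d ^ n. u x * mps_entry n bd G (multi_index n d x)) =
        (\<Sum>x<d ^ n. u x * (\<Sum>\<alpha><bd. left_mps d bd m G (x div d) \<alpha> * G (Last \<alpha> (x mod d))))"
      by (intro sum.cong refl) (simp add: m mps_entry_left_mps)
    also have "\<dots> = (\<Sum>(r, i)\<in>?R \<times> {..<d}. u (r * d + i) * (\<Sum>\<alpha><bd. left_mps d bd m G r \<alpha> * G (Last \<alpha> i)))"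
      by (subst sum.reindex_bij_betw[OF h, symmetric]) (auto intro!: sum.cong)
    also have "\<dots> = lf (\<lambda>i. u (case i of (r, i) \<Rightarrow> r * d + i)) G"
      unfolding lf_def sum.cartesian_product[symmetric] prod.case ..
    finally show "(\<Sum>x<d ^ n. u x * mps_entry n bd G (multi_index n d x)) =
      lf (\<lambda>i. u (case i of (r, i) \<Rightarrow> r * d + i)) G" .
  qed
qed

lemma borel_measurable_mps_entry:
  assumes "2 \<le> n" "x < d ^ n"
  shows "(\<lambda>G. mps_entry n bd G (multi_index n d x)) \<in>
    borel_measurable (\<Pi>\<^sub>M e\<in>core_entries n d bd. N (core_variance bd e))"
proof -
  obtain m where m: "n = Suc (Suc m)"
    using assms(1) by (metis Suc_1 Suc_le_D add_2_eq_Suc le_Suc_ex)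
  have "x div d < d ^ Suc m" "x mod d < d"
    using assms(2) by (cases "d = 0"; simp add: m less_mult_imp_div_less mult.commute)+
  then show ?thesis
    using assms(2) unfolding m mps_entry_left_mps[OF assms(2)[unfolded m]] core_entries_eq
    by (intro borel_measurable_sum borel_measurable_times borel_measurable_left_mps borel_measurable_PiM_component)
       (auto simp: sets_N)
qed

lemma isotropic_law_rmps:
  assumes bd: "0 < bd" and n: "2 \<le> n"
  shows "isotropic_law (rmps_law N n d bd) (d ^ n) (3 * (1 + 2 / real bd) ^ (n - 1) - 2)"
proof -
  let ?P = "\<Pi>\<^sub>M e\<in>core_entries n d bd. N (core_variance bd e)"
  let ?Q = "\<Pi>\<^sub>M x\<in>{..<d ^ n}. (borel :: 'a measure)"
  let ?f = "\<lambda>G. \<lambda>x\<in>{..<d ^ n}. mps_entry n bd G (multi_index n d x)"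
  have P: "prob_space ?P"
    by (intro prob_space_PiM prob_space_N core_variance_pos bd)
  have f: "?f \<in> measurable ?P ?Q"
    by (intro measurable_restrict borel_measurable_mps_entry n) simp
  have lin: "(\<lambda>\<omega>. \<Sum>x<d ^ n. u x * \<omega> x) \<in> borel_measurable ?Q" for u
    by (intro borel_measurable_sum borel_measurable_times borel_measurable_const measurable_component_singleton)
  note lm = linear_moments_mps[OF bd n, of d, unfolded linear_moments_def]
  have eval: "(\<Sum>x<d ^ n. u x * ?f G x) = (\<Sum>x<d ^ n. u x * mps_entry n bd G (multi_index n d x))" for u G
    by (intro sum.cong) auto
  show ?thesis
  proof (intro isotropic_law.intro isotropic_law_axioms.intro)
    show "prob_space (rmps_law N n d bd)"
      unfolding rmps_law_def by (rule prob_space.prob_space_distr[OF P f])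
    show "sets (rmps_law N n d bd) = sets ?Q"
      by (simp add: rmps_law_def)
    show "1 \<le> 3 * (1 + 2 / real bd) ^ (n - 1) - 2"
      using one_le_power[of "1 + 2 / real bd" "n - 1"] by simp
    show "(\<integral>\<^sup>+\<omega>. ennreal ((norm (\<Sum>x<d ^ n. u x * \<omega> x))\<^sup>2) \<partial>rmps_law N n d bd) = ennreal (norm_sq_on {..<d ^ n} u)" for u
      unfolding rmps_law_def using lm lin[of u]
      by (subst nn_integral_distr[OF f]) (simp_all add: eval del: restrict_apply)
    show "(\<integral>\<^sup>+\<omega>. ennreal ((norm (\<Sum>x<d ^ n. u x * \<omega> x))\<^sup>2 * (norm (\<Sum>x<d ^ n. v x * \<omega> x))\<^sup>2) \<partial>rmps_law N n d bd)
      \<le> ennreal ((3 * (1 + 2 / real bd) ^ (n - 1) - 2) * norm_sq_on {..<d ^ n} u * norm_sq_on {..<d ^ n} v +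
          2 * (norm (cinner_on {..<d ^ n} u v))\<^sup>2)" for u v
      unfolding rmps_law_def using lm lin[of u] lin[of v]
      by (subst nn_integral_distr[OF f]) (simp_all add: eval del: restrict_apply)
  qed
qed

end

section \<open>Real and complex Gaussian laws\<close>

lemma gaussian_real_moment_even:
  assumes "0 < v"
  shows "has_bochner_integral (gaussian_real v) (\<lambda>x. x ^ (2 * k)) (fact (2 * k) / ((2 / v) ^ k * fact k))"
proof -
  have "has_bochner_integral lborel (\<lambda>x. normal_density 0 (sqrt v) x *\<^sub>R x ^ (2 * k)) (fact (2 * k) / ((2 / v) ^ k * fact k))"
    using normal_moment_even[of "sqrt v" 0 k] assms by simp
  then show ?thesis
    unfolding gaussian_real_def by (intro has_bochner_integral_density) auto
qed

lemma gaussian_real_moment_odd: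
  assumes "0 < v"
  shows "has_bochner_integral (gaussian_real v) (\<lambda>x. x ^ (2 * k + 1)) 0"
proof -
  have "has_bochner_integral lborel (\<lambda>x. normal_density 0 (sqrt v) x *\<^sub>R x ^ (2 * k + 1)) 0"
    using normal_moment_odd[of "sqrt v" 0 k] assms by simp
  then show ?thesis
    unfolding gaussian_real_def by (intro has_bochner_integral_density) auto
qed

lemma gaussian_real_moments:
  assumes "0 < v"
  shows "has_bochner_integral (gaussian_real v) (\<lambda>x. x) 0"
    "has_bochner_integral (gaussian_real v) (\<lambda>x. x\<^sup>2) v"
    "has_bochner_integral (gaussian_real v) (\<lambda>x. x ^ 4) (3 * v\<^sup>2)"
proof -
  show "has_bochner_integral (gaussian_real v) (\<lambda>x. x) 0"
    using gaussian_real_moment_odd[OF assms, of 0] by simp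
  show "has_bochner_integral (gaussian_real v) (\<lambda>x. x\<^sup>2) v"
    using gaussian_real_moment_even[OF assms, of 1] by simp
  show "has_bochner_integral (gaussian_real v) (\<lambda>x. x ^ 4) (3 * v\<^sup>2)"
    using gaussian_real_moment_even[OF assms, of 2] by (simp add: fact_numeral power_divide)
qed

lemma sets_gaussian_real [simp]: "sets (gaussian_real v) = sets borel"
  by (simp add: gaussian_real_def)

lemma prob_space_gaussian_real: "0 < v \<Longrightarrow> prob_space (gaussian_real v)"
  unfolding gaussian_real_def by (rule prob_space_normal_density) simp

lemma wick_family_gaussian_real: "wick_family gaussian_real 1"
proof (rule wick_family.intro)
  fix v :: real assume v: "0 < v"
  show "prob_space (gaussian_real v)" by (rule prob_space_gaussian_real[OF v])
  note m = gaussian_real_moments[OF v, unfolded has_bochner_integral_iff]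
  show "integrable (gaussian_real v) (\<lambda>x. norm x ^ 4)"
    using m(3) by simp
  show "(\<integral>x. x \<partial>gaussian_real v) = 0" "(\<integral>x. conjugate x \<partial>gaussian_real v) = 0"
    using m(1) by simp_all
  show "(\<integral>x. x * conjugate x \<partial>gaussian_real v) = of_real v"
    "(\<integral>x. x\<^sup>2 \<partial>gaussian_real v) = of_real (1 * v)"
    "(\<integral>x. (conjugate x)\<^sup>2 \<partial>gaussian_real v) = of_real (1 * v)"
    using m(2) by (simp_all add: power2_eq_square)
  have "x\<^sup>2 * (conjugate x)\<^sup>2 = x ^ 4" for x :: real
    by (simp add: power2_eq_square power4_eq_xxxx)
  then show "(\<integral>x. x\<^sup>2 * (conjugate x)\<^sup>2 \<partial>gaussian_real v) = of_real ((2 + 1) * v\<^sup>2)"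
    using m(3) by simp
qed simp_all

lemma has_bochner_integral_pair_prod:
  fixes f g :: "real \<Rightarrow> real"
  assumes M: "prob_space M1" "prob_space M2"
    and f: "has_bochner_integral M1 f a" and g: "has_bochner_integral M2 g b"
  shows "has_bochner_integral (M1 \<Otimes>\<^sub>M M2) (\<lambda>z. f (fst z) * g (snd z)) (a * b)"
proof -
  interpret M1: prob_space M1 by (rule M(1))
  interpret M2: prob_space M2 by (rule M(2))
  interpret P: pair_prob_space M1 M2 ..
  have fi: "integrable M1 f" "integral\<^sup>L M1 f = a" and gi: "integrable M2 g" "integral\<^sup>L M2 g = b"
    using f g by (simp_all add: has_bochner_integral_iff)
  have [measurable]: "f \<in> borel_measurable M1" "g \<in> borel_measurable M2"
    using fi gi by auto
  have int: "integrable (M1 \<Otimes>\<^sub>M M2) (\<lambda>z. f (fst z) * g (snd z))"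
  proof (rule P.Fubini_integrable)
    show "integrable M1 (\<lambda>x. \<integral>y. norm (f (fst (x, y)) * g (snd (x, y))) \<partial>M2)"
      using fi gi by (simp add: abs_mult)
    show "AE x in M1. integrable M2 (\<lambda>y. f (fst (x, y)) * g (snd (x, y)))"
      using gi by simp
  qed measurable
  have "(\<integral>z. f (fst z) * g (snd z) \<partial>(M1 \<Otimes>\<^sub>M M2)) = (\<integral>x. (\<integral>y. f x * g y \<partial>M2) \<partial>M1)"
    using P.integral_fst'[OF int] by simp
  also have "\<dots> = a * b"
    using fi gi by simp
  finally show ?thesis
    using int by (simp add: has_bochner_integral_iff)
qed

text \<open>
  Reduces moments of the complex Gaussian law to moments of its real and imaginary part.
\<close>

lemma has_bochner_integral_gaussian_complex:
  fixes f :: "complex \<Rightarrow> 'b :: {banach, second_countable_topology}"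
  assumes "f \<in> borel_measurable borel"
    "has_bochner_integral (gaussian_real (v / 2) \<Otimes>\<^sub>M gaussian_real (v / 2)) (\<lambda>z. f (Complex (fst z) (snd z))) c"
  shows "has_bochner_integral (gaussian_complex v) f c"
proof -
  have "(\<lambda>(x, y). Complex x y) \<in> borel_measurable (gaussian_real (v / 2) \<Otimes>\<^sub>M gaussian_real (v / 2))"
    unfolding Complex_eq measurable_cong_sets[OF sets_pair_measure_cong[OF sets_gaussian_real sets_gaussian_real] refl]
    by measurable
  then show ?thesis
    unfolding gaussian_complex_def using assms
    by (intro has_bochner_integral_distr) (simp_all add: split_def)
qed

lemma wick_family_gaussian_complex: "wick_family gaussian_complex 0"
proof (rule wick_family.intro)
  fix v :: real
  show "sets (gaussian_complex v) = sets borel" by (simp add: gaussian_complex_def)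
  assume v: "0 < v"
  let ?R = "gaussian_real (v / 2)"
  let ?Q = "?R \<Otimes>\<^sub>M ?R"
  have v2: "0 < v / 2" using v by simp
  interpret R: prob_space ?R by (rule prob_space_gaussian_real[OF v2])
  interpret Q: pair_prob_space ?R ?R ..
  have meas: "(\<lambda>(x, y). Complex x y) \<in> borel_measurable ?Q"
    unfolding Complex_eq measurable_cong_sets[OF sets_pair_measure_cong[OF sets_gaussian_real sets_gaussian_real] refl]
    by measurable
  show "prob_space (gaussian_complex v)"
    unfolding gaussian_complex_def by (rule Q.prob_space_distr[OF meas])
  note m = gaussian_real_moments[OF v2]
  have one: "has_bochner_integral ?R (\<lambda>_. 1 :: real) 1"
    by (simp add: has_bochner_integral_iff R.prob_space)
  note prod = has_bochner_integral_pair_prod[OF R.prob_space_axioms R.prob_space_axioms]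
  have x: "has_bochner_integral ?Q (\<lambda>z. fst z) 0" and y: "has_bochner_integral ?Q (\<lambda>z. snd z) 0"
    and x2: "has_bochner_integral ?Q (\<lambda>z. (fst z)\<^sup>2) (v / 2)" and y2: "has_bochner_integral ?Q (\<lambda>z. (snd z)\<^sup>2) (v / 2)"
    and xy: "has_bochner_integral ?Q (\<lambda>z. fst z * snd z) 0"
    and x4: "has_bochner_integral ?Q (\<lambda>z. (fst z) ^ 4) (3 * (v / 2)\<^sup>2)"
    and y4: "has_bochner_integral ?Q (\<lambda>z. (snd z) ^ 4) (3 * (v / 2)\<^sup>2)"
    and x2y2: "has_bochner_integral ?Q (\<lambda>z. (fst z)\<^sup>2 * (snd z)\<^sup>2) ((v / 2) * (v / 2))"
    using prod[OF m(1) one] prod[OF one m(1)] prod[OF m(2) one] prod[OF one m(2)] prod[OF m(1) m(1)]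
      prod[OF m(3) one] prod[OF one m(3)] prod[OF m(2) m(2)] by simp_all
  have r4: "has_bochner_integral ?Q (\<lambda>z. ((fst z)\<^sup>2 + (snd z)\<^sup>2)\<^sup>2) (2 * v\<^sup>2)"
  proof -
    have "has_bochner_integral ?Q (\<lambda>z. (fst z) ^ 4 + 2 * ((fst z)\<^sup>2 * (snd z)\<^sup>2) + (snd z) ^ 4)
        (3 * (v / 2)\<^sup>2 + 2 * ((v / 2) * (v / 2)) + 3 * (v / 2)\<^sup>2)"
      by (intro has_bochner_integral_add has_bochner_integral_mult_right x4 y4 x2y2)
    then show ?thesis
      by (simp add: power2_eq_square power4_eq_xxxx algebra_simps)
  qed
  have r2: "has_bochner_integral ?Q (\<lambda>z. (fst z)\<^sup>2 + (snd z)\<^sup>2) v"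
    using has_bochner_integral_add[OF x2 y2] by simp
  have [measurable]: "cnj \<in> borel_measurable borel"
    using borel_measurable_conjugate[where 'a = complex] by simp
  note of_real = has_bochner_integral_of_real[where 'a = complex]
  have "has_bochner_integral (gaussian_complex v) (\<lambda>z. norm z ^ 4) (2 * v\<^sup>2)"
  proof (rule has_bochner_integral_gaussian_complex)
    have "norm (Complex a b) ^ 4 = (a\<^sup>2 + b\<^sup>2)\<^sup>2" for a b
    proof -
      have "norm (Complex a b) ^ 4 = ((norm (Complex a b))\<^sup>2)\<^sup>2" by (simp only: power_mult[symmetric]) simp
      then show ?thesis by (simp add: cmod_power2)
    qed
    then show "has_bochner_integral ?Q (\<lambda>z. norm (Complex (fst z) (snd z)) ^ 4) (2 * v\<^sup>2)"
      using r4 by simp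
  qed measurable
  then show "integrable (gaussian_complex v) (\<lambda>z. norm z ^ 4)"
    by (simp add: has_bochner_integral_iff)
  have "has_bochner_integral (gaussian_complex v) (\<lambda>z. z) 0"
  proof (rule has_bochner_integral_gaussian_complex)
    show "has_bochner_integral ?Q (\<lambda>z. Complex (fst z) (snd z)) 0"
      using has_bochner_integral_add[OF of_real[OF x] has_bochner_integral_mult_right[OF of_real[OF y], of \<i>]]
      by (simp add: Complex_eq)
  qed measurable
  then show "(\<integral>z. z \<partial>gaussian_complex v) = 0"
    by (simp add: has_bochner_integral_iff)
  have "has_bochner_integral (gaussian_complex v) (\<lambda>z. cnj z) 0"
  proof (rule has_bochner_integral_gaussian_complex)
    show "has_bochner_integral ?Q (\<lambda>z. cnj (Complex (fst z) (snd z))) 0"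
      using has_bochner_integral_diff[OF of_real[OF x] has_bochner_integral_mult_right[OF of_real[OF y], of \<i>]]
      by (simp add: Complex_eq)
  qed measurable
  then show "(\<integral>z. conjugate z \<partial>gaussian_complex v) = 0"
    by (simp add: has_bochner_integral_iff)
  have "has_bochner_integral (gaussian_complex v) (\<lambda>z. z * cnj z) (of_real v)"
  proof (rule has_bochner_integral_gaussian_complex)
    have "Complex a b * cnj (Complex a b) = of_real (a\<^sup>2 + b\<^sup>2)" for a b
      by (simp add: complex_eq_iff power2_eq_square)
    then show "has_bochner_integral ?Q (\<lambda>z. Complex (fst z) (snd z) * cnj (Complex (fst z) (snd z))) (of_real v)"
      using of_real[OF r2] by simp
  qed measurable
  then show "(\<integral>z. z * conjugate z \<partial>gaussian_complex v) = of_real v"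
    by (simp add: has_bochner_integral_iff)
  have "has_bochner_integral (gaussian_complex v) (\<lambda>z. z\<^sup>2) 0"
  proof (rule has_bochner_integral_gaussian_complex)
    have "(Complex a b)\<^sup>2 = of_real (a\<^sup>2) - of_real (b\<^sup>2) + 2 * \<i> * of_real (a * b)" for a b
      by (simp add: complex_eq_iff power2_eq_square)
    then show "has_bochner_integral ?Q (\<lambda>z. (Complex (fst z) (snd z))\<^sup>2) 0"
      using has_bochner_integral_add[OF has_bochner_integral_diff[OF of_real[OF x2] of_real[OF y2]]
          has_bochner_integral_mult_right[OF of_real[OF xy], of "2 * \<i>"]]
      by simp
  qed measurable
  then show "(\<integral>z. z\<^sup>2 \<partial>gaussian_complex v) = of_real (0 * v)"
    by (simp add: has_bochner_integral_iff)
  have "has_bochner_integral (gaussian_complex v) (\<lambda>z. (cnj z)\<^sup>2) 0"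
  proof (rule has_bochner_integral_gaussian_complex)
    have "(cnj (Complex a b))\<^sup>2 = of_real (a\<^sup>2) - of_real (b\<^sup>2) + (- 2 * \<i>) * of_real (a * b)" for a b
      by (simp add: complex_eq_iff power2_eq_square)
    then show "has_bochner_integral ?Q (\<lambda>z. (cnj (Complex (fst z) (snd z)))\<^sup>2) 0"
      using has_bochner_integral_add[OF has_bochner_integral_diff[OF of_real[OF x2] of_real[OF y2]]
          has_bochner_integral_mult_right[OF of_real[OF xy], of "- 2 * \<i>"]]
      by simp
  qed measurable
  then show "(\<integral>z. (conjugate z)\<^sup>2 \<partial>gaussian_complex v) = of_real (0 * v)"
    by (simp add: has_bochner_integral_iff)
  have "has_bochner_integral (gaussian_complex v) (\<lambda>z. z\<^sup>2 * (cnj z)\<^sup>2) (of_real (2 * v\<^sup>2))"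
  proof (rule has_bochner_integral_gaussian_complex)
    have "(Complex a b)\<^sup>2 * (cnj (Complex a b))\<^sup>2 = of_real ((a\<^sup>2 + b\<^sup>2)\<^sup>2)" for a b
    proof -
      have "Complex a b * cnj (Complex a b) = of_real (a\<^sup>2 + b\<^sup>2)"
        by (simp add: complex_eq_iff power2_eq_square)
      then show ?thesis
        unfolding power_mult_distrib[symmetric] of_real_power by (rule arg_cong)
    qed
    then show "has_bochner_integral ?Q (\<lambda>z. (Complex (fst z) (snd z))\<^sup>2 * (cnj (Complex (fst z) (snd z)))\<^sup>2) (of_real (2 * v\<^sup>2))"
      using of_real[OF r4] by simp
  qed measurable
  then show "(\<integral>z. z\<^sup>2 * (conjugate z)\<^sup>2 \<partial>gaussian_complex v) = of_real ((2 + 0) * v\<^sup>2)"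
    by (simp add: has_bochner_integral_iff)
qed simp

section \<open>Adjoints and the Moore-Penrose pseudoinverse\<close>

lemma dim_mat_adjoint [simp]: "dim_row (mat_adjoint A) = dim_col A" "dim_col (mat_adjoint A) = dim_row A"
  by (simp_all add: mat_adjoint_def)

lemma index_mat_adjoint [simp]:
  "i < dim_col A \<Longrightarrow> j < dim_row A \<Longrightarrow> mat_adjoint A $$ (i, j) = conjugate (A $$ (j, i))"
  by (simp add: mat_adjoint_def mat_of_rows_index)

lemma mat_adjoint_carrier [simp]: "A \<in> carrier_mat n m \<Longrightarrow> mat_adjoint A \<in> carrier_mat m n"
  by (rule carrier_matI) auto

lemma index_mult_mat_sum:
  "i < dim_row A \<Longrightarrow> j < dim_col B \<Longrightarrow> dim_col A = dim_row B \<Longrightarrow>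
    (A * B) $$ (i, j) = (\<Sum>l<dim_row B. A $$ (i, l) * B $$ (l, j))"
  by (simp add: scalar_prod_def atLeast0LessThan)

lemma mat_adjoint_mat_adjoint [simp]: "mat_adjoint (mat_adjoint A) = A"
  by (rule eq_matI) simp_all

lemma mat_adjoint_mult:
  fixes A B :: "'a :: real_or_complex mat"
  assumes "dim_col A = dim_row B"
  shows "mat_adjoint (A * B) = mat_adjoint B * mat_adjoint A"
proof (rule eq_matI)
  fix i j assume "i < dim_row (mat_adjoint B * mat_adjoint A)" "j < dim_col (mat_adjoint B * mat_adjoint A)"
  then have ij: "i < dim_col B" "j < dim_row A" by simp_all
  have "mat_adjoint (A * B) $$ (i, j) = conjugate (\<Sum>l<dim_row B. A $$ (j, l) * B $$ (l, i))"
    using ij assms by (subst index_mat_adjoint) (auto simp: index_mult_mat_sum simp del: index_mult_mat(1))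
  also have "\<dots> = (\<Sum>l<dim_row B. mat_adjoint B $$ (i, l) * mat_adjoint A $$ (l, j))"
    unfolding conjugate_sum conjugate_dist_mul
    using ij assms by (intro sum.cong refl) (simp add: mult.commute)
  also have "\<dots> = (mat_adjoint B * mat_adjoint A) $$ (i, j)"
    using ij assms by (subst index_mult_mat_sum) auto
  finally show "mat_adjoint (A * B) $$ (i, j) = (mat_adjoint B * mat_adjoint A) $$ (i, j)" .
qed (simp_all add: assms)

lemma is_pseudoinverse_unique:
  fixes A X Y :: "'a :: real_or_complex mat"
  assumes X: "is_pseudoinverse A X" and Y: "is_pseudoinverse A Y"
  shows "X = Y"
proof -
  define n where "n = dim_row A"
  define m where "m = dim_col A"
  have c: "A \<in> carrier_mat n m" "X \<in> carrier_mat m n" "Y \<in> carrier_mat m n"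
    using X Y by (auto simp: is_pseudoinverse_def n_def m_def)
  note assoc = assoc_mult_mat
  have AX: "A * X = A * Y"
  proof -
    have "A * X = (A * Y * A) * X" using Y by (simp add: is_pseudoinverse_def)
    also have "\<dots> = (A * Y) * (A * X)"
      using c by (intro assoc[of _ n n _ m _ n]) auto
    finally have 1: "A * X = (A * Y) * (A * X)" .
    have "A * Y = (A * X * A) * Y" using X by (simp add: is_pseudoinverse_def)
    also have "\<dots> = (A * X) * (A * Y)"
      using c by (intro assoc[of _ n n _ m _ n]) auto
    finally have 2: "A * Y = (A * X) * (A * Y)" .
    have "A * X = mat_adjoint (A * X)" using X by (simp add: is_pseudoinverse_def hermitian_mat_def)
    also have "\<dots> = mat_adjoint (A * X) * mat_adjoint (A * Y)"
      using c by (subst 1, subst mat_adjoint_mult) auto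
    also have "\<dots> = (A * X) * (A * Y)"
      using X Y by (simp add: is_pseudoinverse_def hermitian_mat_def)
    finally show ?thesis by (rule trans[OF _ 2[symmetric]])
  qed
  have XA: "X * A = Y * A"
  proof -
    have "X * A = X * (A * Y * A)" using Y by (simp add: is_pseudoinverse_def)
    also have "\<dots> = (X * A) * (Y * A)"
      using c assoc[of A n m Y n A m] assoc[of X m n A m "Y * A" m] by simp
    finally have 1: "X * A = (X * A) * (Y * A)" .
    have "Y * A = Y * (A * X * A)" using X by (simp add: is_pseudoinverse_def)
    also have "\<dots> = (Y * A) * (X * A)"
      using c assoc[of A n m X n A m] assoc[of Y m n A m "X * A" m] by simp
    finally have 2: "Y * A = (Y * A) * (X * A)" .
    have "X * A = mat_adjoint (X * A)" using X by (simp add: is_pseudoinverse_def hermitian_mat_def)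
    also have "\<dots> = mat_adjoint (Y * A) * mat_adjoint (X * A)"
      using c by (subst 1, subst mat_adjoint_mult) auto
    also have "\<dots> = (Y * A) * (X * A)"
      using X Y by (simp add: is_pseudoinverse_def hermitian_mat_def)
    finally show ?thesis by (rule trans[OF _ 2[symmetric]])
  qed
  have "X = X * A * X" using X by (simp add: is_pseudoinverse_def)
  also have "\<dots> = X * (A * Y)"
    using c assoc[of X m n A m X n] by (simp add: AX)
  also have "\<dots> = Y * A * Y"
    using c assoc[of X m n A m Y n] by (simp add: XA)
  also have "\<dots> = Y" using Y by (simp add: is_pseudoinverse_def)
  finally show ?thesis .
qed

text \<open>
  The columns of \<open>Z\<close> solve the normal equations \<open>M\<^sup>* M z = M\<^sup>* e\<^sub>i\<close>. They exist because deflating the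
  identity by the columns of \<open>M\<close> produces the orthogonal projection \<open>1 - M Z\<close> onto the complement
  of the range of \<open>M\<close>.
\<close>

lemma normal_equation:
  fixes M :: "'a :: real_or_complex mat"
  assumes M: "M \<in> carrier_mat k k" and herm: "hermitian_mat M"
  obtains Z where "Z \<in> carrier_mat k k" "M * (M * Z) = M"
proof -
  define I :: "nat \<Rightarrow> nat \<Rightarrow> 'a" where "I x y = (if x = y then 1 else 0)" for x y
  define w where "w j x = M $$ (x, j)" for j x
  have app: "apply_kernel k I v x = v x" if "x < k" for v x
    using that by (simp add: apply_kernel_def I_def if_distrib[of "\<lambda>c. c * _"] cong: if_cong)
  have "sesq k I v v = of_real (norm_sq_on {..<k} v)" for v
    unfolding cinner_on_self[symmetric] sesq_def cinner_on_def by (simp add: app mult.commute)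
  then have I: "psd_kernel k I"
    unfolding psd_kernel_def by (simp add: I_def)
  obtain z where z: "\<And>x y. residual k k I w x y = I x y - (\<Sum>j<k. apply_kernel k I (w j) x * z j y)"
    using residual_form[OF I] by blast
  define Z where "Z = Matrix.mat k k (\<lambda>(j, y). z j y)"
  have Z: "Z \<in> carrier_mat k k" by (simp add: Z_def)
  have R: "residual k k I w x y = I x y - (M * Z) $$ (x, y)" if "x < k" "y < k" for x y
    using M that by (simp add: z app w_def index_mult_mat_sum Z_def del: index_mult_mat(1))
  have adj: "conjugate (M $$ (x, i)) = M $$ (i, x)" if "x < k" "i < k" for x i
  proof -
    have "mat_adjoint M $$ (i, x) = conjugate (M $$ (x, i))"
      using M that by (intro index_mat_adjoint) auto
    then show ?thesis
      using herm unfolding hermitian_mat_def by (metis (no_types))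
  qed
  have "(M * (M * Z)) $$ (i, y) = M $$ (i, y)" if "i < k" "y < k" for i y
  proof -
    have "(\<Sum>x<k. residual k k I w y x * w i x) = 0"
      using residual_kills[OF I \<open>i < k\<close> \<open>y < k\<close>, of w] by (simp add: apply_kernel_def)
    then have "conjugate (\<Sum>x<k. residual k k I w y x * w i x) = 0"
      by simp
    moreover have "conjugate (\<Sum>x<k. residual k k I w y x * w i x) = (\<Sum>x<k. M $$ (i, x) * residual k k I w x y)"
      unfolding conjugate_sum conjugate_dist_mul
      by (intro sum.cong refl) (simp add: psd_kernel_hermitian[OF psd_residual[OF I]] \<open>y < k\<close> \<open>i < k\<close> w_def adj mult.commute)
    moreover have "(\<Sum>x<k. M $$ (i, x) * residual k k I w x y) = (\<Sum>x<k. M $$ (i, x) * I x y) - (\<Sum>x<k. M $$ (i, x) * (M * Z) $$ (x, y))"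
      unfolding sum_subtractf[symmetric] by (intro sum.cong refl) (simp add: R \<open>y < k\<close> right_diff_distrib del: index_mult_mat(1))
    moreover have "(\<Sum>x<k. M $$ (i, x) * I x y) = M $$ (i, y)"
      using \<open>y < k\<close> by (simp add: I_def if_distrib[of "\<lambda>c. _ * c"] cong: if_cong)
    moreover have "(M * (M * Z)) $$ (i, y) = (\<Sum>x<k. M $$ (i, x) * (M * Z) $$ (x, y))"
      using M Z that by (subst index_mult_mat_sum) auto
    ultimately show ?thesis by simp
  qed
  then have "M * (M * Z) = M"
    using M Z by (intro eq_matI) auto
  then show ?thesis by (rule that[OF Z])
qed

text \<open>
  If \<open>M M Z = M\<close> then \<open>M Z\<close> is the orthogonal projection onto the range of \<open>M\<close> and \<open>Z\<^sup>* M Z\<close> is the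
  pseudoinverse.
\<close>

lemma pseudoinverse_hermitian:
  fixes M :: "'a :: real_or_complex mat"
  assumes M: "M \<in> carrier_mat k k" and herm: "hermitian_mat M"
  shows "is_pseudoinverse M (pseudoinverse M)"
proof -
  obtain Z where Z: "Z \<in> carrier_mat k k" and MMZ: "M * (M * Z) = M"
    using normal_equation[OF M herm] .
  let ?Z = "mat_adjoint Z"
  have Z': "?Z \<in> carrier_mat k k" using Z by simp
  have assoc: "A * B * C = A * (B * C)"
    if "A \<in> carrier_mat k k" "B \<in> carrier_mat k k" "C \<in> carrier_mat k k" for A B C :: "'a mat"
    using assoc_mult_mat[OF that] .
  have prod: "A * B \<in> carrier_mat k k"
    if "A \<in> carrier_mat k k" "B \<in> carrier_mat k k" for A B :: "'a mat"
    using mult_carrier_mat[OF that] .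
  have adjM: "mat_adjoint M = M" using herm by (simp add: hermitian_mat_def)
  have ZMM: "?Z * (M * M) = M"
  proof -
    have "M = mat_adjoint (M * (M * Z))" by (simp add: MMZ adjM)
    also have "\<dots> = ?Z * M * M"
      using M Z by (simp add: mat_adjoint_mult adjM)
    finally show ?thesis using assoc[OF Z' M M] by simp
  qed
  have MZ: "M * Z = ?Z * M"
  proof -
    have "M * Z = (?Z * (M * M)) * Z" by (simp add: ZMM)
    also have "\<dots> = ?Z * (M * (M * Z))"
      by (simp add: assoc prod M Z Z')
    finally show ?thesis by (simp add: MMZ)
  qed
  define X where "X = ?Z * (M * Z)"
  have X: "X \<in> carrier_mat k k" unfolding X_def by (intro prod Z Z' M)
  have MX: "M * X = M * Z"
  proof -
    have "M * X = M * (?Z * M) * Z"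
      unfolding X_def by (simp add: assoc prod M Z Z')
    also have "\<dots> = M * (M * Z) * Z" by (simp add: MZ)
    finally show ?thesis by (simp add: MMZ)
  qed
  have XM: "X * M = ?Z * M"
  proof -
    have "X * M = ?Z * ((?Z * M) * M)"
      unfolding X_def MZ by (simp add: assoc prod M Z Z')
    also have "(?Z * M) * M = M" using assoc[OF Z' M M] ZMM by simp
    finally show ?thesis .
  qed
  have "is_pseudoinverse M X"
    unfolding is_pseudoinverse_def
  proof (intro conjI)
    show "X \<in> carrier_mat (dim_col M) (dim_row M)" using X M by simp
    show "M * X * M = M"
      unfolding MX MZ using assoc[OF Z' M M] ZMM by simp
    show "X * M * X = X"
    proof -
      have "X * M * X = ?Z * (M * X)"
        unfolding XM by (rule assoc[OF Z' M X])
      also have "\<dots> = X"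
        by (subst MX) (rule X_def[symmetric])
      finally show ?thesis .
    qed
    show "hermitian_mat (M * X)" "hermitian_mat (X * M)"
      unfolding MX XM hermitian_mat_def MZ using M Z by (simp_all add: mat_adjoint_mult adjM MZ)
  qed
  then show ?thesis
    unfolding pseudoinverse_def using is_pseudoinverse_unique by (metis theI)
qed

section \<open>The residual of the Nystrom approximation is an iterated deflation\<close>

lemma deflate_scale:
  assumes "c \<noteq> 0"
  shows "deflate D B (\<lambda>x. c * w x) = deflate D B w"
proof (intro ext)
  fix x y
  have app: "apply_kernel D B (\<lambda>x. c * w x) x = c * apply_kernel D B w x" for x
    by (simp add: apply_kernel_def sum_distrib_left mult.left_commute)
  have "sesq D B (\<lambda>x. c * w x) (\<lambda>x. c * w x) = (c * conjugate c) * sesq D B w w"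
    unfolding sesq_def app sum_distrib_left
    by (intro sum.cong refl) (simp add: conjugate_dist_mul mult_ac)
  then show "deflate D B (\<lambda>x. c * w x) x y = deflate D B w x y"
    using assms by (simp add: deflate_def app conjugate_dist_mul)
qed

text \<open>
  The sketch carries a factor \<open>1/sqrt k\<close>, which deflation does not see.
\<close>

lemma residual_scale:
  "c \<noteq> 0 \<Longrightarrow> residual D k B (\<lambda>j x. c * \<omega> j x) = residual D k B \<omega>"
  by (induction k arbitrary: B) (simp_all add: deflate_scale)

text \<open>
  Two kernels \<open>B - B \<Omega> Y\<close> and \<open>B - B \<Omega> Z\<close> that are annihilated by \<open>\<Omega>\<^sup>*\<close> differ by \<open>B w\<close> columnwise,
  with \<open>w\<close> in the range of \<open>\<Omega>\<close>, so that \<open>w\<^sup>* B w = 0\<close> and hence \<open>B w = 0\<close>.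
\<close>

lemma residual_unique:
  assumes psd: "psd_kernel D B"
    and form: "\<And>x y. x < D \<Longrightarrow> y < D \<Longrightarrow> R x y = B x y - (\<Sum>j<k. apply_kernel D B (\<omega> j) x * Y j y)"
    and orth: "\<And>j y. j < k \<Longrightarrow> y < D \<Longrightarrow> (\<Sum>x<D. conjugate (\<omega> j x) * R x y) = 0"
    and x: "x < D" and y: "y < D"
  shows "R x y = residual D k B \<omega> x y"
proof -
  let ?S = "residual D k B \<omega>"
  obtain Z where Z: "\<And>x y. ?S x y = B x y - (\<Sum>j<k. apply_kernel D B (\<omega> j) x * Z j y)"
    using residual_form[OF psd] by blast
  have orth': "(\<Sum>x<D. conjugate (\<omega> j x) * ?S x y) = 0" if "j < k" for j
  proof -
    have "conjugate (\<Sum>x<D. ?S y x * \<omega> j x) = 0"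
      using residual_kills[OF psd that y, of \<omega>] by (simp add: apply_kernel_def)
    also have "conjugate (\<Sum>x<D. ?S y x * \<omega> j x) = (\<Sum>x<D. conjugate (\<omega> j x) * ?S x y)"
      unfolding conjugate_sum conjugate_dist_mul
      by (intro sum.cong refl) (simp add: psd_kernel_hermitian[OF psd_residual[OF psd]] y mult.commute)
    finally show ?thesis .
  qed
  define w where "w x = (\<Sum>j<k. (Z j y - Y j y) * \<omega> j x)" for x
  have diff: "R x y - ?S x y = apply_kernel D B w x" if "x < D" for x
  proof -
    have "apply_kernel D B w x = (\<Sum>z<D. \<Sum>j<k. (Z j y - Y j y) * (B x z * \<omega> j z))"
      unfolding apply_kernel_def w_def sum_distrib_left by (intro sum.cong refl) (simp add: mult_ac)
    also have "\<dots> = (\<Sum>j<k. (Z j y - Y j y) * apply_kernel D B (\<omega> j) x)"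
      unfolding apply_kernel_def sum_distrib_left by (rule sum.swap)
    also have "\<dots> = (\<Sum>j<k. apply_kernel D B (\<omega> j) x * Z j y) - (\<Sum>j<k. apply_kernel D B (\<omega> j) x * Y j y)"
      unfolding sum_subtractf[symmetric] by (intro sum.cong refl) (simp add: algebra_simps)
    also have "\<dots> = R x y - ?S x y"
      unfolding form[OF that y] Z by simp
    finally show ?thesis by simp
  qed
  have "sesq D B w w = (\<Sum>x<D. \<Sum>j<k. conjugate (Z j y - Y j y) * (conjugate (\<omega> j x) * (R x y - ?S x y)))"
    unfolding sesq_def
    by (intro sum.cong refl)
       (simp add: diff[symmetric] w_def conjugate_sum conjugate_dist_mul sum_distrib_right mult.assoc)
  also have "\<dots> = (\<Sum>j<k. conjugate (Z j y - Y j y) * (\<Sum>x<D. conjugate (\<omega> j x) * (R x y - ?S x y)))"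
    unfolding sum_distrib_left by (rule sum.swap)
  also have "\<dots> = 0"
    by (intro sum.neutral) (simp add: right_diff_distrib sum_subtractf orth orth' y)
  finally have "apply_kernel D B w x = 0"
    by (rule psd_kernel_null[OF psd _ x])
  then show ?thesis
    using diff[OF x] by simp
qed

definition kernel_of :: "'a mat \<Rightarrow> nat \<Rightarrow> nat \<Rightarrow> 'a" where
  "kernel_of A x y = A $$ (x, y)"

lemma cscalar_prod_kernel:
  fixes A :: "'a :: real_or_complex mat"
  assumes "A \<in> carrier_mat D D"
  shows "(A *\<^sub>v Matrix.vec D w) \<bullet>c Matrix.vec D w = sesq D (kernel_of A) w w"
  using assms
  by (simp add: scalar_prod_def sesq_def apply_kernel_def kernel_of_def atLeast0LessThan mult.commute)

lemma psd_kernel_of: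
  fixes A :: "'a :: real_or_complex mat"
  assumes A: "A \<in> carrier_mat D D" and psd: "psd_mat A"
  shows "psd_kernel D (kernel_of A)"
  unfolding psd_kernel_def
proof (intro conjI allI impI)
  fix x y assume "x < D" "y < D"
  then show "kernel_of A y x = conjugate (kernel_of A x y)"
    using psd A index_mat_adjoint[of y A x] by (simp add: psd_mat_def hermitian_mat_def kernel_of_def)
next
  fix w
  have "0 \<le> sesq D (kernel_of A) w w"
    using psd A by (auto simp: psd_mat_def cscalar_prod_kernel[OF A, symmetric])
  then show "sesq D (kernel_of A) w w = of_real (norm (sesq D (kernel_of A) w w))"
    by (rule nonneg_eq_norm)
qed

text \<open>
  The matrix \<open>A - A\<langle>\<Omega>\<rangle>\<close> has the form \<open>A - A \<Omega> Y\<close>, so by \<open>residual_unique\<close> it remains to see that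
  \<open>\<Omega>\<^sup>*\<close> annihilates it, i.e. that \<open>E = \<Omega>\<^sup>* A - M M\<^sup>+ \<Omega>\<^sup>* A\<close> vanishes for \<open>M = \<Omega>\<^sup>* A \<Omega>\<close>. The defining
  equation \<open>M M\<^sup>+ M = M\<close> gives \<open>E \<Omega> = 0\<close>; as \<open>E = Z \<Omega>\<^sup>* A\<close>, every row \<open>w\<^sup>* A\<close> of \<open>E\<close> satisfies
  \<open>w\<^sup>* A w = 0\<close>, and semidefiniteness gives \<open>w\<^sup>* A = 0\<close>.
\<close>

lemma nystrom_residual:
  fixes A :: "'a :: real_or_complex mat"
  assumes A: "A \<in> carrier_mat D D" and psd: "psd_mat A" and k: "0 < k" and x: "x < D" and y: "y < D"
  shows "(A - nystrom_approx A (sketch_mat D k \<omega>)) $$ (x, y) = residual D k (kernel_of A) \<omega> x y"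
proof -
  define s :: 'a where "s = of_real (1 / sqrt (real k))"
  have s: "s \<noteq> 0" using k by (simp add: s_def)
  define \<Omega> where "\<Omega> = sketch_mat D k \<omega>"
  let ?app = "apply_kernel D (kernel_of A)"
  let ?Wh = "mat_adjoint \<Omega>"
  have \<Omega>: "\<Omega> \<in> carrier_mat D k" by (simp add: \<Omega>_def sketch_mat_def)
  have \<Omega>_entry: "\<Omega> $$ (x, j) = s * \<omega> j x" if "x < D" "j < k" for x j
    using that by (simp add: \<Omega>_def sketch_mat_def s_def)
  have \<Omega>': "?Wh \<in> carrier_mat k D" using \<Omega> by simp
  have A_adj: "mat_adjoint A = A" using psd by (simp add: psd_mat_def hermitian_mat_def)
  note kernel = psd_kernel_of[OF A psd]
  define P where "P = ?Wh * A"
  define M where "M = P * \<Omega>"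
  define X where "X = pseudoinverse M"
  have P: "P \<in> carrier_mat k D" unfolding P_def using \<Omega>' A by (rule mult_carrier_mat)
  have M: "M \<in> carrier_mat k k" unfolding M_def using P \<Omega> by (rule mult_carrier_mat)
  have "mat_adjoint M = ?Wh * (A * \<Omega>)"
    unfolding M_def P_def using \<Omega> A by (simp add: mat_adjoint_mult A_adj)
  also have "\<dots> = M"
    unfolding M_def P_def using assoc_mult_mat[OF \<Omega>' A \<Omega>] by simp
  finally have "hermitian_mat M" by (simp add: hermitian_mat_def)
  then have pinv: "is_pseudoinverse M X"
    unfolding X_def by (rule pseudoinverse_hermitian[OF M])
  then have X: "X \<in> carrier_mat k k" and MXM: "M * X * M = M"
    using M by (simp_all add: is_pseudoinverse_def)
  have MX: "M * X \<in> carrier_mat k k" using M X by (rule mult_carrier_mat)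
  have XP: "X * P \<in> carrier_mat k D" using X P by (rule mult_carrier_mat)
  have A\<Omega>: "A * \<Omega> \<in> carrier_mat D k" using A \<Omega> by (rule mult_carrier_mat)
  define N where "N = A * \<Omega> * (X * P)"
  have N: "N \<in> carrier_mat D D" unfolding N_def using A\<Omega> XP by (rule mult_carrier_mat)
  have nystrom: "nystrom_approx A \<Omega> = N"
    unfolding nystrom_approx_def N_def P_def[symmetric] M_def[symmetric] X_def[symmetric]
    by (rule assoc_mult_mat[OF A\<Omega> X P])
  define R where "R x y = (A - N) $$ (x, y)" for x y
  have A_entry: "A $$ (x, y) = conjugate (A $$ (y, x))" if "x < D" "y < D" for x y
    using psd_kernel_hermitian[OF kernel that(2,1)] by (simp add: kernel_of_def)
  have app: "(A * \<Omega>) $$ (x, j) = ?app (\<lambda>z. s * \<omega> j z) x" if "x < D" "j < k" for x j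
    using that A \<Omega> by (subst index_mult_mat_sum) (auto simp: apply_kernel_def kernel_of_def \<Omega>_entry)
  have form: "R x y = kernel_of A x y - (\<Sum>j<k. ?app (\<lambda>z. s * \<omega> j z) x * (X * P) $$ (j, y))"
    if "x < D" "y < D" for x y
  proof -
    have "N $$ (x, y) = (\<Sum>j<k. (A * \<Omega>) $$ (x, j) * (X * P) $$ (j, y))"
      unfolding N_def using index_mult_mat_sum[of x "A * \<Omega>" y "X * P"] that
      by (simp only: carrier_matD[OF A\<Omega>] carrier_matD[OF XP] simp_thms)
    then show ?thesis
      using that A N by (simp add: R_def kernel_of_def app del: index_mult_mat(1))
  qed
  define E where "E = P - M * X * P"
  have MXP: "M * X * P \<in> carrier_mat k D" using MX P by (rule mult_carrier_mat)
  have E: "E \<in> carrier_mat k D" unfolding E_def using MXP by (rule minus_carrier_mat)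
  have E\<Omega>: "E * \<Omega> = 0\<^sub>m k k"
  proof -
    have "E * \<Omega> = P * \<Omega> - M * X * P * \<Omega>"
      unfolding E_def by (rule minus_mult_distrib_mat[OF P MXP \<Omega>])
    also have "M * X * P * \<Omega> = M * X * (P * \<Omega>)"
      by (rule assoc_mult_mat[OF MX P \<Omega>])
    also have "\<dots> = P * \<Omega>"
      using MXM by (simp add: M_def)
    finally show ?thesis
      using M by (simp add: M_def)
  qed
  define Z where "Z = 1\<^sub>m k - M * X"
  have Z: "Z \<in> carrier_mat k k" unfolding Z_def using MX by (rule minus_carrier_mat)
  have EZ: "E = Z * P"
    unfolding E_def Z_def using minus_mult_distrib_mat[OF _ MX P, of "1\<^sub>m k"] P by simp
  have P_entry: "P $$ (l, y) = (\<Sum>x<D. conjugate (\<Omega> $$ (x, l)) * A $$ (x, y))" if "l < k" "y < D" for l y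
    unfolding P_def using that \<Omega> A by (subst index_mult_mat_sum) auto
  have E0: "E $$ (j, y) = 0" if j: "j < k" and y: "y < D" for j y
  proof -
    \<comment> \<open>Row \<open>j\<close> of \<open>E\<close> is \<open>w\<^sup>* A\<close> for this combination of the sketch vectors.\<close>
    define w where "w x = (\<Sum>l<k. conjugate (Z $$ (j, l)) * \<Omega> $$ (x, l))" for x
    have e: "E $$ (j, y) = conjugate (?app w y)" if "y < D" for y
    proof -
      have "E $$ (j, y) = (\<Sum>l<k. Z $$ (j, l) * P $$ (l, y))"
        unfolding EZ using j that Z P by (subst index_mult_mat_sum) auto
      also have "\<dots> = (\<Sum>l<k. \<Sum>x<D. Z $$ (j, l) * (conjugate (\<Omega> $$ (x, l)) * A $$ (x, y)))"
        using that by (simp add: P_entry sum_distrib_left)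
      also have "\<dots> = (\<Sum>x<D. \<Sum>l<k. Z $$ (j, l) * (conjugate (\<Omega> $$ (x, l)) * A $$ (x, y)))"
        by (rule sum.swap)
      also have "\<dots> = conjugate (?app w y)"
        unfolding apply_kernel_def conjugate_sum w_def kernel_of_def conjugate_dist_mul sum_distrib_left
      proof (intro sum.cong refl)
        fix x l assume "x \<in> {..<D}" "l \<in> {..<k}"
        then show "Z $$ (j, l) * (conjugate (\<Omega> $$ (x, l)) * A $$ (x, y)) =
            conjugate (A $$ (y, x)) * (conjugate (conjugate (Z $$ (j, l))) * conjugate (\<Omega> $$ (x, l)))"
          using A_entry[of x y] that by (simp add: mult_ac)
      qed
      finally show ?thesis .
    qed
    have "conjugate (sesq D (kernel_of A) w w) = (\<Sum>y<D. w y * E $$ (j, y))"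
      unfolding sesq_def conjugate_sum conjugate_dist_mul by (intro sum.cong refl) (simp add: e)
    also have "\<dots> = (\<Sum>y<D. \<Sum>l<k. conjugate (Z $$ (j, l)) * (E $$ (j, y) * \<Omega> $$ (y, l)))"
      unfolding w_def sum_distrib_right by (intro sum.cong refl) (simp add: mult_ac)
    also have "\<dots> = (\<Sum>l<k. conjugate (Z $$ (j, l)) * (\<Sum>y<D. E $$ (j, y) * \<Omega> $$ (y, l)))"
      unfolding sum_distrib_left by (rule sum.swap)
    also have "\<dots> = 0"
    proof (intro sum.neutral ballI)
      fix l assume "l \<in> {..<k}"
      then have "(\<Sum>y<D. E $$ (j, y) * \<Omega> $$ (y, l)) = (E * \<Omega>) $$ (j, l)"
        using j E \<Omega> by (subst index_mult_mat_sum) auto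
      then show "conjugate (Z $$ (j, l)) * (\<Sum>y<D. E $$ (j, y) * \<Omega> $$ (y, l)) = 0"
        using j \<open>l \<in> {..<k}\<close> by (simp add: E\<Omega>)
    qed
    finally have "sesq D (kernel_of A) w w = 0" by simp
    then have "?app w y = 0"
      by (rule psd_kernel_null[OF kernel _ y])
    then show ?thesis using e[OF y] by simp
  qed
  have orth: "(\<Sum>x<D. conjugate (s * \<omega> j x) * R x y) = 0" if j: "j < k" and y: "y < D" for j y
  proof -
    have AN: "A - N \<in> carrier_mat D D" using N by (rule minus_carrier_mat)
    have "(\<Sum>x<D. conjugate (s * \<omega> j x) * R x y) = (?Wh * (A - N)) $$ (j, y)"
      using j y \<Omega> AN N A by (subst index_mult_mat_sum) (auto simp: R_def \<Omega>_entry)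
    also have "?Wh * (A - N) = ?Wh * A - ?Wh * N"
      by (rule mult_minus_distrib_mat[OF \<Omega>' A N])
    also have "?Wh * N = M * X * P"
    proof -
      have "?Wh * N = (?Wh * (A * \<Omega>)) * (X * P)"
        unfolding N_def by (rule assoc_mult_mat[OF \<Omega>' A\<Omega> XP, symmetric])
      also have "?Wh * (A * \<Omega>) = M"
        unfolding M_def P_def by (rule assoc_mult_mat[OF \<Omega>' A \<Omega>, symmetric])
      also have "M * (X * P) = M * X * P"
        by (rule assoc_mult_mat[OF M X P, symmetric])
      finally show ?thesis .
    qed
    also have "(?Wh * A - M * X * P) $$ (j, y) = E $$ (j, y)"
      by (simp only: E_def P_def)
    finally show ?thesis using E0[OF j y] by simp
  qed
  have "R x y = residual D k (kernel_of A) (\<lambda>j x. s * \<omega> j x) x y"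
    by (rule residual_unique[OF kernel form orth x y])
  also have "\<dots> = residual D k (kernel_of A) \<omega> x y"
    by (simp only: residual_scale[OF s])
  finally show ?thesis
    by (simp only: R_def nystrom \<Omega>_def[symmetric])
qed

lemma sesq_cong:
  "(\<And>x y. x < D \<Longrightarrow> y < D \<Longrightarrow> B x y = B' x y) \<Longrightarrow> sesq D B v w = sesq D B' v w"
  by (simp add: sesq_def apply_kernel_def)

lemma mat_trace_kernel_trace:
  fixes A :: "'a :: real_or_complex mat"
  assumes "A \<in> carrier_mat D D" "psd_mat A"
  shows "mat_trace A = of_real (kernel_trace D (kernel_of A))"
  using assms unfolding of_real_kernel_trace[OF psd_kernel_of[OF assms]]
  by (simp add: mat_trace_def kernel_of_def)

lemma nystrom_pp_error:
  fixes A :: "'a :: real_or_complex mat"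
  assumes A: "A \<in> carrier_mat D D" and psd: "psd_mat A" and k: "0 < k"
  shows "nystrom_pp k k A S - mat_trace A = of_real (nystrom_error D k (kernel_of A) S)"
proof -
  obtain \<omega> \<psi> where S: "S = (\<omega>, \<psi>)" by (cases S)
  let ?B = "nystrom_approx A (sketch_mat D k \<omega>)"
  let ?R = "residual D k (kernel_of A) \<omega>"
  note kernel = psd_kernel_of[OF A psd]
  have B: "dim_row ?B = D" "dim_col ?B = D"
    unfolding nystrom_approx_def by (simp_all only: index_mult_mat(2,3) carrier_matD[OF A])
  have AB: "A - ?B \<in> carrier_mat D D"
    by (intro carrier_matI) (simp_all only: index_minus_mat(2,3) B)
  have R: "kernel_of (A - ?B) x y = ?R x y" if "x < D" "y < D" for x y
    using nystrom_residual[OF A psd k that, of \<omega>] by (simp only: kernel_of_def[of "A - ?B"])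
  have trace: "mat_trace ?B = mat_trace A - of_real (kernel_trace D ?R)"
  proof -
    have solve: "p - q = r \<Longrightarrow> q = p - r" for p q r :: 'a
    proof -
      assume h: "p - q = r"
      show "q = p - r" unfolding h[symmetric] by simp
    qed
    have "(\<Sum>x<D. ?B $$ (x, x)) = (\<Sum>x<D. A $$ (x, x) - ?R x x)"
    proof (intro sum.cong refl)
      fix x assume "x \<in> {..<D}"
      then have "x < D" by simp
      then have "(A - ?B) $$ (x, x) = A $$ (x, x) - ?B $$ (x, x)"
        by (intro index_minus_mat(1)) (simp_all only: B)
      then have "A $$ (x, x) - ?B $$ (x, x) = ?R x x"
        unfolding nystrom_residual[OF A psd k \<open>x < D\<close> \<open>x < D\<close>] by (rule sym)
      then show "?B $$ (x, x) = A $$ (x, x) - ?R x x"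
        by (rule solve)
    qed
    then show ?thesis
      unfolding mat_trace_def of_real_kernel_trace[OF psd_residual[OF kernel]] sum_subtractf B(1)
      unfolding carrier_matD(1)[OF A] .
  qed
  have "((A - ?B) *\<^sub>v Matrix.vec D (\<psi> j)) \<bullet>c Matrix.vec D (\<psi> j) = of_real (quad D ?R (\<psi> j))" for j
    unfolding cscalar_prod_kernel[OF AB] psd_kernel_quad[OF psd_residual[OF kernel], symmetric]
    by (rule sesq_cong[OF R])
  then show ?thesis
    using A by (simp add: nystrom_pp_def S Let_def trace nystrom_error_def)
qed

section \<open>Concentration of the estimator\<close>

text \<open>
  The bond dimension is compared to \<open>n/\<epsilon>\<close> here: with \<open>bd\<close> at least
  \<open>100 n/\<epsilon>\<close> the power is at most \<open>exp (\<epsilon>/50)\<close>, so the moment constant satisfies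
  \<open>a \<le> 1 + 3 \<epsilon>/25\<close>.
\<close>

lemma compound_growth_le:
  fixes \<epsilon> :: real and bd n :: nat
  assumes n: "1 \<le> n" and \<epsilon>: "0 < \<epsilon>" "\<epsilon> \<le> 1" and bd: "100 * real n / \<epsilon> \<le> real bd"
  shows "(1 + 2 / real bd) ^ (n - 1) \<le> 1 + \<epsilon> / 25"
proof -
  have pos: "0 < real bd"
    using bd n \<epsilon> by (intro less_le_trans[OF _ bd]) simp
  have "(1 + 2 / real bd) ^ (n - 1) \<le> exp (2 / real bd) ^ (n - 1)"
    using pos by (intro power_mono exp_ge_add_one_self) simp
  also have "\<dots> = exp (real (n - 1) * (2 / real bd))"
    by (rule exp_of_nat_mult[symmetric])
  also have "\<dots> \<le> exp (\<epsilon> / 50)"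
  proof -
    have "real (n - 1) * 2 \<le> \<epsilon> / 50 * real bd"
      using bd \<epsilon> n by (simp add: field_simps of_nat_diff)
    then show ?thesis
      using pos by (simp add: field_simps)
  qed
  also have "\<dots> \<le> 1 + \<epsilon> / 50 + (\<epsilon> / 50)\<^sup>2"
    using \<epsilon> by (intro exp_bound) auto
  also have "\<dots> \<le> 1 + \<epsilon> / 25"
  proof -
    have "\<epsilon> * \<epsilon> \<le> \<epsilon> * 1" using \<epsilon> by (intro mult_left_mono) auto
    then show ?thesis using \<epsilon> by (simp add: power2_eq_square field_simps)
  qed
  finally show ?thesis .
qed

text \<open>
  With the constant 100 the relative mean square error is at most
  \<open>(3/2500 + 8/10000) \<epsilon>\<^sup>2 = 0.002 \<epsilon>\<^sup>2\<close>, well below the \<open>0.02 \<epsilon>\<^sup>2\<close> that Chebyshev's inequality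
  requires.
\<close>

theorem (in wick_family) rmps_nystrom_pp_concentration:
  fixes A :: "'a mat" and \<epsilon> :: real
  assumes n: "2 \<le> n" and A: "A \<in> carrier_mat (d ^ n) (d ^ n)" and psd: "psd_mat A"
    and \<epsilon>: "0 < \<epsilon>" "\<epsilon> \<le> 1" and bd: "100 * real n / \<epsilon> \<le> real bd" and k: "100 / \<epsilon> \<le> real k"
  shows "0.98 \<le> measure (rmps_samples N n d bd k k)
    {S \<in> space (rmps_samples N n d bd k k). norm (nystrom_pp k k A S - mat_trace A) \<le> \<epsilon> * norm (mat_trace A)}"
proof -
  have bd_pos: "0 < bd"
  proof -
    have "0 < real bd" using n \<epsilon> by (intro less_le_trans[OF _ bd]) simp
    then show ?thesis by simp
  qed
  have k_pos: "0 < k"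
  proof -
    have "0 < real k" using \<epsilon> by (intro less_le_trans[OF _ k]) simp
    then show ?thesis by simp
  qed
  let ?a = "3 * (1 + 2 / real bd) ^ (n - 1) - 2"
  interpret isotropic_law "rmps_law N n d bd" "d ^ n" ?a
    by (rule isotropic_law_rmps[OF bd_pos n])
  have a: "?a - 1 \<le> 3 * \<epsilon> / 25" "?a + 2 \<le> 4"
    using compound_growth_le[of n \<epsilon> bd] n \<epsilon> bd by simp_all
  have inv_k: "1 / real k \<le> \<epsilon> / 100"
    using k k_pos \<epsilon> by (simp add: field_simps)
  have "(?a - 1) / real k + 2 * (?a + 2) / (real k)\<^sup>2 = (?a - 1) * (1 / real k) + 2 * (?a + 2) * (1 / real k)\<^sup>2"
    by (simp add: power_divide)
  also have "\<dots> \<le> 3 * \<epsilon> / 25 * (\<epsilon> / 100) + 2 * 4 * (\<epsilon> / 100)\<^sup>2"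
    using a inv_k \<epsilon> a_ge_1 by (intro add_mono mult_mono power_mono) simp_all
  also have "\<dots> \<le> 0.02 * \<epsilon>\<^sup>2"
    using \<epsilon> by (simp add: power2_eq_square)
  finally have small: "(?a - 1) / real k + 2 * (?a + 2) / (real k)\<^sup>2 \<le> 0.02 * \<epsilon>\<^sup>2" .
  have "norm (nystrom_pp k k A S - mat_trace A) \<le> \<epsilon> * norm (mat_trace A) \<longleftrightarrow>
      \<bar>nystrom_error (d ^ n) k (kernel_of A) S\<bar> \<le> \<epsilon> * kernel_trace (d ^ n) (kernel_of A)" for S
    unfolding nystrom_pp_error[OF A psd k_pos] unfolding mat_trace_kernel_trace[OF A psd] by simp
  then show ?thesis
    using nystrom_error_concentration[OF psd_kernel_of[OF A psd] k_pos \<epsilon>(1) small]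
    unfolding rmps_samples_def by simp
qed

text \<open>
  The constants are \<open>c\<^sub>1 = 100\<close> and \<open>c\<^sub>2 = 200\<close>. In both instances the trace is real and nonnegative,
  so it agrees with its norm.
\<close>

theorem theorem3p4:
  shows "\<exists>c1 c2 :: real. c1 \<ge> 1 \<and> c2 \<ge> 2 * c1 \<and>
    (\<forall>(n :: nat) (d :: nat) (bd :: nat) (k :: nat) (l :: nat) (\<epsilon> :: real) (A :: real mat).
       n \<ge> 2 \<longrightarrow> d \<ge> 1 \<longrightarrow> bd \<ge> 1 \<longrightarrow>
       A \<in> carrier_mat (d ^ n) (d ^ n) \<longrightarrow> psd_mat A \<longrightarrow>
       0 < \<epsilon> \<longrightarrow> \<epsilon> < 1 / 2 \<longrightarrow>
       c1 * real n / \<epsilon> \<le> real bd \<longrightarrow> real bd \<le> c2 * real n / \<epsilon> \<longrightarrow>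
       k = l \<longrightarrow> c1 / \<epsilon> \<le> real k \<longrightarrow> real k \<le> c2 / \<epsilon> \<longrightarrow>
       measure (rmps_samples gaussian_real n d bd k l)
         {S \<in> space (rmps_samples gaussian_real n d bd k l).
            \<bar>nystrom_pp k l A S - mat_trace A\<bar> \<le> \<epsilon> * mat_trace A} \<ge> 0.98) \<and>
    (\<forall>(n :: nat) (d :: nat) (bd :: nat) (k :: nat) (l :: nat) (\<epsilon> :: real) (A :: complex mat).
       n \<ge> 2 \<longrightarrow> d \<ge> 1 \<longrightarrow> bd \<ge> 1 \<longrightarrow>
       A \<in> carrier_mat (d ^ n) (d ^ n) \<longrightarrow> psd_mat A \<longrightarrow>
       0 < \<epsilon> \<longrightarrow> \<epsilon> < 1 / 2 \<longrightarrow>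
       c1 * real n / \<epsilon> \<le> real bd \<longrightarrow> real bd \<le> c2 * real n / \<epsilon> \<longrightarrow>
       k = l \<longrightarrow> c1 / \<epsilon> \<le> real k \<longrightarrow> real k \<le> c2 / \<epsilon> \<longrightarrow>
       measure (rmps_samples gaussian_complex n d bd k l)
         {S \<in> space (rmps_samples gaussian_complex n d bd k l).
            cmod (nystrom_pp k l A S - mat_trace A) \<le> \<epsilon> * Re (mat_trace A)} \<ge> 0.98)"
proof -
  define c1 :: real where "c1 = 100"
  define c2 :: real where "c2 = 200"
  have "c1 \<ge> 1" "c2 \<ge> 2 * c1"
    by (simp_all add: c1_def c2_def)
  moreover have "measure (rmps_samples gaussian_real n d bd k l)
      {S \<in> space (rmps_samples gaussian_real n d bd k l).
        \<bar>nystrom_pp k l A S - mat_trace A\<bar> \<le> \<epsilon> * mat_trace A} \<ge> 0.98"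
    if "n \<ge> 2" "A \<in> carrier_mat (d ^ n) (d ^ n)" "psd_mat A" "0 < \<epsilon>" "\<epsilon> < 1 / 2"
      "c1 * real n / \<epsilon> \<le> real bd" "k = l" "c1 / \<epsilon> \<le> real k"
    for n d bd k l :: nat and \<epsilon> :: real and A :: "real mat"
  proof -
    have "norm (mat_trace A) = mat_trace A"
      unfolding mat_trace_kernel_trace[OF that(2,3)] by simp
    then show ?thesis
      using wick_family.rmps_nystrom_pp_concentration[OF wick_family_gaussian_real that(1-4), of bd k] that(5-)
      by (simp add: c1_def)
  qed
  moreover have "measure (rmps_samples gaussian_complex n d bd k l)
      {S \<in> space (rmps_samples gaussian_complex n d bd k l).
        cmod (nystrom_pp k l A S - mat_trace A) \<le> \<epsilon> * Re (mat_trace A)} \<ge> 0.98"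
    if "n \<ge> 2" "A \<in> carrier_mat (d ^ n) (d ^ n)" "psd_mat A" "0 < \<epsilon>" "\<epsilon> < 1 / 2"
      "c1 * real n / \<epsilon> \<le> real bd" "k = l" "c1 / \<epsilon> \<le> real k"
    for n d bd k l :: nat and \<epsilon> :: real and A :: "complex mat"
  proof -
    have "norm (mat_trace A) = Re (mat_trace A)"
      unfolding mat_trace_kernel_trace[OF that(2,3)] by simp
    then show ?thesis
      using wick_family.rmps_nystrom_pp_concentration[OF wick_family_gaussian_complex that(1-4), of bd k] that(5-)
      by (simp add: c1_def)
  qed
  ultimately show ?thesis
    by blast
qed

end
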